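(* Let $\mathbb{F}$ be a field, let $m$, $n$, $r\le \min\{m,n\}$ be positive integers and $d$ a non negative integer. Let $\alpha_1(s)\mid\dots\mid\alpha_r(s)$ be monic polynomials in $\mathbb{F}[s]$, let $(f_r,\dots,f_1)$ be a partition of non negative integers (so $f_r\ge\dots\ge f_1\ge 0$), and let $K(s)\in\mathbb{F}[s]^{m\times r}$ and $L(s)^T\in\mathbb{F}[s]^{n\times r}$ be minimal bases with column degrees $k_1\ge\dots\ge k_r$ and $\ell_1\ge\dots\ge\ell_r$, respectively. Let $g_1\ge\dots\ge g_r$ be the decreasing reordering of $k_r+\ell_1,\,k_{r-1}+\ell_2,\dots,k_1+\ell_r$. (Necessity, arbitrary field.) If $A(s)\in\mathbb{F}[s]^{m\times n}$ is a polynomial matrix with $\operatorname{rank}(A(s))=r$, $\deg(A(s))=d$, $\alpha_1(s),\dots,\alpha_r(s)$ as invariant factors, $f_1,\dots,f_r$ as partial multiplicities of $\infty$, $\mathcal{R}(A(s))=\mathcal{R}(K(s))$ and $\mathcal{R}(A(s)^T)=\mathcal{R}(L(s)^T)$, then $$f_1=0$$ and $$(d-g_r,\dots,d-g_1)\prec(\deg(\alpha_r)+f_r,\dots,\deg(\alpha_1)+f_1).$$ (Sufficiency.) Conversely, if $\mathbb{F}$ is algebraically closed, these two conditions are sufficient for the existence of a polynomial matrix $A(s)\in\mathbb{F}[s]^{m\times n}$ with $\operatorname{rank}(A(s))=r$, $\deg(A(s))=d$, $\alpha_1(s),\dots,\alpha_r(s)$ as invariant factors, $f_1,\dots,f_r$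 as partial multiplicities of $\infty$, $\mathcal{R}(A(s))=\mathcal{R}(K(s))$ and $\mathcal{R}(A(s)^T)=\mathcal{R}(L(s)^T)$.
   Context: $\mathbb{F}[s]$ is the ring of polynomials and $\mathbb{F}(s)$ its field of fractions. The rank of a polynomial matrix is its rank over $\mathbb{F}(s)$. The degree of a polynomial matrix is the highest degree of its entries ($-\infty$ for the zero matrix). Invariant factors: a polynomial matrix $P(s)\in\mathbb{F}[s]^{m\times n}$ of rank $r$ can be written $U(s)P(s)V(s)=\begin{bmatrix}\operatorname{diag}(\alpha_1(s),\dots,\alpha_r(s))&0\\0&0\end{bmatrix}$ (Smith form), with $U,V$ unimodular (square polynomial matrices with polynomial inverse) and $\alpha_1(s)\mid\dots\mid\alpha_r(s)$ monic; the $\alpha_i$ are uniquely determined and are the invariant factors of $P(s)$. Partial multiplicities of $\infty$: if $\deg(P(s))=d$, put $\operatorname{rev}P(t)=t^dP(1/t)$. The partial multiplicities of $\infty$ in $P(s)$ are the integers $0\le f_1\le\dots\le f_r$ where $f_i$ is the exponent of $t$ in the $i$-th invariant factor of $\operatorname{rev}P(t)$ (zero exponents included). For $P(s)\in\mathbb{F}(s)^{m\times n}$, $\mathcal{R}(P(s))\subseteq\mathbb{F}(s)^m$ is the $\mathbb{F}(s)$-subspace spanned by the columns of $P(s)$. A polynomial basis of a subspace $\mathcal{V}$ of $\mathbb{F}(s)^p$ is a basis consisting of polynomial vectors; its order is the sum of the degrees of its vectors (degree of a vector = maximum degree of its entries). A minimal basis of $\mathcal{V}$ is a polynomial basis of least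 order. A matrix $N(s)\in\mathbb{F}[s]^{m\times r}$ is called a minimal basis if its $r$ columns form a minimal basis of $\mathcal{R}(N(s))$; its column degrees are the degrees of its columns. A partition is a non-increasing sequence of non negative integers. For sequences of integers $a_1\ge\dots\ge a_r$ and $b_1\ge\dots\ge b_r$, $(a_1,\dots,a_r)\prec(b_1,\dots,b_r)$ (majorization) means $\sum_{i=1}^k a_i\le\sum_{i=1}^k b_i$ for $1\le k\le r-1$ and $\sum_{i=1}^r a_i=\sum_{i=1}^r b_i$. *)

theory Defs
  imports
    "HOL-Computational_Algebra.Polynomial_Factorial"
    "Jordan_Normal_Form.DL_Rank"
begin

text \<open>
  The field of fractions of \<open>'a poly\<close> is \<open>'a poly fract\<close>. Polynomial matrices and vectors
  are embedded into it entrywise, and rank, column space and linear independence are those of the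
  library over this field.
\<close>

abbreviation fract_mat :: "'a::field poly mat \<Rightarrow> 'a poly fract mat" where
  "fract_mat \<equiv> map_mat to_fract"

abbreviation fract_vec :: "'a::field poly vec \<Rightarrow> 'a poly fract vec" where
  "fract_vec \<equiv> map_vec to_fract"

definition poly_rank :: "'a::field poly mat \<Rightarrow> nat" where
  "poly_rank P = vec_space.rank (dim_row P) (fract_mat P)"

definition col_range :: "'a::field poly mat \<Rightarrow> 'a poly fract vec set" where
  "col_range P = vec_space.col_space (dim_row P) (fract_mat P)"

text \<open>
  The degree is \<open>nat\<close>-valued as in the library, so zero matrices and zero vectors get degree
  \<open>0\<close> instead of minus infinity. It is only used for matrices of positive rank and for members
  of bases, which are nonzero.
\<close>

definition mat_degree :: "'a::field poly mat \<Rightarrow> nat" where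
  "mat_degree P = Max (insert 0 (degree ` elements_mat P))"

definition vec_degree :: "'a::field poly vec \<Rightarrow> nat" where
  "vec_degree v = Max (insert 0 (degree ` set\<^sub>v v))"

definition smith_mat :: "nat \<Rightarrow> nat \<Rightarrow> 'a::field poly list \<Rightarrow> 'a poly mat" where
  "smith_mat m n \<alpha>s = mat m n (\<lambda>(i, j). if i = j \<and> i < length \<alpha>s then \<alpha>s ! i else 0)"

text \<open>
  \<open>invertible_mat\<close> at type \<open>'a poly mat\<close> asks for a polynomial inverse, i.e. it says that
  the matrix is unimodular.
\<close>

definition invariant_factors :: "'a::field poly mat \<Rightarrow> 'a poly list \<Rightarrow> bool" where
  "invariant_factors P \<alpha>s \<longleftrightarrow>
     length \<alpha>s = poly_rank P \<and>
     (\<forall>\<alpha>\<in>set \<alpha>s. lead_coeff \<alpha> = 1) \<and>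
     sorted_wrt (dvd) \<alpha>s \<and>
     (\<exists>U V. U \<in> carrier_mat (dim_row P) (dim_row P) \<and> invertible_mat U \<and>
            V \<in> carrier_mat (dim_col P) (dim_col P) \<and> invertible_mat V \<and>
            U * P * V = smith_mat (dim_row P) (dim_col P) \<alpha>s)"

text \<open>\<open>poly_reversal d p\<close> is \<open>t\<^sup>d p(1/t)\<close>, for \<open>degree p \<le> d\<close>.\<close>

definition poly_reversal :: "nat \<Rightarrow> 'a::field poly \<Rightarrow> 'a poly" where
  "poly_reversal d p = (\<Sum>k\<le>d. monom (coeff p k) (d - k))"

definition mat_reversal :: "'a::field poly mat \<Rightarrow> 'a poly mat" where
  "mat_reversal P = map_mat (poly_reversal (mat_degree P)) P"

text \<open>
  The exponent of \<open>t\<close> in \<open>\<beta>\<close> is \<open>order 0 \<beta>\<close>, the multiplicity of the root \<open>0\<close>. The list is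
  in non-decreasing order: its first entry is the smallest partial multiplicity.
\<close>

definition partial_multiplicities_infinity :: "'a::field poly mat \<Rightarrow> nat list \<Rightarrow> bool" where
  "partial_multiplicities_infinity P fs \<longleftrightarrow>
     (\<exists>\<beta>s. invariant_factors (mat_reversal P) \<beta>s \<and> fs = map (order 0) \<beta>s)"

definition polynomial_basis ::
    "nat \<Rightarrow> 'a::field poly fract vec set \<Rightarrow> 'a poly vec list \<Rightarrow> bool" where
  "polynomial_basis p V bs \<longleftrightarrow>
     set bs \<subseteq> carrier_vec p \<and>
     distinct bs \<and>
     \<not> LinearCombinations.module.lin_dep class_ring (module_vec TYPE('a poly fract) p) (fract_vec ` set bs) \<and>
     LinearCombinations.module.span class_ring (module_vec TYPE('a poly fract) p) (fract_vec ` set bs) = V"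

definition basis_order :: "'a::field poly vec list \<Rightarrow> nat" where
  "basis_order bs = sum_list (map vec_degree bs)"

definition minimal_basis ::
    "nat \<Rightarrow> 'a::field poly fract vec set \<Rightarrow> 'a poly vec list \<Rightarrow> bool" where
  "minimal_basis p V bs \<longleftrightarrow>
     polynomial_basis p V bs \<and>
     (\<forall>cs. polynomial_basis p V cs \<longrightarrow> basis_order bs \<le> basis_order cs)"

definition minimal_basis_mat :: "'a::field poly mat \<Rightarrow> bool" where
  "minimal_basis_mat N \<longleftrightarrow> minimal_basis (dim_row N) (col_range N) (cols N)"

definition column_degrees :: "'a::field poly mat \<Rightarrow> nat list" where
  "column_degrees N = map vec_degree (cols N)"

text \<open>Majorization, to be used for non-increasing sequences of the same length.\<close>

definition majorized :: "int list \<Rightarrow> int list \<Rightarrow> bool" (infix "\<prec>\<^sub>m" 50) where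
  "xs \<prec>\<^sub>m ys \<longleftrightarrow>
     length xs = length ys \<and>
     (\<forall>k. 1 \<le> k \<and> k < length xs \<longrightarrow> sum_list (take k xs) \<le> sum_list (take k ys)) \<and>
     sum_list xs = sum_list ys"

end

theory Submission
  imports Defs
begin

text \<open>
  A matrix \<open>A\<close> with the column space of \<open>K\<close> and the row space of \<open>L\<close> factors as
  \<open>A = K E L\<close> with a square polynomial matrix \<open>E\<close>, because minimal bases have polynomial
  one-sided inverses (\<open>factor_through\<close>). These inverses show that \<open>A\<close> and \<open>E\<close> have the same
  invariant factors. Minimal bases are also reduced at infinity, with the following two effects.
  The matrix \<open>A\<close> has degree at most \<open>d\<close> if and only if the entry \<open>(i, j)\<close> of \<open>E\<close> has degree at
  most \<open>d - k\<^sub>i - l\<^sub>j\<close> (or is zero, if this bound is negative). Moreover, the behaviour of \<open>A\<close> at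
  infinity is that of the matrix \<open>E'\<close> which results from reversing every entry of \<open>E\<close> with
  respect to its own bound (\<open>dvd_minors_reversal_KEL\<close>). So everything is a statement about \<open>E\<close>.

  Invariant factors enter only through minors: \<open>x\<close> divides all minors of order \<open>j\<close> of a matrix
  if and only if it divides the product of its first \<open>j\<close> invariant factors
  (\<open>dvd_minors_Smith\<close>). Minors are convenient since all Leibniz terms of a minor of \<open>E'\<close> are
  reversed with respect to the same total bound, so that the minor of \<open>E'\<close> is the reversal of the
  minor of \<open>E\<close> with respect to \<open>j d\<close> minus the sum of the degrees \<open>k\<close> of its rows and \<open>l\<close>
  of its columns (\<open>minor_weighted_reversal\<close>).

  Necessity: a nonzero minor of \<open>E\<close> of order \<open>j\<close> has degree at least the sum of the first \<open>j\<close>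
  numbers \<open>deg \<alpha>\<^sub>i\<close>, and its reversal vanishes at \<open>0\<close> to order at least the sum of the first \<open>j\<close>
  numbers \<open>f\<^sub>i\<close>. Hence the first \<open>j\<close> numbers \<open>deg \<alpha>\<^sub>i + f\<^sub>i\<close> add up to at most \<open>j d\<close> minus the
  total weight of rows and columns of the minor, with equality for the determinant. It remains to
  find a nonzero minor of large weight. When the \<open>k\<^sub>i\<close> are arranged increasingly and the \<open>l\<^sub>i\<close>
  decreasingly, every nonsingular matrix has, for every set \<open>S\<close> of indices, a nonzero minor at
  least as heavy as the positions \<open>(i, i)\<close> with \<open>i \<in> S\<close> (\<open>exists_heavy_minor\<close>); the weights of
  these positions are the numbers \<open>g\<close>.

  Sufficiency: choose a point \<open>c\<close> that is not a root of any \<open>\<alpha>\<^sub>i\<close>. The Moebius transformation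
  \<open>s = c + 1/z\<close> moves infinity to \<open>z = 0\<close> and \<open>c\<close> to infinity; the prescribed finite and infinite
  data become invariant factors \<open>\<gamma>\<^sub>i\<close> of degree \<open>deg \<alpha>\<^sub>i + f\<^sub>i\<close> without any contribution at
  infinity. By majorization there is an upper triangular matrix \<open>G\<close> with
  these invariant factors, whose monic diagonal entries have the degrees \<open>d - k\<^sub>i - l\<^sub>i\<close>, in this
  order, and exceed in degree the entries above them
  (\<open>exists_triangular_with_invariants\<close>). It satisfies the degree bounds, and transforming it back
  gives \<open>E\<close>. The invariants of \<open>E\<close> are compared with the prescribed ones one point of the
  projective line at a time; an algebraically closed field makes this sufficient.
\<close>

section \<open>Minors and their common divisors\<close>

text \<open>Rows and columns are selected by functions that need not be increasing or injective: minors with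
  a repeated row vanish, so divisibility by all minors is not affected, and no index sets have to be
  enumerated.\<close>

definition minor :: "'a::comm_ring_1 mat \<Rightarrow> nat \<Rightarrow> (nat \<Rightarrow> nat) \<Rightarrow> (nat \<Rightarrow> nat) \<Rightarrow> 'a" where
  "minor M j \<rho> \<gamma> = det (mat j j (\<lambda>(a, b). M $$ (\<rho> a, \<gamma> b)))"

lemma minor_Leibniz:
  "minor M j \<rho> \<gamma> = (\<Sum>p | p permutes {0..<j}. signof p * (\<Prod>a = 0..<j. M $$ (\<rho> a, \<gamma> (p a))))"
  unfolding minor_def
  by (subst det_def'[of _ j]) (auto intro!: sum.cong prod.cong simp: permutes_in_image)

lemma minor_id: "M \<in> carrier_mat j j \<Longrightarrow> minor M j id id = det M"
  unfolding minor_def by (rule arg_cong[of _ _ det]) auto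

lemma minor_transpose:
  assumes "M \<in> carrier_mat m n" "\<rho> \<in> {0..<j} \<rightarrow> {0..<m}" "\<gamma> \<in> {0..<j} \<rightarrow> {0..<n}"
  shows "minor M\<^sup>T j \<gamma> \<rho> = minor M j \<rho> \<gamma>"
proof -
  have "mat j j (\<lambda>(a, b). M\<^sup>T $$ (\<gamma> a, \<rho> b)) = (mat j j (\<lambda>(a, b). M $$ (\<rho> a, \<gamma> b)))\<^sup>T"
    using assms by (intro eq_matI) (auto simp: Pi_def)
  then show ?thesis
    unfolding minor_def by (metis det_transpose mat_carrier)
qed

lemma minor_cong:
  assumes "\<And>a b. a < j \<Longrightarrow> b < j \<Longrightarrow> M $$ (\<rho> a, \<gamma> b) = M' $$ (\<rho>' a, \<gamma>' b)"
  shows "minor M j \<rho> \<gamma> = minor M' j \<rho>' \<gamma>'"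
  unfolding minor_def by (rule arg_cong[of _ _ det]) (auto simp: assms)

lemma minor_eq_0_if_not_inj:
  assumes "\<not> inj_on \<rho> {0..<j}"
  shows "minor M j \<rho> \<gamma> = 0"
proof -
  obtain a b where "a < j" "b < j" "a \<noteq> b" "\<rho> a = \<rho> b"
    using assms by (auto simp: inj_on_def)
  then show ?thesis
    unfolding minor_def by (intro det_identical_rows[of _ j a b]) (auto simp: row_def)
qed

text \<open>The Cauchy-Binet formula before collecting the terms with the same set of rows: every selected row
  of the product is expanded by multilinearity.\<close>

lemma minor_mult_left:
  assumes W: "W \<in> carrier_mat m k" and N: "N \<in> carrier_mat k n"
    and \<rho>: "\<rho> \<in> {0..<j} \<rightarrow> {0..<m}" and \<gamma>: "\<gamma> \<in> {0..<j} \<rightarrow> {0..<n}"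
  shows "minor (W * N) j \<rho> \<gamma> =
    (\<Sum>\<sigma>\<in>{0..<j} \<rightarrow>\<^sub>E {0..<k}. (\<Prod>a = 0..<j. W $$ (\<rho> a, \<sigma> a)) * minor N j \<sigma> \<gamma>)"
proof -
  let ?F = "{0..<j} \<rightarrow>\<^sub>E {0..<k}" and ?P = "{p. p permutes {0..<j}}"
  have summand: "signof p * (\<Prod>a = 0..<j. (W * N) $$ (\<rho> a, \<gamma> (p a))) =
      (\<Sum>\<sigma>\<in>?F. (\<Prod>a = 0..<j. W $$ (\<rho> a, \<sigma> a)) * (signof p * (\<Prod>a = 0..<j. N $$ (\<sigma> a, \<gamma> (p a)))))"
    if p: "p \<in> ?P" for p
  proof -
    have "(\<Prod>a = 0..<j. (W * N) $$ (\<rho> a, \<gamma> (p a))) =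
        (\<Prod>a = 0..<j. \<Sum>i = 0..<k. W $$ (\<rho> a, i) * N $$ (i, \<gamma> (p a)))"
    proof (rule prod.cong[OF refl])
      fix a assume a: "a \<in> {0..<j}"
      then have "p a \<in> {0..<j}" using p permutes_in_image by fastforce
      with a have "\<rho> a < m" "\<gamma> (p a) < n" using \<rho> \<gamma> by auto
      then show "(W * N) $$ (\<rho> a, \<gamma> (p a)) = (\<Sum>i = 0..<k. W $$ (\<rho> a, i) * N $$ (i, \<gamma> (p a)))"
        using W N by (auto simp: scalar_prod_def)
    qed
    also have "\<dots> = (\<Sum>\<sigma>\<in>?F. \<Prod>a = 0..<j. W $$ (\<rho> a, \<sigma> a) * N $$ (\<sigma> a, \<gamma> (p a)))"
      by (rule prod_sum_PiE) auto
    finally show ?thesis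
      by (simp add: prod.distrib sum_distrib_left mult_ac)
  qed
  have "minor (W * N) j \<rho> \<gamma> = (\<Sum>p\<in>?P. \<Sum>\<sigma>\<in>?F. (\<Prod>a = 0..<j. W $$ (\<rho> a, \<sigma> a)) *
      (signof p * (\<Prod>a = 0..<j. N $$ (\<sigma> a, \<gamma> (p a)))))"
    unfolding minor_Leibniz by (rule sum.cong[OF refl summand])
  also have "\<dots> = (\<Sum>\<sigma>\<in>?F. (\<Prod>a = 0..<j. W $$ (\<rho> a, \<sigma> a)) * minor N j \<sigma> \<gamma>)"
    unfolding minor_Leibniz sum_distrib_left by (rule sum.swap)
  finally show ?thesis .
qed

text \<open>The divisors of the determinantal divisor of order \<open>j\<close>. Using the divisors instead of the
  greatest one also covers the value \<open>0\<close> and avoids normalization.\<close>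

definition dvd_minors :: "nat \<Rightarrow> 'a::comm_ring_1 \<Rightarrow> 'a mat \<Rightarrow> bool" where
  "dvd_minors j x M \<longleftrightarrow>
     (\<forall>\<rho>\<in>{0..<j} \<rightarrow> {0..<dim_row M}. \<forall>\<gamma>\<in>{0..<j} \<rightarrow> {0..<dim_col M}. x dvd minor M j \<rho> \<gamma>)"

lemma dvd_minors_transpose [simp]: "dvd_minors j x M\<^sup>T \<longleftrightarrow> dvd_minors j x M"
  unfolding dvd_minors_def
  using minor_transpose[of M "dim_row M" "dim_col M"] by auto

lemma dvd_minors_mult_left:
  assumes "W \<in> carrier_mat m k" "N \<in> carrier_mat k n" "dvd_minors j x N"
  shows "dvd_minors j x (W * N)"
  unfolding dvd_minors_def
proof (intro ballI)
  fix \<rho> \<gamma> assume "\<rho> \<in> {0..<j} \<rightarrow> {0..<dim_row (W * N)}" "\<gamma> \<in> {0..<j} \<rightarrow> {0..<dim_col (W * N)}"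
  then have \<rho>: "\<rho> \<in> {0..<j} \<rightarrow> {0..<m}" and \<gamma>: "\<gamma> \<in> {0..<j} \<rightarrow> {0..<n}" using assms by auto
  show "x dvd minor (W * N) j \<rho> \<gamma>"
    unfolding minor_mult_left[OF assms(1,2) \<rho> \<gamma>]
    using assms \<gamma> unfolding dvd_minors_def
    by (intro dvd_sum dvd_mult) (auto simp: PiE_def)
qed

lemma dvd_minors_mult_right:
  assumes "N \<in> carrier_mat m k" "W \<in> carrier_mat k n" "dvd_minors j x N"
  shows "dvd_minors j x (N * W)"
proof -
  have "dvd_minors j x (W\<^sup>T * N\<^sup>T)"
    by (rule dvd_minors_mult_left[of _ n k _ m]) (use assms in auto)
  then show ?thesis
    using transpose_mult[OF assms(1,2)] dvd_minors_transpose[of j x "N * W"] by simp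
qed

lemma dvd_minors_mult:
  assumes "W \<in> carrier_mat m k" "N \<in> carrier_mat k l" "W' \<in> carrier_mat l n" "dvd_minors j x N"
  shows "dvd_minors j x (W * N * W')"
  using assms by (intro dvd_minors_mult_right[of _ m l _ n] dvd_minors_mult_left[of _ m k _ l]) auto

text \<open>A selection of \<open>r\<close> rows and \<open>r\<close> columns is a product with \<open>0\<close>-\<open>1\<close> matrices on both
  sides.\<close>

lemma det_dvd_minors:
  assumes N: "N \<in> carrier_mat r r"
  shows "dvd_minors r (det N) N"
  unfolding dvd_minors_def
proof (intro ballI)
  fix \<rho> \<gamma> assume \<rho>: "\<rho> \<in> {0..<r} \<rightarrow> {0..<dim_row N}" and \<gamma>: "\<gamma> \<in> {0..<r} \<rightarrow> {0..<dim_col N}"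
  let ?R = "mat r r (\<lambda>(a, i). if i = \<rho> a then 1 else 0)"
  let ?C = "mat r r (\<lambda>(i, b). if i = \<gamma> b then 1 else 0)"
  have RN: "?R * N = mat r r (\<lambda>(a, b). N $$ (\<rho> a, b))"
    using N \<rho> by (intro eq_matI)
      (auto simp: scalar_prod_def Pi_def if_distrib[of "\<lambda>x. x * _"] sum.delta cong: if_cong)
  have "?R * N * ?C = mat r r (\<lambda>(a, b). N $$ (\<rho> a, \<gamma> b))"
    unfolding RN using N \<rho> \<gamma> by (intro eq_matI)
      (auto simp: scalar_prod_def Pi_def if_distrib[of "\<lambda>x. _ * x"] sum.delta cong: if_cong)
  then have "minor N r \<rho> \<gamma> = det (?R * N * ?C)"
    unfolding minor_def by simp
  also have "\<dots> = det ?R * det N * det ?C"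
    using N by (subst det_mult[of _ r], auto)+
  finally show "det N dvd minor N r \<rho> \<gamma>" by simp
qed

text \<open>Factoring through dimension \<open>k\<close> kills the minors of larger order.\<close>

lemma dvd_minors_zero:
  assumes "W \<in> carrier_mat m k" "N \<in> carrier_mat k n" "k < j"
  shows "dvd_minors j 0 (W * N)"
proof -
  have "dvd_minors j 0 N"
    unfolding dvd_minors_def
  proof (intro ballI)
    fix \<rho> \<gamma> assume "\<rho> \<in> {0..<j} \<rightarrow> {0..<dim_row N}"
    then have "\<not> inj_on \<rho> {0..<j}"
      using assms card_inj_on_le[of \<rho> "{0..<j}" "{0..<k}"] by auto
    then show "0 dvd minor N j \<rho> \<gamma>" by (simp add: minor_eq_0_if_not_inj)
  qed
  then show ?thesis using assms dvd_minors_mult_left by blast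
qed

lemma minor_smult:
  assumes "\<rho> \<in> {0..<j} \<rightarrow> {0..<dim_row M}" "\<gamma> \<in> {0..<j} \<rightarrow> {0..<dim_col M}"
  shows "minor (q \<cdot>\<^sub>m M) j \<rho> \<gamma> = q ^ j * minor M j \<rho> \<gamma>"
proof -
  have "mat j j (\<lambda>(a, b). (q \<cdot>\<^sub>m M) $$ (\<rho> a, \<gamma> b)) = q \<cdot>\<^sub>m mat j j (\<lambda>(a, b). M $$ (\<rho> a, \<gamma> b))"
    using assms by (intro eq_matI) (auto simp: Pi_def)
  then show ?thesis unfolding minor_def by simp
qed

text \<open>The largest element of \<open>T\<close> is at least \<open>card T - 1\<close>; it is compared with the last factor on
  the left and removed.\<close>

lemma dvd_chain_prod:
  fixes h :: "nat \<Rightarrow> 'a::comm_semiring_1"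
  assumes "finite T" and "\<And>i k. i \<le> k \<Longrightarrow> k \<in> T \<Longrightarrow> h i dvd h k"
  shows "(\<Prod>i<card T. h i) dvd (\<Prod>i\<in>T. h i)"
  using assms
proof (induction "card T" arbitrary: T)
  case 0
  then show ?case by auto
next
  case (Suc c)
  define t where "t = Max T"
  have ne: "T \<noteq> {}" using Suc.hyps by auto
  then have t: "t \<in> T" using Suc.prems t_def by auto
  have c: "card (T - {t}) = c" using t Suc by auto
  have "T \<subseteq> {..t}" using Suc.prems(1) t_def by auto
  then have "card T \<le> Suc t" by (metis card_atMost card_mono finite_atMost)
  then have "c \<le> t" using Suc.hyps by simp
  then have 1: "h c dvd h t" using Suc.prems t by auto
  have 2: "(\<Prod>i<card (T - {t}). h i) dvd (\<Prod>i\<in>T - {t}. h i)"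
    by (rule Suc.hyps) (use Suc.prems c in auto)
  have "(\<Prod>i<card T. h i) = (\<Prod>i<card (T - {t}). h i) * h c"
    using c Suc.hyps(2) by (metis prod.lessThan_Suc)
  moreover have "(\<Prod>i\<in>T. h i) = (\<Prod>i\<in>T - {t}. h i) * h t"
    using prod.remove[OF Suc.prems(1) t, of h] by (simp add: mult.commute)
  ultimately show ?case using mult_dvd_mono[OF 2 1] by simp
qed

text \<open>A minor of a diagonal matrix is zero or, up to sign, a product of distinct diagonal entries, and
  the product of the first \<open>j\<close> entries of the divisibility chain divides all of these. The
  bijection \<open>\<sigma>\<close> allows the chain to appear in any order on the diagonal.\<close>

lemma dvd_minors_diagonal:
  fixes h :: "nat \<Rightarrow> 'a::idom"
  assumes M: "M \<in> carrier_mat m n"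
    and off: "\<And>i k. i < m \<Longrightarrow> k < n \<Longrightarrow> i \<noteq> k \<Longrightarrow> M $$ (i, k) = 0"
    and diag: "\<And>i. i < min m n \<Longrightarrow> M $$ (i, i) = h (\<sigma> i)"
    and \<sigma>: "bij_betw \<sigma> {0..<min m n} {0..<min m n}"
    and chain: "\<And>i k. i \<le> k \<Longrightarrow> k < min m n \<Longrightarrow> h i dvd h k"
    and j: "j \<le> min m n"
  shows "dvd_minors j x M \<longleftrightarrow> x dvd (\<Prod>i<j. h i)"
proof
  assume D: "dvd_minors j x M"
  define \<tau> where "\<tau> = inv_into {0..<min m n} \<sigma>"
  have \<tau>: "\<tau> a < min m n" "\<sigma> (\<tau> a) = a" if "a < j" for a
  proof -
    have "a \<in> \<sigma> ` {0..<min m n}" using that j \<sigma> by (auto simp: bij_betw_def)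
    from inv_into_into[OF this] f_inv_into_f[OF this] show "\<tau> a < min m n" "\<sigma> (\<tau> a) = a"
      unfolding \<tau>_def by simp_all
  qed
  have entry: "M $$ (\<tau> a, \<tau> b) = (if a = b then h a else 0)" if "a < j" "b < j" for a b
  proof (cases "a = b")
    case True
    then show ?thesis using that \<tau>[of a] diag[of "\<tau> a"] by simp
  next
    case False
    then have "\<tau> a \<noteq> \<tau> b" using that \<tau>(2) by metis
    then show ?thesis using False that \<tau>(1)[of a] \<tau>(1)[of b] off[of "\<tau> a" "\<tau> b"] by simp
  qed
  have "minor M j \<tau> \<tau> = (\<Prod>i<j. h i)"
    unfolding minor_def
    by (subst det_upper_triangular[of _ j])
      (auto simp: entry upper_triangular_def prod_list_diag_prod lessThan_atLeast0)
  moreover have "x dvd minor M j \<tau> \<tau>"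
    using D M \<tau> unfolding dvd_minors_def by auto
  ultimately show "x dvd (\<Prod>i<j. h i)" by simp
next
  assume x: "x dvd (\<Prod>i<j. h i)"
  show "dvd_minors j x M"
    unfolding dvd_minors_def
  proof (intro ballI)
    fix \<rho> \<gamma> assume \<rho>: "\<rho> \<in> {0..<j} \<rightarrow> {0..<dim_row M}" and \<gamma>: "\<gamma> \<in> {0..<j} \<rightarrow> {0..<dim_col M}"
    show "x dvd minor M j \<rho> \<gamma>"
    proof (cases "inj_on \<rho> {0..<j}")
      case False
      then show ?thesis by (simp add: minor_eq_0_if_not_inj)
    next
      case inj: True
      have "x dvd (\<Prod>a = 0..<j. M $$ (\<rho> a, \<gamma> (p a)))" if p: "p permutes {0..<j}" for p
      proof (cases "\<forall>a<j. \<rho> a = \<gamma> (p a)")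
        case False
        then obtain a where a: "a < j" "\<rho> a \<noteq> \<gamma> (p a)" by auto
        moreover have "p a < j" using p a permutes_in_image by fastforce
        ultimately have "M $$ (\<rho> a, \<gamma> (p a)) = 0"
          using \<rho> \<gamma> M by (intro off) auto
        then have "(\<Prod>a = 0..<j. M $$ (\<rho> a, \<gamma> (p a))) = 0"
          using a by (intro prod_zero) auto
        then show ?thesis by (metis dvd_0_right)
      next
        case True
        have lt: "\<rho> a < min m n" if "a < j" for a
        proof -
          have "p a < j" using p that permutes_in_image by fastforce
          then have "\<gamma> (p a) < n" "\<rho> a < m"
            using funcset_mem[OF \<rho>, of a] funcset_mem[OF \<gamma>, of "p a"] M that by simp_all
          then show ?thesis using that True by auto
        qed
        let ?T = "(\<lambda>a. \<sigma> (\<rho> a)) ` {0..<j}"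
        have inj2: "inj_on (\<lambda>a. \<sigma> (\<rho> a)) {0..<j}"
          using comp_inj_on[OF inj inj_on_subset[of \<sigma> "{0..<min m n}"]] \<sigma> lt
          unfolding bij_betw_def by (simp add: comp_def image_subset_iff)
        have "(\<Prod>a = 0..<j. M $$ (\<rho> a, \<gamma> (p a))) = (\<Prod>a = 0..<j. h (\<sigma> (\<rho> a)))"
          using True lt diag by (intro prod.cong) auto
        also have "\<dots> = (\<Prod>i\<in>?T. h i)"
          using inj2 by (simp add: prod.reindex)
        finally have eq: "(\<Prod>a = 0..<j. M $$ (\<rho> a, \<gamma> (p a))) = (\<Prod>i\<in>?T. h i)" .
        have "?T \<subseteq> {0..<min m n}" using lt \<sigma> by (auto simp: bij_betw_def)
        then have "(\<Prod>i<card ?T. h i) dvd (\<Prod>i\<in>?T. h i)"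
          by (intro dvd_chain_prod) (use chain in auto)
        moreover have "card ?T = j" using inj2 by (simp add: card_image)
        ultimately show ?thesis using x eq by (metis dvd_trans)
      qed
      then show ?thesis
        unfolding minor_Leibniz by (intro dvd_sum dvd_mult) auto
    qed
  qed
qed

section \<open>Unimodular equivalence and Smith forms\<close>

definition unimod :: "nat \<Rightarrow> 'a::comm_ring_1 mat \<Rightarrow> bool" where
  "unimod n U \<longleftrightarrow> U \<in> carrier_mat n n \<and> (\<exists>U'\<in>carrier_mat n n. U * U' = 1\<^sub>m n \<and> U' * U = 1\<^sub>m n)"

lemma unimod_iff_invertible_mat: "unimod n U \<longleftrightarrow> U \<in> carrier_mat n n \<and> invertible_mat U"
proof
  assume "U \<in> carrier_mat n n \<and> invertible_mat U"
  then obtain B where U: "U \<in> carrier_mat n n" and B: "U * B = 1\<^sub>m n" "B * U = 1\<^sub>m (dim_row B)"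
    unfolding invertible_mat_def inverts_mat_def by auto
  have "dim_col B = n" using arg_cong[OF B(1), of dim_col] by simp
  moreover have "dim_row B = n" using arg_cong[OF B(2), of dim_col] U by simp
  ultimately show "unimod n U" unfolding unimod_def using U B by (intro conjI bexI[of _ B]) auto
qed (auto simp: unimod_def invertible_mat_def inverts_mat_def)

lemma unimodI:
  "\<lbrakk>U \<in> carrier_mat n n; U' \<in> carrier_mat n n; U * U' = 1\<^sub>m n; U' * U = 1\<^sub>m n\<rbrakk> \<Longrightarrow> unimod n U"
  unfolding unimod_def by auto

lemma unimod_carrier: "unimod n U \<Longrightarrow> U \<in> carrier_mat n n"
  unfolding unimod_def by auto

lemma unimod_one: "unimod n (1\<^sub>m n)"
  by (rule unimodI[of _ _ "1\<^sub>m n"]) auto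

lemma unimod_mult:
  assumes "unimod n U" "unimod n V"
  shows "unimod n (U * V)"
proof -
  obtain U' V' where c: "U \<in> carrier_mat n n" "V \<in> carrier_mat n n" "U' \<in> carrier_mat n n" "V' \<in> carrier_mat n n"
    and i: "U * U' = 1\<^sub>m n" "U' * U = 1\<^sub>m n" "V * V' = 1\<^sub>m n" "V' * V = 1\<^sub>m n"
    using assms unfolding unimod_def by blast
  have "(U * V) * (V' * U') = U * (V * V') * U'"
    using c by (simp add: assoc_mult_mat[of _ n n _ n _ n])
  moreover have "(V' * U') * (U * V) = V' * (U' * U) * V"
    using c by (simp add: assoc_mult_mat[of _ n n _ n _ n])
  ultimately show ?thesis
    using c i by (intro unimodI[of _ _ "V' * U'"]) auto
qed

lemma unimod_transpose:
  assumes "unimod n U"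
  shows "unimod n U\<^sup>T"
proof -
  obtain U' where c: "U \<in> carrier_mat n n" "U' \<in> carrier_mat n n"
    and i: "U * U' = 1\<^sub>m n" "U' * U = 1\<^sub>m n"
    using assms unfolding unimod_def by blast
  have "U\<^sup>T * U'\<^sup>T = 1\<^sub>m n"
    using transpose_mult[OF c(2,1)] i by simp
  moreover have "U'\<^sup>T * U\<^sup>T = 1\<^sub>m n"
    using transpose_mult[OF c(1,2)] i by simp
  ultimately show ?thesis
    using c by (intro unimodI[of _ _ "U'\<^sup>T"]) auto
qed

lemma unimod_inverse:
  assumes "unimod n U"
  obtains U' where "unimod n U'" "U' \<in> carrier_mat n n" "U * U' = 1\<^sub>m n" "U' * U = 1\<^sub>m n"
  using assms unfolding unimod_def by blast

lemma unimod_swaprows_mat: "k < n \<Longrightarrow> l < n \<Longrightarrow> unimod n (swaprows_mat n k l)"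
  by (rule unimodI[of _ _ "swaprows_mat n k l"]) (auto intro: swaprows_mat_inv)

lemma unimod_addrow_mat:
  assumes "k < n" "l < n" "k \<noteq> l"
  shows "unimod n (addrow_mat n (a::'a::comm_ring_1) k l)"
  using addrow_mat_inv[OF assms, of a] addrow_mat_inv[OF assms, of "-a"]
  by (intro unimodI[of _ _ "addrow_mat n (-a) k l"]) auto

lemma multrow_mat_mult:
  assumes "k < n" "a * b = (1::'a::comm_ring_1)"
  shows "multrow_mat n k a * multrow_mat n k b = 1\<^sub>m n"
proof -
  have "multrow_mat n k a * multrow_mat n k b = multrow k a (multrow_mat n k b)"
    by (rule multrow_mat[symmetric, of _ n n]) auto
  also have "\<dots> = 1\<^sub>m n" using assms by (intro eq_matI) auto
  finally show ?thesis .
qed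

lemma unimod_multrow_mat:
  assumes "k < n" "a * b = (1::'a::comm_ring_1)"
  shows "unimod n (multrow_mat n k a)"
  using multrow_mat_mult[OF assms] multrow_mat_mult[of k n b a] assms
  by (intro unimodI[of _ _ "multrow_mat n k b"]) (auto simp: mult.commute)

lemma unimod_block_diag:
  assumes "unimod p U" "unimod q V"
  shows "unimod (p + q) (four_block_mat U (0\<^sub>m p q) (0\<^sub>m q p) V)"
proof -
  obtain U' V' where c: "U \<in> carrier_mat p p" "V \<in> carrier_mat q q" "U' \<in> carrier_mat p p" "V' \<in> carrier_mat q q"
    and i: "U * U' = 1\<^sub>m p" "U' * U = 1\<^sub>m p" "V * V' = 1\<^sub>m q" "V' * V = 1\<^sub>m q"
    using assms unfolding unimod_def by blast
  have "four_block_mat U (0\<^sub>m p q) (0\<^sub>m q p) V * four_block_mat U' (0\<^sub>m p q) (0\<^sub>m q p) V' = 1\<^sub>m (p + q)"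
    using c i by (subst mult_four_block_mat[of _ p p _ q _ q _ _ p _ q]) auto
  moreover have "four_block_mat U' (0\<^sub>m p q) (0\<^sub>m q p) V' * four_block_mat U (0\<^sub>m p q) (0\<^sub>m q p) V = 1\<^sub>m (p + q)"
    using c i by (subst mult_four_block_mat[of _ p p _ q _ q _ _ p _ q]) auto
  ultimately show ?thesis
    using c by (intro unimodI[of _ _ "four_block_mat U' (0\<^sub>m p q) (0\<^sub>m q p) V'"]) auto
qed

lemma unimod_block_upper:
  assumes X: "(X :: 'a::comm_ring_1 mat) \<in> carrier_mat p q"
  shows "unimod (p + q) (four_block_mat (1\<^sub>m p) X (0\<^sub>m q p) (1\<^sub>m q))"
proof -
  have [simp]: "- 0\<^sub>m q q = (0\<^sub>m q q :: 'a mat)" "X + - X = 0\<^sub>m p q" "- X + X = 0\<^sub>m p q"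
    by (rule eq_matI; use X in auto)+
  have "four_block_mat (1\<^sub>m p) X (0\<^sub>m q p) (1\<^sub>m q) * four_block_mat (1\<^sub>m p) (- X) (0\<^sub>m q p) (1\<^sub>m q) = 1\<^sub>m (p + q)"
    using X by (subst mult_four_block_mat[of _ p p _ q _ q _ _ p _ q]) auto
  moreover have "four_block_mat (1\<^sub>m p) (- X) (0\<^sub>m q p) (1\<^sub>m q) * four_block_mat (1\<^sub>m p) X (0\<^sub>m q p) (1\<^sub>m q) = 1\<^sub>m (p + q)"
    using X by (subst mult_four_block_mat[of _ p p _ q _ q _ _ p _ q]) auto
  ultimately show ?thesis
    using X by (intro unimodI[of _ _ "four_block_mat (1\<^sub>m p) (- X) (0\<^sub>m q p) (1\<^sub>m q)"]) auto
qed

lemma unimod_block_lower: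
  assumes X: "(X :: 'a::comm_ring_1 mat) \<in> carrier_mat q p"
  shows "unimod (p + q) (four_block_mat (1\<^sub>m p) (0\<^sub>m p q) X (1\<^sub>m q))"
proof -
  have "(four_block_mat (1\<^sub>m p) X\<^sup>T (0\<^sub>m q p) (1\<^sub>m q))\<^sup>T = four_block_mat (1\<^sub>m p) (0\<^sub>m p q) X (1\<^sub>m q)"
    using X by (subst transpose_four_block_mat[of _ p p _ q _ q]) auto
  then show ?thesis
    using unimod_transpose[OF unimod_block_upper[of "X\<^sup>T" p q]] X by simp
qed

definition unimod_equiv :: "nat \<Rightarrow> nat \<Rightarrow> 'a::comm_ring_1 mat \<Rightarrow> 'a mat \<Rightarrow> bool" where
  "unimod_equiv m n P Q \<longleftrightarrow>
     P \<in> carrier_mat m n \<and> (\<exists>U V. unimod m U \<and> unimod n V \<and> U * P * V = Q)"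

lemma unimod_equivI:
  "\<lbrakk>P \<in> carrier_mat m n; unimod m U; unimod n V; U * P * V = Q\<rbrakk> \<Longrightarrow> unimod_equiv m n P Q"
  unfolding unimod_equiv_def by auto

lemma unimod_equiv_carrier:
  "unimod_equiv m n P Q \<Longrightarrow> P \<in> carrier_mat m n"
  "unimod_equiv m n P Q \<Longrightarrow> Q \<in> carrier_mat m n"
  unfolding unimod_equiv_def unimod_def by auto

lemma unimod_equiv_refl: "P \<in> carrier_mat m n \<Longrightarrow> unimod_equiv m n P P"
  by (rule unimod_equivI[OF _ unimod_one unimod_one]) auto

lemma unimod_equiv_mult_left:
  "P \<in> carrier_mat m n \<Longrightarrow> unimod m U \<Longrightarrow> unimod_equiv m n P (U * P)"
  by (rule unimod_equivI[OF _ _ unimod_one]) (auto dest: unimod_carrier)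

lemma unimod_equiv_mult_right:
  "P \<in> carrier_mat m n \<Longrightarrow> unimod n V \<Longrightarrow> unimod_equiv m n P (P * V)"
  by (rule unimod_equivI[OF _ unimod_one]) (auto dest: unimod_carrier)

lemma unimod_equiv_trans [trans]:
  assumes "unimod_equiv m n P Q" "unimod_equiv m n Q R"
  shows "unimod_equiv m n P R"
proof -
  obtain U V where 1: "P \<in> carrier_mat m n" "unimod m U" "unimod n V" "U * P * V = Q"
    using assms unfolding unimod_equiv_def by blast
  obtain U' V' where 2: "unimod m U'" "unimod n V'" "U' * Q * V' = R"
    using assms unfolding unimod_equiv_def by blast
  note c = 1(1) 1(2,3)[THEN unimod_carrier] 2(1,2)[THEN unimod_carrier]
  have "(U' * U) * P * (V * V') = U' * (U * P * V) * V'"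
    using c by (simp add: assoc_mult_mat[of _ m m _ m _ n] assoc_mult_mat[of _ m m _ n _ n] assoc_mult_mat[of _ m n _ n _ n])
  then show ?thesis
    using 1 2 by (intro unimod_equivI[of _ _ _ "U' * U" "V * V'"] unimod_mult) auto
qed

lemma unimod_equiv_sym:
  assumes "unimod_equiv m n P Q"
  shows "unimod_equiv m n Q P"
proof -
  obtain U V where 1: "P \<in> carrier_mat m n" "unimod m U" "unimod n V" "U * P * V = Q"
    using assms unfolding unimod_equiv_def by blast
  obtain U' where U': "unimod m U'" "U' \<in> carrier_mat m m" "U' * U = 1\<^sub>m m"
    using unimod_inverse[OF 1(2)] by metis
  obtain V' where V': "unimod n V'" "V' \<in> carrier_mat n n" "V * V' = 1\<^sub>m n"
    using unimod_inverse[OF 1(3)] by metis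
  note c = 1(1) 1(2,3)[THEN unimod_carrier] U'(2) V'(2)
  have "U' * Q * V' = (U' * U) * P * (V * V')"
    unfolding 1(4)[symmetric]
    using c by (simp add: assoc_mult_mat[of _ m m _ m _ n] assoc_mult_mat[of _ m m _ n _ n] assoc_mult_mat[of _ m n _ n _ n])
  also have "\<dots> = P" using c U' V' by simp
  finally show ?thesis
    using U' V' assms unimod_equiv_carrier by (intro unimod_equivI[of _ _ _ U' V']) auto
qed

lemma unimod_equiv_swaprows:
  "\<lbrakk>P \<in> carrier_mat m n; k < m; l < m\<rbrakk> \<Longrightarrow> unimod_equiv m n P (swaprows k l P)"
  using unimod_equiv_mult_left[OF _ unimod_swaprows_mat] swaprows_mat by metis

lemma unimod_equiv_swapcols:
  "\<lbrakk>P \<in> carrier_mat m n; k < n; l < n\<rbrakk> \<Longrightarrow> unimod_equiv m n P (swapcols k l P)"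
  using unimod_equiv_mult_right[OF _ unimod_swaprows_mat] swapcols_mat by metis

lemma unimod_equiv_addrow:
  "\<lbrakk>P \<in> carrier_mat m n; k < m; l < m; k \<noteq> l\<rbrakk> \<Longrightarrow> unimod_equiv m n P (addrow a k l P)"
  using unimod_equiv_mult_left[OF _ unimod_addrow_mat] addrow_mat by metis

lemma unimod_equiv_addcol:
  "\<lbrakk>P \<in> carrier_mat m n; k < n; l < n; k \<noteq> l\<rbrakk> \<Longrightarrow> unimod_equiv m n P (addcol a k l P)"
  using unimod_equiv_mult_right[OF _ unimod_addrow_mat[of l n k a]] addcol_mat[of P m n l a k] by metis

lemma unimod_equiv_multrow:
  "\<lbrakk>P \<in> carrier_mat m n; k < m; a * b = 1\<rbrakk> \<Longrightarrow> unimod_equiv m n P (multrow k a P)"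
  using unimod_equiv_mult_left[OF _ unimod_multrow_mat] multrow_mat by metis

lemma unimod_equiv_block_diag:
  assumes A: "unimod_equiv p p' A A'" and D: "unimod_equiv q q' D D'"
  shows "unimod_equiv (p + q) (p' + q') (four_block_mat A (0\<^sub>m p q') (0\<^sub>m q p') D)
    (four_block_mat A' (0\<^sub>m p q') (0\<^sub>m q p') D')"
proof -
  obtain U V where 1: "A \<in> carrier_mat p p'" "unimod p U" "unimod p' V" "U * A * V = A'"
    using A unfolding unimod_equiv_def by blast
  obtain U' V' where 2: "D \<in> carrier_mat q q'" "unimod q U'" "unimod q' V'" "U' * D * V' = D'"
    using D unfolding unimod_equiv_def by blast
  note c = 1(1) 2(1) 1(2,3)[THEN unimod_carrier] 2(2,3)[THEN unimod_carrier]
  have "four_block_mat U (0\<^sub>m p q) (0\<^sub>m q p) U' * four_block_mat A (0\<^sub>m p q') (0\<^sub>m q p') D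
      * four_block_mat V (0\<^sub>m p' q') (0\<^sub>m q' p') V' = four_block_mat A' (0\<^sub>m p q') (0\<^sub>m q p') D'"
    using c 1(4) 2(4)
    by (subst mult_four_block_mat[of _ p p _ q _ q _ _ p' _ q'], auto)
      (subst mult_four_block_mat[of _ p p' _ q' _ q _ _ p' _ q'], auto)
  then show ?thesis
    using c 1 2 by (intro unimod_equivI[OF _ unimod_block_diag unimod_block_diag]) auto
qed

lemma dvd_minors_unimod_equiv:
  assumes "unimod_equiv m n P Q"
  shows "dvd_minors j x P \<longleftrightarrow> dvd_minors j x Q"
proof -
  have "dvd_minors j x Q" if "unimod_equiv m n P Q" "dvd_minors j x P" for P Q
    using that unfolding unimod_equiv_def
    by (auto dest: unimod_carrier intro: dvd_minors_mult)
  then show ?thesis using assms unimod_equiv_sym by blast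
qed

lemma dvd_entries_mult:
  fixes x :: "'a::comm_ring_1"
  assumes "U \<in> carrier_mat k m" "P \<in> carrier_mat m n" "V \<in> carrier_mat n l"
    and "\<forall>i<m. \<forall>j<n. x dvd P $$ (i, j)" and "i < k" "j < l"
  shows "x dvd (U * P * V) $$ (i, j)"
proof -
  define Q where "Q = U * P"
  have Q: "Q \<in> carrier_mat k n" unfolding Q_def using assms by auto
  have "x dvd Q $$ (i, b)" if "b < n" for b
    unfolding Q_def using assms that by (auto simp: scalar_prod_def intro!: dvd_sum)
  then show ?thesis
    unfolding Q_def[symmetric] using Q assms by (auto simp: scalar_prod_def intro!: dvd_sum)
qed

lemma clear_first_row_col:
  fixes M :: "'a::field poly mat"
  assumes M: "M \<in> carrier_mat (Suc m) (Suc n)" and a: "M $$ (0, 0) = a"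
    and row: "\<And>k. k < Suc n \<Longrightarrow> a dvd M $$ (0, k)" and col: "\<And>i. i < Suc m \<Longrightarrow> a dvd M $$ (i, 0)"
  obtains R where "R \<in> carrier_mat m n"
    "unimod_equiv (Suc m) (Suc n) M (four_block_mat (mat 1 1 (\<lambda>_. a)) (0\<^sub>m 1 n) (0\<^sub>m m 1) R)"
proof -
  let ?A = "mat 1 1 (\<lambda>_. a)"
  define B where "B = mat 1 n (\<lambda>(i, k). M $$ (0, Suc k))"
  define C where "C = mat m 1 (\<lambda>(i, k). M $$ (Suc i, 0))"
  define D where "D = mat m n (\<lambda>(i, k). M $$ (Suc i, Suc k))"
  define X where "X = mat 1 n (\<lambda>(i, k). - (M $$ (0, Suc k) div a))"
  define Y where "Y = mat m 1 (\<lambda>(i, k). - (M $$ (Suc i, 0) div a))"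
  note defs = B_def C_def D_def X_def Y_def
  have c: "B \<in> carrier_mat 1 n" "C \<in> carrier_mat m 1" "D \<in> carrier_mat m n"
     "X \<in> carrier_mat 1 n" "Y \<in> carrier_mat m 1" "?A \<in> carrier_mat 1 1"
    unfolding defs by auto
  have eqM: "M = four_block_mat ?A B C D"
    using M a by (intro eq_matI) (auto simp: B_def C_def D_def)
  have AX: "?A * X + B = 0\<^sub>m 1 n"
    using row by (intro eq_matI) (auto simp: B_def X_def scalar_prod_def)
  have YA: "Y * ?A + C = 0\<^sub>m m 1"
    using col by (intro eq_matI) (auto simp: C_def Y_def scalar_prod_def)
  let ?U = "four_block_mat (1\<^sub>m 1) (0\<^sub>m 1 m) Y (1\<^sub>m m)"
  let ?V = "four_block_mat (1\<^sub>m 1) X (0\<^sub>m n 1) (1\<^sub>m n)"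
  have 1: "?U * M = four_block_mat ?A B (0\<^sub>m m 1) (Y * B + D)"
    unfolding eqM using c YA
    by (subst mult_four_block_mat[of _ 1 1 _ m _ m _ _ 1 _ n]) auto
  have 2: "?U * M * ?V = four_block_mat ?A (0\<^sub>m 1 n) (0\<^sub>m m 1) (Y * B + D)"
    unfolding 1 using c AX
    by (subst mult_four_block_mat[of _ 1 1 _ n _ m _ _ 1 _ n]) auto
  have "unimod_equiv (1 + m) (1 + n) M (four_block_mat ?A (0\<^sub>m 1 n) (0\<^sub>m m 1) (Y * B + D))"
    using M c by (intro unimod_equivI[OF _ unimod_block_lower unimod_block_upper 2]) auto
  then show ?thesis using that[of "Y * B + D"] c by auto
qed

lemma smith_mat_carrier [simp]: "smith_mat m n \<beta>s \<in> carrier_mat m n"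
  unfolding smith_mat_def by auto

lemma smith_mat_Cons:
  "four_block_mat (mat 1 1 (\<lambda>_. a)) (0\<^sub>m 1 n) (0\<^sub>m m 1) (smith_mat m n \<beta>s) = smith_mat (Suc m) (Suc n) (a # \<beta>s)"
  unfolding smith_mat_def by (rule eq_matI) (auto simp: nth_Cons')

text \<open>Among all entries of all matrices equivalent to \<open>P\<close> take a nonzero one of least degree, move
  it to the corner and make it monic. Any entry in its row or column that it did not divide would
  leave a remainder of smaller degree, so row and column can be cleared.\<close>

lemma Smith_form_exists:
  fixes P :: "'a::field poly mat"
  assumes "P \<in> carrier_mat m n"
  shows "\<exists>\<beta>s. length \<beta>s \<le> min m n \<and> (\<forall>\<beta>\<in>set \<beta>s. lead_coeff \<beta> = 1) \<and> sorted_wrt (dvd) \<beta>s \<and>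
    unimod_equiv m n P (smith_mat m n \<beta>s)"
  using assms
proof (induction m arbitrary: n P)
  case 0
  then have "smith_mat 0 n [] = P" unfolding smith_mat_def by (intro eq_matI) auto
  then show ?case using 0 unimod_equiv_refl[of P 0 n] by (intro exI[of _ "[]"]) auto
next
  case (Suc m)
  show ?case
  proof (cases "P = 0\<^sub>m (Suc m) n")
    case True
    then have "smith_mat (Suc m) n [] = P" unfolding smith_mat_def by (intro eq_matI) auto
    then show ?thesis using Suc.prems unimod_equiv_refl[of P "Suc m" n] by (intro exI[of _ "[]"]) auto
  next
    case False
    define good where "good Q i k \<longleftrightarrow> unimod_equiv (Suc m) n P Q \<and> i < Suc m \<and> k < n \<and> Q $$ (i, k) \<noteq> 0" for Q i k
    obtain i0 k0 where "i0 < Suc m" "k0 < n" "P $$ (i0, k0) \<noteq> 0"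
      using False Suc.prems by (metis carrier_matD eq_matI index_zero_mat)
    then have "\<exists>Q i k. good Q i k"
      using unimod_equiv_refl[OF Suc.prems] unfolding good_def by blast
    then have "\<exists>e Q i k. good Q i k \<and> degree (Q $$ (i, k)) = e" by blast
    then obtain e where "\<exists>Q i k. good Q i k \<and> degree (Q $$ (i, k)) = e"
      and least: "\<And>e'. e' < e \<Longrightarrow> \<not> (\<exists>Q i k. good Q i k \<and> degree (Q $$ (i, k)) = e')"
      using exists_least_iff[of "\<lambda>e. \<exists>Q i k. good Q i k \<and> degree (Q $$ (i, k)) = e"] by blast
    then obtain Q i k where Q: "good Q i k" "degree (Q $$ (i, k)) = e" by blast
    have min: "e \<le> degree (Q' $$ (i', k'))"
      if "unimod_equiv (Suc m) n P Q'" "i' < Suc m" "k' < n" "Q' $$ (i', k') \<noteq> 0" for Q' i' k'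
    proof (rule ccontr)
      assume "\<not> e \<le> degree (Q' $$ (i', k'))"
      then have "\<not> good Q' i' k'" using least[of "degree (Q' $$ (i', k'))"] by auto
      then show False using that unfolding good_def by blast
    qed
    obtain n' where n: "n = Suc n'" using Q unfolding good_def by (cases n) auto
    let ?E = "unimod_equiv (Suc m) (Suc n') P"
    define Q1 where "Q1 = swapcols 0 k (swaprows 0 i Q)"
    have cQ: "Q \<in> carrier_mat (Suc m) (Suc n')" and ik: "i < Suc m" "k < Suc n'" "Q $$ (i, k) \<noteq> 0"
      using Q unimod_equiv_carrier n unfolding good_def by auto
    have "?E Q" using Q n unfolding good_def by auto
    also have "unimod_equiv (Suc m) (Suc n') Q (swaprows 0 i Q)"
      using cQ ik by (intro unimod_equiv_swaprows) auto
    also have "unimod_equiv (Suc m) (Suc n') (swaprows 0 i Q) Q1"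
      unfolding Q1_def using cQ ik by (intro unimod_equiv_swapcols) auto
    finally have E1: "?E Q1" .
    have Q100: "Q1 $$ (0, 0) = Q $$ (i, k)"
      unfolding Q1_def using cQ ik by auto
    define c where "c = lead_coeff (Q $$ (i, k))"
    have c0: "c \<noteq> 0" using ik c_def by auto
    define Q2 where "Q2 = multrow 0 [:inverse c:] Q1"
    have "?E Q2"
    proof -
      have "unimod_equiv (Suc m) (Suc n') Q1 Q2"
        unfolding Q2_def using c0 unimod_equiv_carrier[OF E1]
        by (intro unimod_equiv_multrow[of _ _ _ _ _ "[:c:]"]) (auto simp: one_pCons)
      then show ?thesis using E1 unimod_equiv_trans by blast
    qed
    define a where "a = Q2 $$ (0, 0)"
    have a: "a = [:inverse c:] * Q $$ (i, k)"
      unfolding a_def Q2_def using unimod_equiv_carrier[OF E1] Q100 by auto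
    have dega: "degree a = e" using c0 Q(2) unfolding a by (simp add: degree_mult_eq)
    have monic: "lead_coeff a = 1"
      unfolding a using c0 by (simp add: c_def lead_coeff_mult)
    then have a0: "a \<noteq> 0" by auto
    have dvd_row: "a dvd Q' $$ (0, l)" if E: "?E Q'" and aQ: "Q' $$ (0, 0) = a" and l: "l < Suc n'" for Q' l
    proof (cases "l = 0")
      case False
      let ?Q = "addcol (- (Q' $$ (0, l) div a)) l 0 Q'"
      have cQ': "Q' \<in> carrier_mat (Suc m) (Suc n')" using unimod_equiv_carrier[OF E] by auto
      have E': "?E ?Q"
        using E unimod_equiv_trans unimod_equiv_addcol[OF cQ' l _ False] by blast
      have "?Q $$ (0, l) = Q' $$ (0, l) mod a"
        using cQ' l aQ by (simp add: minus_div_mult_eq_mod[symmetric])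
      then have "Q' $$ (0, l) mod a = 0"
        using min[of ?Q 0 l] E' l n dega degree_mod_less'[OF a0, of "Q' $$ (0, l)"] by fastforce
      then show ?thesis by auto
    qed (use aQ in auto)
    have dvd_col: "a dvd Q' $$ (l, 0)" if E: "?E Q'" and aQ: "Q' $$ (0, 0) = a" and l: "l < Suc m" for Q' l
    proof (cases "l = 0")
      case False
      let ?Q = "addrow (- (Q' $$ (l, 0) div a)) l 0 Q'"
      have cQ': "Q' \<in> carrier_mat (Suc m) (Suc n')" using unimod_equiv_carrier[OF E] by auto
      have E': "?E ?Q"
        using E unimod_equiv_trans unimod_equiv_addrow[OF cQ' l _ False] by blast
      have "?Q $$ (l, 0) = Q' $$ (l, 0) mod a"
        using cQ' l aQ by (simp add: minus_div_mult_eq_mod[symmetric])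
      then have "Q' $$ (l, 0) mod a = 0"
        using min[of ?Q l 0] E' l n dega degree_mod_less'[OF a0, of "Q' $$ (l, 0)"] by fastforce
      then show ?thesis by auto
    qed (use aQ in auto)
    obtain R where R: "R \<in> carrier_mat m n'"
      and Eq: "unimod_equiv (Suc m) (Suc n') Q2 (four_block_mat (mat 1 1 (\<lambda>_. a)) (0\<^sub>m 1 n') (0\<^sub>m m 1) R)"
      using clear_first_row_col[OF _ a_def[symmetric]] dvd_row[OF \<open>?E Q2\<close> a_def[symmetric]]
        dvd_col[OF \<open>?E Q2\<close> a_def[symmetric]] unimod_equiv_carrier[OF \<open>?E Q2\<close>] by metis
    define M where "M = four_block_mat (mat 1 1 (\<lambda>_. a)) (0\<^sub>m 1 n') (0\<^sub>m m 1) R"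
    have EM: "?E M" using unimod_equiv_trans[OF \<open>?E Q2\<close> Eq] M_def by simp
    have cM: "M \<in> carrier_mat (Suc m) (Suc n')" using unimod_equiv_carrier[OF EM] by auto
    \<comment> \<open>Adding any other row to the first one keeps the corner \<open>a\<close>, so \<open>a\<close> divides every entry.\<close>
    have aR: "a dvd R $$ (i, k)" if "i < m" "k < n'" for i k
    proof -
      let ?Q = "addrow 1 0 (Suc i) M"
      have "?E ?Q" using EM unimod_equiv_trans unimod_equiv_addrow[OF cM, of 0 "Suc i"] that by blast
      moreover have "?Q $$ (0, 0) = a" "?Q $$ (0, Suc k) = R $$ (i, k)"
        using that R unfolding M_def by auto
      ultimately show ?thesis using dvd_row[of ?Q "Suc k"] that by auto
    qed
    obtain \<beta>s where len: "length \<beta>s \<le> min m n'" and mon: "\<forall>\<beta>\<in>set \<beta>s. lead_coeff \<beta> = 1"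
      and srt: "sorted_wrt (dvd) \<beta>s" and ER: "unimod_equiv m n' R (smith_mat m n' \<beta>s)"
      using Suc.IH[OF R] by blast
    have "a dvd \<beta>s ! i" if "i < length \<beta>s" for i
    proof -
      obtain U V where "unimod m U" "unimod n' V" and UV: "U * R * V = smith_mat m n' \<beta>s"
        using ER unfolding unimod_equiv_def by blast
      then have "a dvd smith_mat m n' \<beta>s $$ (i, i)"
        using that len aR R unimod_carrier unfolding UV[symmetric]
        by (intro dvd_entries_mult[of _ m m _ n' _ n']) auto
      then show ?thesis using that len unfolding smith_mat_def by auto
    qed
    then have "sorted_wrt (dvd) (a # \<beta>s)" using srt by (auto simp: in_set_conv_nth)
    moreover have "?E (smith_mat (Suc m) (Suc n') (a # \<beta>s))"
    proof -
      have "unimod_equiv (1 + m) (1 + n') M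
          (four_block_mat (mat 1 1 (\<lambda>_. a)) (0\<^sub>m 1 n') (0\<^sub>m m 1) (smith_mat m n' \<beta>s))"
        unfolding M_def by (intro unimod_equiv_block_diag ER unimod_equiv_refl) auto
      then have "unimod_equiv (Suc m) (Suc n') M (smith_mat (Suc m) (Suc n') (a # \<beta>s))"
        unfolding smith_mat_Cons by simp
      then show ?thesis using EM unimod_equiv_trans by blast
    qed
    ultimately show ?thesis
      using len mon monic n by (intro exI[of _ "a # \<beta>s"]) auto
  qed
qed

text \<open>Zeros in place of the missing invariant factors make the determinantal divisors of order beyond
  the rank come out as \<open>0\<close>; since \<open>0\<close> is divisible by everything, the chain condition
  persists.\<close>

definition padded :: "'a::zero list \<Rightarrow> nat \<Rightarrow> 'a" where
  "padded xs i = (if i < length xs then xs ! i else 0)"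

text \<open>This is how invariant factors are used from here on: they are determined by the divisors of the
  minors, and transformations that are not unimodular can be followed on minors as well.\<close>

lemma dvd_minors_Smith:
  fixes P :: "'a::field poly mat"
  assumes E: "unimod_equiv m n P (smith_mat m n \<beta>s)" and srt: "sorted_wrt (dvd) \<beta>s"
    and j: "j \<le> min m n"
  shows "dvd_minors j x P \<longleftrightarrow> x dvd (\<Prod>i<j. padded \<beta>s i)"
proof -
  have "dvd_minors j x (smith_mat m n \<beta>s) \<longleftrightarrow> x dvd (\<Prod>i<j. padded \<beta>s i)"
  proof (rule dvd_minors_diagonal[where \<sigma> = id])
    show "padded \<beta>s i dvd padded \<beta>s k" if "i \<le> k" for i k
      using that srt by (cases "i = k") (auto simp: padded_def sorted_wrt_iff_nth_less)
  qed (use j in \<open>auto simp: smith_mat_def padded_def\<close>)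
  then show ?thesis using dvd_minors_unimod_equiv[OF E] by simp
qed

section \<open>Nonvanishing minors in heavy positions\<close>

text \<open>A permutation avoiding the block would map the \<open>r - p\<close> indices from \<open>p\<close> on injectively
  to the \<open>r - p - 1\<close> indices after \<open>p\<close>.\<close>

lemma det_zero_block:
  fixes A :: "'a::comm_ring_1 mat"
  assumes A: "A \<in> carrier_mat r r" and p: "p < r"
    and zero: "\<And>i k. p \<le> i \<Longrightarrow> i < r \<Longrightarrow> k \<le> p \<Longrightarrow> A $$ (i, k) = 0"
  shows "det A = 0"
proof -
  have "(\<Prod>i = 0..<r. A $$ (i, \<pi> i)) = 0" if \<pi>: "\<pi> permutes {0..<r}" for \<pi>
  proof -
    have "\<exists>i\<in>{p..<r}. \<pi> i \<le> p"
    proof (rule ccontr)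
      assume "\<not> ?thesis"
      moreover have "\<pi> i < r" if "i < r" for i
        using permutes_in_image[OF \<pi>, of i] that by auto
      ultimately have "\<pi> ` {p..<r} \<subseteq> {Suc p..<r}" by auto
      then have "card (\<pi> ` {p..<r}) \<le> card {Suc p..<r}" by (intro card_mono) auto
      moreover have "card (\<pi> ` {p..<r}) = r - p"
        using permutes_inj[OF \<pi>] by (subst card_image) (auto intro: inj_on_subset)
      ultimately show False using p by simp
    qed
    then show ?thesis using zero by (intro prod_zero) (auto intro!: bexI)
  qed
  then show ?thesis unfolding det_def'[OF A] by (intro sum.neutral) auto
qed

text \<open>Otherwise the adjugate of \<open>A\<close> would have a zero block as above, although it is nonsingular.\<close>

lemma nonzero_cofactor_in_corner:
  fixes A :: "'a::idom mat"
  assumes A: "A \<in> carrier_mat r r" and det: "det A \<noteq> 0" and p: "p < r"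
  shows "\<exists>q p'. q \<le> p \<and> p \<le> p' \<and> p' < r \<and> det (mat_delete A q p') \<noteq> 0"
proof (rule ccontr)
  assume contr: "\<not> ?thesis"
  have "det (adj_mat A) = 0"
  proof (rule det_zero_block[OF _ p])
    fix i k assume ik: "p \<le> i" "i < r" "k \<le> p"
    then have "det (mat_delete A k i) = 0" using contr by blast
    then show "adj_mat A $$ (i, k) = 0"
      using A ik p unfolding adj_mat_def cofactor_def by auto
  qed (use adj_mat(1)[OF A] in auto)
  moreover have "det A * det (adj_mat A) = det (det A \<cdot>\<^sub>m 1\<^sub>m r)"
    using adj_mat(1,2)[OF A] det_mult[OF A adj_mat(1)[OF A]] by simp
  ultimately show False using det by simp
qed

lemma insert_index_mono: "i \<le> k \<Longrightarrow> insert_index q i \<le> insert_index q k"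
  unfolding insert_index_def by auto

text \<open>The minor has at least the total weight of the positions \<open>(i, i)\<close>, \<open>i \<in> S\<close>, separately for
  rows (where weights increase) and columns (where they decrease). As long as some \<open>p\<close> is missing
  from \<open>S\<close>, a row \<open>q \<le> p\<close> and a column \<open>p' \<ge> p\<close> are deleted without making the matrix
  singular. The diagonal positions of the smaller matrix are at least as heavy as those with
  \<open>i \<noteq> p\<close> of the larger one: renumbering moves rows only to larger and columns only to smaller
  indices.\<close>

lemma exists_heavy_minor:
  fixes E :: "'a::idom mat" and \<kappa> l :: "nat \<Rightarrow> nat"
  assumes "E \<in> carrier_mat r r" and "det E \<noteq> 0" and "S \<subseteq> {0..<r}"
    and "\<And>i k. i \<le> k \<Longrightarrow> k < r \<Longrightarrow> \<kappa> i \<le> \<kappa> k" and "\<And>i k. i \<le> k \<Longrightarrow> k < r \<Longrightarrow> l k \<le> l i"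
  shows "\<exists>\<rho>\<in>{0..<card S} \<rightarrow> {0..<r}. \<exists>\<gamma>\<in>{0..<card S} \<rightarrow> {0..<r}. minor E (card S) \<rho> \<gamma> \<noteq> 0 \<and>
    (\<Sum>i\<in>S. \<kappa> i) \<le> (\<Sum>a = 0..<card S. \<kappa> (\<rho> a)) \<and> (\<Sum>i\<in>S. l i) \<le> (\<Sum>a = 0..<card S. l (\<gamma> a))"
  using assms
proof (induction r arbitrary: E S \<kappa> l)
  case 0
  then have "minor E 0 id id \<noteq> 0" by (simp add: minor_id)
  then show ?case using 0 by (intro bexI[of _ id]) (auto simp del: id_apply simp: id_def)
next
  case (Suc r)
  note E = Suc.prems(1)
  show ?case
  proof (cases "S = {0..<Suc r}")
    case True
    then have "minor E (card S) id id \<noteq> 0" using Suc.prems by (simp add: minor_id)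
    then show ?thesis using True by (intro bexI[of _ id]) (auto simp: id_def)
  next
    case False
    then have "\<not> {0..<Suc r} \<subseteq> S" using Suc.prems(3) by blast
    then obtain p where "p \<in> {0..<Suc r}" and p2: "p \<notin> S" by blast
    then have p: "p < Suc r" "p \<notin> S" by auto
    obtain q p' where qp: "q \<le> p" "p \<le> p'" "p' < Suc r" and det: "det (mat_delete E q p') \<noteq> 0"
      using nonzero_cofactor_in_corner[OF E Suc.prems(2) p(1)] by blast
    define S' where "S' = delete_index p ` S"
    have inj: "inj_on (delete_index p) S"
    proof (rule inj_onI)
      fix x y assume "x \<in> S" "y \<in> S" and eq: "delete_index p x = delete_index p y"
      then have "x \<noteq> p" "y \<noteq> p" using p by auto
      then show "x = y" using eq unfolding delete_index_def by (simp split: if_splits)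
    qed
    have card: "card S' = card S" unfolding S'_def using inj by (simp add: card_image)
    have S': "S' \<subseteq> {0..<r}"
    proof
      fix x assume "x \<in> S'"
      then obtain s where s: "s \<in> S" "x = delete_index p s" unfolding S'_def by auto
      then have "s < Suc r" "s \<noteq> p" using Suc.prems(3) p by auto
      then show "x \<in> {0..<r}" using p s unfolding delete_index_def by auto
    qed
    have D: "mat_delete E q p' \<in> carrier_mat r r"
      using mat_delete_carrier[OF E] by simp
    obtain \<rho> \<gamma> where \<rho>: "\<rho> \<in> {0..<card S} \<rightarrow> {0..<r}" and \<gamma>: "\<gamma> \<in> {0..<card S} \<rightarrow> {0..<r}"
      and minor: "minor (mat_delete E q p') (card S) \<rho> \<gamma> \<noteq> 0"
      and s1: "(\<Sum>i\<in>S'. \<kappa> (insert_index q i)) \<le> (\<Sum>a = 0..<card S. \<kappa> (insert_index q (\<rho> a)))"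
      and s2: "(\<Sum>i\<in>S'. l (insert_index p' i)) \<le> (\<Sum>a = 0..<card S. l (insert_index p' (\<gamma> a)))"
      using Suc.IH[OF D det S', of "\<lambda>i. \<kappa> (insert_index q i)" "\<lambda>i. l (insert_index p' i)"]
        Suc.prems(4,5) insert_index_mono card by (auto simp: insert_index_def)
    have "minor (mat_delete E q p') (card S) \<rho> \<gamma> =
        minor E (card S) (\<lambda>a. insert_index q (\<rho> a)) (\<lambda>a. insert_index p' (\<gamma> a))"
      using \<rho> \<gamma> E by (intro minor_cong) (auto simp: mat_delete_def insert_index_def Pi_def)
    moreover have "(\<Sum>i\<in>S. \<kappa> i) \<le> (\<Sum>i\<in>S'. \<kappa> (insert_index q i))"
      unfolding S'_def sum.reindex[OF inj] comp_def
    proof (rule sum_mono)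
      fix i assume "i \<in> S"
      then have i: "i < Suc r" "i \<noteq> p" using Suc.prems(3) p by auto
      then have "i \<le> insert_index q (delete_index p i)" "insert_index q (delete_index p i) < Suc r"
        using qp p unfolding insert_index_def delete_index_def by auto
      then show "\<kappa> i \<le> \<kappa> (insert_index q (delete_index p i))" using Suc.prems(4) by blast
    qed
    moreover have "(\<Sum>i\<in>S. l i) \<le> (\<Sum>i\<in>S'. l (insert_index p' i))"
      unfolding S'_def sum.reindex[OF inj] comp_def
    proof (rule sum_mono)
      fix i assume "i \<in> S"
      then have i: "i < Suc r" "i \<noteq> p" using Suc.prems(3) p by auto
      then have "insert_index p' (delete_index p i) \<le> i"
        using qp p unfolding insert_index_def delete_index_def by auto
      then show "l i \<le> l (insert_index p' (delete_index p i))" using Suc.prems(5) i by blast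
    qed
    ultimately show ?thesis
      using minor s1 s2 \<rho> \<gamma>
      by (intro bexI[of _ "\<lambda>a. insert_index q (\<rho> a)"] bexI[of _ "\<lambda>a. insert_index p' (\<gamma> a)"])
        (auto simp: insert_index_def Pi_def less_Suc_eq)
  qed
qed

section \<open>Reversal of polynomials and of matrices with degree bounds\<close>

lemma coeff_poly_reversal: "coeff (poly_reversal d p) i = (if i \<le> d then coeff p (d - i) else 0)"
proof -
  have "coeff (poly_reversal d p) i = (\<Sum>k\<le>d. if d - k = i then coeff p k else 0)"
    unfolding poly_reversal_def by (simp add: coeff_sum)
  also have "\<dots> = (\<Sum>k\<le>d. if k = d - i \<and> i \<le> d then coeff p k else 0)"
    by (intro sum.cong) auto
  also have "\<dots> = (if i \<le> d then coeff p (d - i) else 0)"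
    by (cases "i \<le> d") (simp_all add: sum.delta)
  finally show ?thesis .
qed

lemma poly_reversal_0 [simp]: "poly_reversal d 0 = 0"
  by (intro poly_eqI) (simp add: coeff_poly_reversal)

lemma poly_reversal_add: "poly_reversal d (p + q) = poly_reversal d p + poly_reversal d q"
  by (intro poly_eqI) (simp add: coeff_poly_reversal)

lemma poly_reversal_uminus: "poly_reversal d (- p) = - poly_reversal d p"
  by (intro poly_eqI) (simp add: coeff_poly_reversal)

lemma poly_reversal_sum: "poly_reversal d (\<Sum>x\<in>A. f x) = (\<Sum>x\<in>A. poly_reversal d (f x))"
  by (induction A rule: infinite_finite_induct) (auto simp: poly_reversal_add)

lemma degree_poly_reversal: "degree (poly_reversal d p) \<le> d"
  by (rule degree_le) (simp add: coeff_poly_reversal)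

lemma poly_reversal_reversal: "degree p \<le> d \<Longrightarrow> poly_reversal d (poly_reversal d p) = p"
  by (intro poly_eqI) (auto simp: coeff_poly_reversal coeff_eq_0)

text \<open>Connects reversal with respect to a degree bound to the multiplicative \<open>reflect_poly\<close>.\<close>

lemma poly_reversal_conv_reflect:
  "degree p \<le> d \<Longrightarrow> poly_reversal d p = monom 1 (d - degree p) * reflect_poly p"
  by (intro poly_eqI) (auto simp: coeff_poly_reversal coeff_monom_mult coeff_reflect_poly coeff_eq_0)

lemma poly_reversal_mult:
  assumes "degree p \<le> a" "degree q \<le> b"
  shows "poly_reversal (a + b) (p * q) = poly_reversal a p * poly_reversal b (q :: 'a::field poly)"
proof (cases "p = 0 \<or> q = 0")
  case False
  then have deg: "degree (p * q) = degree p + degree q" by (simp add: degree_mult_eq)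
  have "a + b - degree (p * q) = (a - degree p) + (b - degree q)" using assms deg by simp
  then have "monom (1::'a) (a + b - degree (p * q)) = monom 1 (a - degree p) * monom 1 (b - degree q)"
    by (simp add: mult_monom)
  then show ?thesis
    using assms deg by (simp add: poly_reversal_conv_reflect reflect_poly_mult mult_ac)
qed auto

text \<open>The order of vanishing of the reversal at \<open>0\<close> is the amount by which the degree stays below
  the bound.\<close>

lemma monom_dvd_poly_reversal:
  fixes p :: "'a::field poly"
  assumes "degree p \<le> d"
  shows "monom 1 k dvd poly_reversal d p \<longleftrightarrow> p = 0 \<or> degree p + k \<le> d"
proof
  assume "monom 1 k dvd poly_reversal d p"
  then have c: "\<And>i. i < k \<Longrightarrow> coeff (poly_reversal d p) i = 0"
    by (simp add: monom_1_dvd_iff')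
  show "p = 0 \<or> degree p + k \<le> d"
  proof (rule ccontr)
    assume "\<not> ?thesis"
    then have "p \<noteq> 0" "d - degree p < k" using assms by auto
    then show False using c[of "d - degree p"] assms by (simp add: coeff_poly_reversal)
  qed
next
  assume "p = 0 \<or> degree p + k \<le> d"
  then show "monom 1 k dvd poly_reversal d p"
    by (cases "p = 0") (auto simp: monom_1_dvd_iff' coeff_poly_reversal intro!: coeff_eq_0)
qed

text \<open>Reversal is the substitution \<open>s = 1/t\<close>, so it exchanges the nonzero points \<open>b\<close> and \<open>1/b\<close>
  and preserves multiplicities there. One direction suffices, reversal being an involution.\<close>

lemma linear_power_dvd_poly_reversal:
  fixes p :: "'a::field poly"
  assumes b: "b \<noteq> 0" and deg: "degree p \<le> d"
  shows "[:- b, 1:] ^ k dvd poly_reversal d p \<longleftrightarrow> [:- inverse b, 1:] ^ k dvd p"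
proof -
  have dir: "[:- b, 1:] ^ k dvd poly_reversal d p"
    if b: "b \<noteq> 0" and deg: "degree p \<le> d" and dvd: "[:- inverse b, 1:] ^ k dvd p" for b :: 'a and p
  proof (cases "p = 0")
    case False
    let ?L = "[:- inverse b, 1:]"
    obtain q where q: "p = ?L ^ k * q" using dvd by (elim dvdE)
    have degL: "degree (?L ^ j) = j" for j by (simp add: degree_power_eq)
    have "degree p = k + degree q" using False q degL by (simp add: degree_mult_eq)
    then have k: "k \<le> d" "degree q \<le> d - k" using deg by auto
    have "poly_reversal j (?L ^ j) = [:1, - inverse b:] ^ j" for j
    proof (induction j)
      case 0
      show ?case by (intro poly_eqI) (auto simp: coeff_poly_reversal)
    next
      case (Suc j)
      have "poly_reversal (Suc j) (?L ^ Suc j) = poly_reversal (1 + j) (?L * ?L ^ j)" by simp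
      also have "\<dots> = poly_reversal 1 ?L * poly_reversal j (?L ^ j)"
        by (rule poly_reversal_mult) (auto simp: degL)
      also have "poly_reversal 1 ?L = [:1, - inverse b:]"
        by (intro poly_eqI) (auto simp: coeff_poly_reversal coeff_pCons split: nat.splits)
      finally show ?case using Suc by simp
    qed
    moreover have "poly_reversal (k + (d - k)) p = poly_reversal k (?L ^ k) * poly_reversal (d - k) q"
      unfolding q using k degL by (intro poly_reversal_mult) auto
    ultimately have "[:1, - inverse b:] ^ k dvd poly_reversal d p" using k by simp
    moreover have "[:1, - inverse b:] ^ k = Polynomial.smult ((- inverse b) ^ k) ([:- b, 1:] ^ k)"
    proof -
      have "[:1, - inverse b:] = Polynomial.smult (- inverse b) [:- b, 1:]" using b by simp
      then show ?thesis by (simp only: smult_power)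
    qed
    ultimately show ?thesis
      using b by (simp add: smult_dvd_iff)
  qed auto
  show ?thesis
  proof
    assume "[:- b, 1:] ^ k dvd poly_reversal d p"
    then have "[:- inverse b, 1:] ^ k dvd poly_reversal d (poly_reversal d p)"
      using b dir[of "inverse b" "poly_reversal d p"] degree_poly_reversal[of d p] by simp
    then show "[:- inverse b, 1:] ^ k dvd p" by (simp add: poly_reversal_reversal deg)
  qed (use dir b deg in blast)
qed

text \<open>The zero entries are exempted because \<open>d - \<kappa> i - l k\<close> may be negative.\<close>

definition degree_bounded :: "nat \<Rightarrow> (nat \<Rightarrow> nat) \<Rightarrow> (nat \<Rightarrow> nat) \<Rightarrow> 'a::zero poly mat \<Rightarrow> bool" where
  "degree_bounded d \<kappa> l E \<longleftrightarrow> (\<forall>i<dim_row E. \<forall>k<dim_col E.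
     E $$ (i, k) = 0 \<or> degree (E $$ (i, k)) + \<kappa> i + l k \<le> d)"

text \<open>Where the subtraction is truncated, the bound forces the entry to be zero, and the reversal of \<open>0\<close>
  is \<open>0\<close> with respect to every degree.\<close>

definition weighted_reversal :: "nat \<Rightarrow> (nat \<Rightarrow> nat) \<Rightarrow> (nat \<Rightarrow> nat) \<Rightarrow> 'a::field poly mat \<Rightarrow> 'a poly mat" where
  "weighted_reversal d \<kappa> l E = mat (dim_row E) (dim_col E)
     (\<lambda>(i, k). poly_reversal (d - (\<kappa> i + l k)) (E $$ (i, k)))"

lemma poly_reversal_prod:
  fixes f :: "nat \<Rightarrow> 'a::field poly"
  assumes "\<And>a. a < j \<Longrightarrow> f a = 0 \<or> degree (f a) + w a \<le> d"
  shows "(\<Prod>a = 0..<j. poly_reversal (d - w a) (f a)) = poly_reversal (j * d - (\<Sum>a = 0..<j. w a)) (\<Prod>a = 0..<j. f a)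
    \<and> ((\<Prod>a = 0..<j. f a) = 0 \<or> degree (\<Prod>a = 0..<j. f a) + (\<Sum>a = 0..<j. w a) \<le> j * d)"
  using assms
proof (induction j)
  case 0
  show ?case by (auto intro!: poly_eqI simp: coeff_poly_reversal)
next
  case (Suc j)
  let ?P = "\<Prod>a = 0..<j. f a" and ?W = "\<Sum>a = 0..<j. w a"
  have IH: "(\<Prod>a = 0..<j. poly_reversal (d - w a) (f a)) = poly_reversal (j * d - ?W) ?P"
    "?P = 0 \<or> degree ?P + ?W \<le> j * d"
    using Suc by auto
  show ?case
  proof (cases "?P = 0 \<or> f j = 0")
    case True
    then have z: "?P * f j = 0" by (simp only: mult_eq_0_iff)
    have z': "poly_reversal (j * d - ?W) ?P * poly_reversal (d - w j) (f j) = 0"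
      using True by (elim disjE) (simp_all only: poly_reversal_0 mult_zero_left mult_zero_right)
    show ?thesis
      unfolding prod.atLeast0_lessThan_Suc IH(1) z z' by simp
  next
    case False
    then have d: "degree ?P + ?W \<le> j * d" "degree (f j) + w j \<le> d"
      using IH Suc.prems[of j] by auto
    then have "poly_reversal ((j * d - ?W) + (d - w j)) (?P * f j) =
        poly_reversal (j * d - ?W) ?P * poly_reversal (d - w j) (f j)"
      by (intro poly_reversal_mult) auto
    moreover have "(j * d - ?W) + (d - w j) = Suc j * d - (?W + w j)" using d by simp
    ultimately show ?thesis
      using IH d False by (auto simp: degree_mult_eq)
  qed
qed

text \<open>The bounds of the entries selected by a permutation add up to a number that does not depend on the
  permutation, so all Leibniz terms are reversed alike.\<close>

lemma minor_weighted_reversal: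
  fixes E :: "'a::field poly mat"
  assumes E: "E \<in> carrier_mat r r" and bd: "degree_bounded d \<kappa> l E"
    and \<rho>: "\<rho> \<in> {0..<j} \<rightarrow> {0..<r}" and \<gamma>: "\<gamma> \<in> {0..<j} \<rightarrow> {0..<r}"
  defines "W \<equiv> (\<Sum>a = 0..<j. \<kappa> (\<rho> a)) + (\<Sum>a = 0..<j. l (\<gamma> a))"
  shows "minor (weighted_reversal d \<kappa> l E) j \<rho> \<gamma> = poly_reversal (j * d - W) (minor E j \<rho> \<gamma>)"
    and "minor E j \<rho> \<gamma> = 0 \<or> degree (minor E j \<rho> \<gamma>) + W \<le> j * d"
proof -
  let ?P = "{p. p permutes {0..<j}}"
  let ?t = "\<lambda>p. \<Prod>a = 0..<j. E $$ (\<rho> a, \<gamma> (p a))"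
  have W: "(\<Sum>a = 0..<j. \<kappa> (\<rho> a) + l (\<gamma> (p a))) = W" if "p \<in> ?P" for p
  proof -
    have "(\<Sum>a = 0..<j. l (\<gamma> (p a))) = (\<Sum>a = 0..<j. l (\<gamma> a))"
      using sum.permute[of p "{0..<j}" "\<lambda>a. l (\<gamma> a)"] that by (simp add: comp_def)
    then show ?thesis by (simp add: W_def sum.distrib)
  qed
  have range: "\<rho> a < r" "\<gamma> (p a) < r" if "p \<in> ?P" "a < j" for p a
  proof -
    have "p a < j" using that permutes_in_image[of p "{0..<j}" a] by simp
    then show "\<rho> a < r" "\<gamma> (p a) < r" using funcset_mem[OF \<rho>, of a] funcset_mem[OF \<gamma>, of "p a"] that by auto
  qed
  have t: "(\<Prod>a = 0..<j. weighted_reversal d \<kappa> l E $$ (\<rho> a, \<gamma> (p a))) = poly_reversal (j * d - W) (?t p)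
      \<and> (?t p = 0 \<or> degree (?t p) + W \<le> j * d)" if p: "p \<in> ?P" for p
  proof -
    have "(\<Prod>a = 0..<j. weighted_reversal d \<kappa> l E $$ (\<rho> a, \<gamma> (p a))) =
        (\<Prod>a = 0..<j. poly_reversal (d - (\<kappa> (\<rho> a) + l (\<gamma> (p a)))) (E $$ (\<rho> a, \<gamma> (p a))))"
      using range[OF p] E by (intro prod.cong) (auto simp: weighted_reversal_def)
    then show ?thesis
      using poly_reversal_prod[of j "\<lambda>a. E $$ (\<rho> a, \<gamma> (p a))" "\<lambda>a. \<kappa> (\<rho> a) + l (\<gamma> (p a))" d]
        bd range[OF p] E W[OF p] by (auto simp: degree_bounded_def add.assoc)
  qed
  have sgn: "signof p = (1::'a poly) \<or> signof p = (-1::'a poly)" for p :: "nat \<Rightarrow> nat"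
    by (simp add: sign_def)
  have rs: "signof p * poly_reversal N q = poly_reversal N (signof p * q)" for p :: "nat \<Rightarrow> nat" and N and q :: "'a poly"
    using sgn[of p] by (auto simp: poly_reversal_uminus)
  show "minor (weighted_reversal d \<kappa> l E) j \<rho> \<gamma> = poly_reversal (j * d - W) (minor E j \<rho> \<gamma>)"
    unfolding minor_Leibniz poly_reversal_sum
    using t by (intro sum.cong) (auto simp: rs)
  show "minor E j \<rho> \<gamma> = 0 \<or> degree (minor E j \<rho> \<gamma>) + W \<le> j * d"
  proof (cases "\<exists>p\<in>?P. ?t p \<noteq> 0")
    case True
    then have Wle: "W \<le> j * d" using t by fastforce
    have "degree (minor E j \<rho> \<gamma>) \<le> j * d - W"
      unfolding minor_Leibniz
    proof (rule degree_sum_le)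
      fix p assume p: "p \<in> ?P"
      have "?t p = 0 \<or> degree (?t p) + W \<le> j * d" using t[OF p] by blast
      then have "degree (?t p) \<le> j * d - W"
        by (elim disjE, simp only: degree_0 le0, linarith)
      then show "degree (signof p * ?t p) \<le> j * d - W" using sgn[of p] by auto
    qed (simp add: finite_permutations)
    then show ?thesis using Wle by linarith
  next
    case False
    then show ?thesis unfolding minor_Leibniz by (auto intro!: sum.neutral)
  qed
qed

section \<open>Polynomials that split into linear factors\<close>

lemma dvd_if_order_le:
  fixes p q :: "'a::field poly"
  assumes closed: "\<forall>p :: 'a poly. 0 < degree p \<longrightarrow> (\<exists>x. poly p x = 0)"
    and "p \<noteq> 0" "q \<noteq> 0" "\<And>a. order a p \<le> order a q"
  shows "p dvd q"
  using assms(2-)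
proof (induction "degree p" arbitrary: p q)
  case 0
  then have "is_unit p" by (simp add: is_unit_iff_degree)
  then show ?case by (rule unit_imp_dvd)
next
  case (Suc n)
  obtain x where x: "poly p x = 0" using closed Suc.hyps(2) by (metis zero_less_Suc)
  let ?L = "[:- x, 1:]"
  obtain p' where p: "p = ?L * p'" using x by (auto simp: poly_eq_0_iff_dvd elim: dvdE)
  have "order x p \<noteq> 0" using x Suc.prems by (simp add: order_root)
  then have "poly q x = 0" using Suc.prems(2) Suc.prems(3)[of x] by (simp add: order_root)
  then obtain q' where q: "q = ?L * q'" by (auto simp: poly_eq_0_iff_dvd elim: dvdE)
  have nz: "p' \<noteq> 0" "q' \<noteq> 0" using p q Suc.prems by auto
  have "degree p = Suc (degree p')" using nz unfolding p by (subst degree_mult_eq) auto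
  moreover have "Polynomial.order a p' \<le> Polynomial.order a q'" for a
    using Suc.prems(3)[of a] order_mult[of ?L p' a] order_mult[of ?L q' a] Suc.prems(1,2)
    unfolding p q by simp
  ultimately have "p' dvd q'"
    using Suc.hyps nz by simp
  then show ?case unfolding p q by (rule mult_dvd_mono[OF dvd_refl])
qed

text \<open>Over a field where polynomials split, linear factors of \<open>q div p\<close> can be added to \<open>p\<close> one at a
  time.\<close>

lemma ex_monic_between:
  fixes p q :: "'a::field poly"
  assumes closed: "\<forall>p :: 'a poly. 0 < degree p \<longrightarrow> (\<exists>x. poly p x = 0)"
    and "p dvd q" "q \<noteq> 0" "lead_coeff p = 1" "degree p \<le> e" "e \<le> degree q"
  shows "\<exists>\<pi>. p dvd \<pi> \<and> \<pi> dvd q \<and> lead_coeff \<pi> = 1 \<and> degree \<pi> = e"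
  using assms(2-)
proof (induction "e - degree p" arbitrary: p)
  case 0
  then show ?case by (intro exI[of _ p]) auto
next
  case (Suc n)
  obtain u where u: "q = p * u" using Suc.prems by (elim dvdE)
  then have nz: "p \<noteq> 0" "u \<noteq> 0" using Suc.prems by auto
  then have "degree q = degree p + degree u" unfolding u by (simp add: degree_mult_eq)
  then have "0 < degree u" using Suc.prems Suc.hyps(2) by simp
  then obtain x where "poly u x = 0" using closed by blast
  then have x: "[:- x, 1:] dvd u" by (simp add: poly_eq_0_iff_dvd)
  define p' where "p' = p * [:- x, 1:]"
  have pp': "p dvd p'" unfolding p'_def by (rule dvd_triv_left)
  have dvd: "p' dvd q" unfolding u p'_def by (rule mult_dvd_mono[OF dvd_refl x])
  have deg: "degree p' = Suc (degree p)" using nz unfolding p'_def by (subst degree_mult_eq) auto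
  have lc: "lead_coeff p' = 1" using Suc.prems(3) unfolding p'_def lead_coeff_mult by simp
  have "\<exists>\<pi>. p' dvd \<pi> \<and> \<pi> dvd q \<and> lead_coeff \<pi> = 1 \<and> degree \<pi> = e"
    using Suc.prems Suc.hyps(2) dvd deg lc by (intro Suc.hyps(1)) auto
  then show ?case using pp' dvd_trans by blast
qed

section \<open>Column spaces over the field of fractions in terms of polynomials\<close>

lemma mult_mat_vec_nth:
  "\<lbrakk>M \<in> carrier_mat m r; x \<in> carrier_vec r; a < m\<rbrakk> \<Longrightarrow> (M *\<^sub>v x) $ a = (\<Sum>i = 0..<r. M $$ (a, i) * x $ i)"
  by (auto simp: scalar_prod_def)

lemma mult_mat_unit_vec:
  fixes M :: "'a::comm_ring_1 mat"
  assumes "M \<in> carrier_mat m r" "i < r"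
  shows "M *\<^sub>v unit_vec r i = col M i"
  using assms by (intro eq_vecI) auto

lemma smult_mat_mult_vec:
  fixes M :: "'a::comm_ring_1 mat"
  assumes "M \<in> carrier_mat m r" "x \<in> carrier_vec r"
  shows "(q \<cdot>\<^sub>m M) *\<^sub>v x = q \<cdot>\<^sub>v (M *\<^sub>v x)"
  using assms by (intro eq_vecI) (auto simp: scalar_prod_def sum_distrib_left mult.assoc)

lemma mult_mat_smult_vec:
  fixes M :: "'a::comm_ring_1 mat"
  assumes "M \<in> carrier_mat m r" "x \<in> carrier_vec r"
  shows "M *\<^sub>v (q \<cdot>\<^sub>v x) = q \<cdot>\<^sub>v (M *\<^sub>v x)"
  using assms by (intro eq_vecI) (auto simp: scalar_prod_def sum_distrib_left mult.left_commute)

lemma fract_mat_mult_vec: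
  "\<lbrakk>M \<in> carrier_mat m r; x \<in> carrier_vec r\<rbrakk> \<Longrightarrow> fract_mat M *\<^sub>v fract_vec x = fract_vec (M *\<^sub>v x)"
  by (rule eq_vecI) (auto simp: scalar_prod_def)

lemma fract_mat_mult:
  "\<lbrakk>M \<in> carrier_mat m r; N \<in> carrier_mat r n\<rbrakk> \<Longrightarrow> fract_mat (M * N) = fract_mat M * fract_mat N"
  by (rule eq_matI) (auto simp: scalar_prod_def)

lemma fract_vec_smult: "fract_vec (q \<cdot>\<^sub>v x) = to_fract q \<cdot>\<^sub>v fract_vec x"
  by (rule eq_vecI) auto

lemma fract_vec_eq_iff: "fract_vec x = fract_vec y \<longleftrightarrow> x = y"
proof
  assume eq: "fract_vec x = fract_vec y"
  show "x = y"
  proof (rule eq_vecI)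
    show "dim_vec x = dim_vec y" using arg_cong[OF eq, of dim_vec] by simp
    fix i assume "i < dim_vec y"
    then show "x $ i = y $ i"
      using arg_cong[OF eq, of "\<lambda>v. v $ i"] \<open>dim_vec x = dim_vec y\<close> by simp
  qed
qed auto

lemma common_denominator:
  fixes x :: "'a::field poly fract vec"
  assumes x: "x \<in> carrier_vec n"
  shows "\<exists>q y. q \<noteq> 0 \<and> y \<in> carrier_vec n \<and> to_fract q \<cdot>\<^sub>v x = fract_vec y"
proof -
  have "\<exists>a b. z = to_fract a / to_fract b \<and> b \<noteq> 0" for z :: "'a poly fract"
    by (cases z) (auto simp: Fract_conv_to_fract)
  then have "\<forall>i. \<exists>ab. x $ i = to_fract (fst ab) / to_fract (snd ab) \<and> snd ab \<noteq> 0"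
    by (metis fst_conv snd_conv)
  then obtain f where f: "\<And>i. x $ i = to_fract (fst (f i)) / to_fract (snd (f i)) \<and> snd (f i) \<noteq> 0"
    by metis
  let ?q = "\<Prod>i<n. snd (f i)"
  let ?y = "vec n (\<lambda>i. fst (f i) * (\<Prod>j\<in>{..<n} - {i}. snd (f j)))"
  have "to_fract ?q \<cdot>\<^sub>v x = fract_vec ?y"
  proof (rule eq_vecI)
    fix i assume "i < dim_vec (fract_vec ?y)"
    then have i: "i < n" by simp
    have "?q = snd (f i) * (\<Prod>j\<in>{..<n} - {i}. snd (f j))"
      using i by (intro prod.remove) auto
    then have "to_fract ?q * x $ i = to_fract (fst (f i)) * to_fract (\<Prod>j\<in>{..<n} - {i}. snd (f j))"
      using f[of i] by simp
    then show "(to_fract ?q \<cdot>\<^sub>v x) $ i = fract_vec ?y $ i" using i x by simp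
  qed (use x in auto)
  moreover have "?q \<noteq> 0" using f by auto
  ultimately show ?thesis by (intro exI[of _ ?q] exI[of _ ?y]) auto
qed

lemma col_range_eq:
  assumes "M \<in> carrier_mat m r"
  shows "col_range M = {y \<in> carrier_vec m. \<exists>x\<in>carrier_vec r. fract_mat M *\<^sub>v x = y}"
  using vec_space.col_space_eq[of "fract_mat M" m r] assms unfolding col_range_def by auto

text \<open>Clearing denominators.\<close>

lemma fract_vec_in_col_range_iff:
  assumes M: "M \<in> carrier_mat m r" and v: "v \<in> carrier_vec m"
  shows "fract_vec v \<in> col_range M \<longleftrightarrow> (\<exists>q y. q \<noteq> 0 \<and> y \<in> carrier_vec r \<and> q \<cdot>\<^sub>v v = M *\<^sub>v y)"
proof
  assume "fract_vec v \<in> col_range M"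
  then obtain x where x: "x \<in> carrier_vec r" "fract_mat M *\<^sub>v x = fract_vec v"
    unfolding col_range_eq[OF M] by auto
  obtain q y where q: "q \<noteq> 0" "y \<in> carrier_vec r" "to_fract q \<cdot>\<^sub>v x = fract_vec y"
    using common_denominator[OF x(1)] by blast
  have "fract_vec (M *\<^sub>v y) = fract_mat M *\<^sub>v (to_fract q \<cdot>\<^sub>v x)"
    using M q by (simp add: fract_mat_mult_vec)
  also have "\<dots> = fract_vec (q \<cdot>\<^sub>v v)"
    using M x mult_mat_vec[of "fract_mat M" m r x "to_fract q"] by (simp add: fract_vec_smult)
  finally show "\<exists>q y. q \<noteq> 0 \<and> y \<in> carrier_vec r \<and> q \<cdot>\<^sub>v v = M *\<^sub>v y"
    using q(1,2) fract_vec_eq_iff[of "M *\<^sub>v y" "q \<cdot>\<^sub>v v"] by (metis)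
next
  assume "\<exists>q y. q \<noteq> 0 \<and> y \<in> carrier_vec r \<and> q \<cdot>\<^sub>v v = M *\<^sub>v y"
  then obtain q y where q: "q \<noteq> 0" "y \<in> carrier_vec r" "q \<cdot>\<^sub>v v = M *\<^sub>v y" by blast
  let ?x = "inverse (to_fract q) \<cdot>\<^sub>v fract_vec y"
  have "fract_mat M *\<^sub>v ?x = inverse (to_fract q) \<cdot>\<^sub>v (fract_mat M *\<^sub>v fract_vec y)"
    using M q(2) by (intro mult_mat_vec) auto
  also have "fract_mat M *\<^sub>v fract_vec y = to_fract q \<cdot>\<^sub>v fract_vec v"
    using M q by (simp add: fract_mat_mult_vec flip: fract_vec_smult)
  also have "inverse (to_fract q) \<cdot>\<^sub>v (to_fract q \<cdot>\<^sub>v fract_vec v) = fract_vec v"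
    using q(1) by (simp add: smult_smult_assoc)
  finally show "fract_vec v \<in> col_range M"
    unfolding col_range_eq[OF M] using q v by (auto intro!: bexI[of _ ?x])
qed

lemma col_range_mult_subset:
  assumes M: "M \<in> carrier_mat m r" and N: "N \<in> carrier_mat r n"
  shows "col_range (M * N) \<subseteq> col_range M"
proof
  fix y assume "y \<in> col_range (M * N)"
  then obtain x where x: "y \<in> carrier_vec m" "x \<in> carrier_vec n" "fract_mat (M * N) *\<^sub>v x = y"
    unfolding col_range_eq[OF mult_carrier_mat[OF M N]] by auto
  then have "fract_mat M *\<^sub>v (fract_mat N *\<^sub>v x) = y"
    using M N assoc_mult_mat_vec[of "fract_mat M" m r "fract_mat N" n x] by (simp add: fract_mat_mult[OF M N])
  then show "y \<in> col_range M"
    unfolding col_range_eq[OF M] using x N by (auto intro!: bexI[of _ "fract_mat N *\<^sub>v x"])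
qed

lemma col_range_subsetI:
  assumes M: "M \<in> carrier_mat m k" and N: "N \<in> carrier_mat m r"
    and cols: "\<And>i. i < k \<Longrightarrow> fract_vec (col M i) \<in> col_range N"
  shows "col_range M \<subseteq> col_range N"
proof -
  interpret vec_space "TYPE('a poly fract)" m .
  have "set (cols (fract_mat M)) \<subseteq> col_range N"
    using cols M by (auto simp: cols_def)
  moreover have "submodule class_ring (span (set (cols (fract_mat N)))) V"
    using N cols_dim[of "fract_mat N"] by (intro span_is_submodule) auto
  moreover have "col_range N = span (set (cols (fract_mat N)))" "col_range M = span (set (cols (fract_mat M)))"
    using M N by (simp_all add: col_range_def col_space_def)
  ultimately show ?thesis
    using span_is_subset by metis
qed

lemma col_range_scaled_mult:
  assumes M: "M \<in> carrier_mat m k" and N: "N \<in> carrier_mat m r" and T: "T \<in> carrier_mat r k"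
    and q: "q \<noteq> 0" and eq: "q \<cdot>\<^sub>m M = N * T"
  shows "col_range M \<subseteq> col_range N"
proof (rule col_range_subsetI[OF M N])
  fix i assume i: "i < k"
  have "q \<cdot>\<^sub>v col M i = col (q \<cdot>\<^sub>m M) i" using M i by auto
  also have "\<dots> = N *\<^sub>v col T i" unfolding eq by (rule col_mult2[OF N T i])
  finally show "fract_vec (col M i) \<in> col_range N"
    using q T M i by (subst fract_vec_in_col_range_iff[OF N]) (auto intro!: exI[of _ q] exI[of _ "col T i"])
qed

text \<open>Linear independence of the columns over the field of fractions, stated with polynomials only
  (see \<open>full_column_rank_iff\<close>).\<close>

definition full_column_rank :: "'a::comm_ring_1 mat \<Rightarrow> bool" where
  "full_column_rank M \<longleftrightarrow>
     (\<forall>x\<in>carrier_vec (dim_col M). M *\<^sub>v x = 0\<^sub>v (dim_row M) \<longrightarrow> x = 0\<^sub>v (dim_col M))"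

lemma full_column_rank_iff:
  fixes M :: "'a::field poly mat"
  assumes M: "M \<in> carrier_mat m r"
  shows "full_column_rank M \<longleftrightarrow> distinct (cols (fract_mat M)) \<and>
    \<not> LinearCombinations.module.lin_dep class_ring (module_vec TYPE('a poly fract) m) (set (cols (fract_mat M)))"
proof -
  interpret vec_space "TYPE('a poly fract)" m .
  let ?F = "fract_mat M"
  have F: "?F \<in> carrier_mat m r" using M by auto
  have clear: "\<exists>y\<in>carrier_vec r. M *\<^sub>v y = 0\<^sub>v m \<and> y \<noteq> 0\<^sub>v r"
    if x: "x \<in> carrier_vec r" "?F *\<^sub>v x = 0\<^sub>v m" "x \<noteq> 0\<^sub>v r" for x
  proof -
    obtain q y where q: "q \<noteq> 0" "y \<in> carrier_vec r" "to_fract q \<cdot>\<^sub>v x = fract_vec y"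
      using common_denominator[OF x(1)] by blast
    have "fract_vec (M *\<^sub>v y) = ?F *\<^sub>v (to_fract q \<cdot>\<^sub>v x)"
      unfolding q(3) by (rule fract_mat_mult_vec[OF M q(2), symmetric])
    also have "\<dots> = to_fract q \<cdot>\<^sub>v (?F *\<^sub>v x)"
      by (rule mult_mat_vec[OF F x(1)])
    also have "\<dots> = fract_vec (0\<^sub>v m)" using x by (intro eq_vecI) auto
    finally have "M *\<^sub>v y = 0\<^sub>v m" by (simp add: fract_vec_eq_iff)
    moreover have "y \<noteq> 0\<^sub>v r"
    proof
      assume y: "y = 0\<^sub>v r"
      have "x = 0\<^sub>v r"
      proof (rule eq_vecI)
        fix i assume i: "i < dim_vec (0\<^sub>v r :: 'a poly fract vec)"
        then have "to_fract q * x $ i = 0"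
          using arg_cong[OF q(3), of "\<lambda>v. v $ i"] y x by simp
        then show "x $ i = 0\<^sub>v r $ i" using q(1) i by simp
      qed (use x in auto)
      then show False using x by simp
    qed
    ultimately show ?thesis using q by auto
  qed
  show ?thesis
  proof
    assume fc: "full_column_rank M"
    then have none: "\<not> (\<exists>x\<in>carrier_vec r. ?F *\<^sub>v x = 0\<^sub>v m \<and> x \<noteq> 0\<^sub>v r)"
      using clear M unfolding full_column_rank_def by blast
    have "distinct (cols ?F)"
    proof (rule ccontr)
      assume "\<not> distinct (cols ?F)"
      then obtain i k where ik: "i < r" "k < r" "i \<noteq> k" "col ?F i = col ?F k"
        using M by (auto simp: distinct_conv_nth)
      have "?F *\<^sub>v (unit_vec r i - unit_vec r k) = ?F *\<^sub>v unit_vec r i - ?F *\<^sub>v unit_vec r k"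
        using F by (intro mult_minus_distrib_mat_vec) auto
      also have "\<dots> = col ?F i - col ?F k"
        using F ik by (simp add: mult_mat_unit_vec)
      also have "\<dots> = 0\<^sub>v m" using ik F by (intro eq_vecI) auto
      finally have "unit_vec r i - unit_vec r k = (0\<^sub>v r :: 'a poly fract vec)"
        using none by auto
      then have "(unit_vec r i - unit_vec r k) $ i = (0\<^sub>v r :: 'a poly fract vec) $ i" by (rule arg_cong)
      then show False using ik by simp
    qed
    moreover from this have "\<not> lin_dep (set (cols ?F))"
      using none lin_depE[OF F] by metis
    ultimately show "distinct (cols ?F) \<and> \<not> lin_dep (set (cols ?F))" by simp
  next
    assume ind: "distinct (cols ?F) \<and> \<not> lin_dep (set (cols ?F))"
    show "full_column_rank M"
      unfolding full_column_rank_def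
    proof (intro ballI impI)
      fix x assume "x \<in> carrier_vec (dim_col M)" and zero: "M *\<^sub>v x = 0\<^sub>v (dim_row M)"
      then have x: "x \<in> carrier_vec r" using M by auto
      have "?F *\<^sub>v fract_vec x = fract_vec (0\<^sub>v m)"
        using fract_mat_mult_vec[OF M x] zero M by simp
      also have "\<dots> = 0\<^sub>v m" by (rule eq_vecI) auto
      finally have Fx: "?F *\<^sub>v fract_vec x = 0\<^sub>v m" .
      have "fract_vec x = 0\<^sub>v r"
        using ind lin_depI[OF F _ _ Fx] x by (metis map_carrier_vec)
      also have "\<dots> = fract_vec (0\<^sub>v r)" by (rule eq_vecI) auto
      finally show "x = 0\<^sub>v (dim_col M)" using M by (simp add: fract_vec_eq_iff)
    qed
  qed
qed

lemma distinct_cols_fract_mat: "distinct (cols (fract_mat M)) \<longleftrightarrow> distinct (cols M)"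
proof -
  have "cols (fract_mat M) = map fract_vec (cols M)"
    by (rule nth_equalityI) auto
  moreover have "inj fract_vec" using fract_vec_eq_iff by (auto simp: inj_def)
  ultimately show ?thesis by (metis distinct_map inj_on_subset subset_UNIV)
qed

lemma polynomial_basis_cols_iff:
  fixes M :: "'a::field poly mat"
  assumes M: "M \<in> carrier_mat m r"
  shows "polynomial_basis m V (cols M) \<longleftrightarrow> full_column_rank M \<and> col_range M = V"
proof -
  have "cols (fract_mat M) = map fract_vec (cols M)"
    by (rule nth_equalityI) auto
  then have "set (cols (fract_mat M)) = fract_vec ` set (cols M)" by simp
  then show ?thesis
    using M cols_dim[of M] distinct_cols_fract_mat[of M]
    unfolding polynomial_basis_def full_column_rank_iff[OF M] col_range_def vec_space.col_space_def by auto
qed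

lemma full_column_rankI:
  fixes P :: "'a::idom mat"
  assumes P: "P \<in> carrier_mat m r" and W: "W \<in> carrier_mat r m" and WP: "W * P = q \<cdot>\<^sub>m 1\<^sub>m r" and q: "q \<noteq> 0"
  shows "full_column_rank P"
  unfolding full_column_rank_def
proof (intro ballI impI)
  fix x assume "x \<in> carrier_vec (dim_col P)" and zero: "P *\<^sub>v x = 0\<^sub>v (dim_row P)"
  then have x: "x \<in> carrier_vec r" using P by auto
  have "q \<cdot>\<^sub>v x = (W * P) *\<^sub>v x" using x unfolding WP by (subst smult_mat_mult_vec[of _ r r]) auto
  also have "\<dots> = 0\<^sub>v r" using assoc_mult_mat_vec[OF W P x] zero P W by (auto intro!: eq_vecI)
  finally have eq: "q \<cdot>\<^sub>v x = 0\<^sub>v r" .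
  show "x = 0\<^sub>v (dim_col P)"
  proof (rule eq_vecI)
    fix i assume "i < dim_vec (0\<^sub>v (dim_col P) :: 'a vec)"
    then show "x $ i = 0\<^sub>v (dim_col P) $ i"
      using arg_cong[OF eq, of "\<lambda>v. v $ i"] q x P by simp
  qed (use x P in auto)
qed

lemma poly_rank_full:
  assumes P: "P \<in> carrier_mat m r" and "full_column_rank P"
  shows "poly_rank P = r"
proof -
  interpret vec_space "TYPE('a poly fract)" m .
  show ?thesis
    using assms lin_indpt_full_rank[of "fract_mat P" r] full_column_rank_iff[OF P]
    unfolding poly_rank_def by auto
qed

lemma poly_rank_cong:
  assumes "dim_row P = dim_row Q" "col_range P = col_range Q"
  shows "poly_rank P = poly_rank Q"
  using assms unfolding poly_rank_def col_range_def vec_space.rank_def vec_space.col_space_def by simp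

lemma col_range_and_rank_mult:
  fixes P :: "'a::field poly mat"
  assumes P: "P \<in> carrier_mat m r" and Q: "Q \<in> carrier_mat r n"
    and W: "W \<in> carrier_mat r m" "W * P = q \<cdot>\<^sub>m 1\<^sub>m r" "q \<noteq> 0"
    and Y: "Y \<in> carrier_mat n r" "Q * Y = q' \<cdot>\<^sub>m 1\<^sub>m r" "q' \<noteq> 0"
  shows "col_range (P * Q) = col_range P" and "poly_rank (P * Q) = r"
proof -
  have "q' \<cdot>\<^sub>m P = (P * Q) * Y"
    using P Q Y mult_smult_distrib[of P m r "1\<^sub>m r" r q'] by (simp add: assoc_mult_mat[of _ m r _ n _ r])
  then have "col_range P \<subseteq> col_range (P * Q)"
    using P Q Y by (intro col_range_scaled_mult[of _ m r _ n Y q']) auto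
  then show 1: "col_range (P * Q) = col_range P"
    using col_range_mult_subset[OF P Q] by auto
  then show "poly_rank (P * Q) = r"
    using poly_rank_cong[OF _ 1] poly_rank_full[OF P full_column_rankI[OF P W]] by simp
qed

section \<open>Minimal bases\<close>

lemma vec_degree_ge: "a < dim_vec v \<Longrightarrow> degree (v $ a) \<le> vec_degree v"
  unfolding vec_degree_def by (auto simp: vec_set_def intro!: Max_ge)

lemma vec_degree_attained:
  assumes "v \<noteq> 0\<^sub>v (dim_vec v)"
  shows "\<exists>a<dim_vec v. v $ a \<noteq> 0 \<and> degree (v $ a) = vec_degree v"
proof (cases "vec_degree v = 0")
  case True
  obtain a where "a < dim_vec v" "v $ a \<noteq> 0"
    using assms by (metis eq_vecI index_zero_vec(1,2))
  then show ?thesis using True vec_degree_ge[of a v] by auto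
next
  case False
  have "vec_degree v \<in> insert 0 (degree ` set\<^sub>v v)"
    unfolding vec_degree_def by (rule Max_in) (auto simp: vec_set_def)
  then show ?thesis using False by (auto simp: vec_set_def)
qed

lemma minimal_basis_mat_full_column_rank:
  assumes "K \<in> carrier_mat m r" "minimal_basis_mat K"
  shows "full_column_rank K"
  using assms polynomial_basis_cols_iff[OF assms(1)]
  unfolding minimal_basis_mat_def minimal_basis_def by auto

text \<open>If \<open>y\<close> has a nonzero coordinate \<open>i0\<close>, replacing the column \<open>i0\<close> of \<open>K\<close> by \<open>v\<close> gives
  another polynomial basis of the same space, so \<open>v\<close> cannot have smaller degree than that column.
  The matrices \<open>T\<close> and \<open>T'\<close> express the two bases in each other, up to the factors \<open>q\<close> and
  \<open>y $ i0\<close>. The conclusion names an entry because this also says that \<open>v\<close> is nonzero.\<close>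

lemma minimal_basis_exchange:
  fixes K :: "'a::field poly mat"
  assumes K: "K \<in> carrier_mat m r" and min: "minimal_basis_mat K"
    and q: "q \<noteq> 0" and v: "v \<in> carrier_vec m" and y: "y \<in> carrier_vec r"
    and eq: "q \<cdot>\<^sub>v v = K *\<^sub>v y" and i0: "i0 < r" "y $ i0 \<noteq> 0"
  shows "\<exists>a<m. v $ a \<noteq> 0 \<and> vec_degree (col K i0) \<le> degree (v $ a)"
proof -
  define K' where "K' = mat m r (\<lambda>(a, i). if i = i0 then v $ a else K $$ (a, i))"
  define T where "T = mat r r (\<lambda>(k, i). if i = i0 then y $ k else if k = i then q else 0)"
  define T' where "T' = mat r r (\<lambda>(k, i). if i = i0 then (if k = i0 then q else - (y $ k))
    else if k = i then y $ i0 else 0)"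
  have c: "K' \<in> carrier_mat m r" "T \<in> carrier_mat r r" "T' \<in> carrier_mat r r"
    unfolding K'_def T_def T'_def by auto
  have fc: "full_column_rank K" using minimal_basis_mat_full_column_rank[OF K min] .
  have va: "(\<Sum>i = 0..<r. K $$ (a, i) * y $ i) = q * v $ a" if "a < m" for a
    using arg_cong[OF eq, of "\<lambda>w. w $ a"] mult_mat_vec_nth[OF K y that] that v by simp
  have KT: "q \<cdot>\<^sub>m K' = K * T"
  proof (rule eq_matI)
    fix a i assume "a < dim_row (K * T)" "i < dim_col (K * T)"
    then have ai: "a < m" "i < r" using K c by auto
    have "(K * T) $$ (a, i) = (\<Sum>k = 0..<r. K $$ (a, k) * T $$ (k, i))"
      using ai K c by (auto simp: scalar_prod_def)
    also have "\<dots> = (if i = i0 then q * v $ a else q * K $$ (a, i))"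
      using ai va by (auto simp: T_def sum.delta if_distrib[of "\<lambda>x. _ * x"] cong: if_cong)
    finally show "(q \<cdot>\<^sub>m K') $$ (a, i) = (K * T) $$ (a, i)"
      using ai by (auto simp: K'_def)
  qed (use K c in auto)
  have KT': "y $ i0 \<cdot>\<^sub>m K = K' * T'"
  proof (rule eq_matI)
    fix a i assume "a < dim_row (K' * T')" "i < dim_col (K' * T')"
    then have ai: "a < m" "i < r" using c by auto
    have 1: "(K' * T') $$ (a, i) = (\<Sum>k = 0..<r. K' $$ (a, k) * T' $$ (k, i))"
      using ai c by (auto simp: scalar_prod_def)
    show "(y $ i0 \<cdot>\<^sub>m K) $$ (a, i) = (K' * T') $$ (a, i)"
    proof (cases "i = i0")
      case False
      have "(\<Sum>k = 0..<r. K' $$ (a, k) * T' $$ (k, i)) = (\<Sum>k = 0..<r. if k = i then K $$ (a, i) * y $ i0 else 0)"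
        using ai False by (intro sum.cong) (auto simp: K'_def T'_def)
      then show ?thesis using ai K unfolding 1 by (simp add: sum.delta mult.commute)
    next
      case True
      have "(\<Sum>k = 0..<r. K' $$ (a, k) * T' $$ (k, i)) =
          v $ a * q + (\<Sum>k\<in>{0..<r} - {i0}. - (K $$ (a, k) * y $ k))"
        using ai i0 True by (subst sum.remove[of _ i0]) (auto simp: K'_def T'_def intro!: sum.cong)
      also have "\<dots> = K $$ (a, i0) * y $ i0"
        using va[OF ai(1)] sum.remove[of "{0..<r}" i0 "\<lambda>k. K $$ (a, k) * y $ k"] i0
        by (simp add: sum_negf mult.commute)
      finally show ?thesis using ai K True unfolding 1 by (simp add: mult.commute)
    qed
  qed (use K c in auto)
  have range: "col_range K' = col_range K"
    using col_range_scaled_mult[OF c(1) K c(2) q KT] col_range_scaled_mult[OF K c(1) c(3) i0(2) KT'] by auto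
  have fc': "full_column_rank K'"
    unfolding full_column_rank_def
  proof (intro ballI impI)
    fix x assume "x \<in> carrier_vec (dim_col K')" and zero: "K' *\<^sub>v x = 0\<^sub>v (dim_row K')"
    then have x: "x \<in> carrier_vec r" using c by auto
    have "K *\<^sub>v (T *\<^sub>v x) = q \<cdot>\<^sub>v (K' *\<^sub>v x)"
      unfolding smult_mat_mult_vec[OF c(1) x, symmetric] KT by (rule assoc_mult_mat_vec[OF K c(2) x, symmetric])
    also have "\<dots> = 0\<^sub>v m" using zero c by (intro eq_vecI) auto
    finally have T0: "T *\<^sub>v x = 0\<^sub>v r"
      using fc K c x unfolding full_column_rank_def by auto
    have Tx: "(\<Sum>i = 0..<r. T $$ (k, i) * x $ i) = 0" if "k < r" for k
      using arg_cong[OF T0, of "\<lambda>w. w $ k"] mult_mat_vec_nth[OF c(2) x that] that by simp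
    have "(\<Sum>i = 0..<r. T $$ (i0, i) * x $ i) = (\<Sum>i = 0..<r. if i = i0 then y $ i0 * x $ i0 else 0)"
      using i0 by (intro sum.cong) (auto simp: T_def)
    then have xi0: "x $ i0 = 0" using Tx[of i0] i0 by simp
    have "x $ k = 0" if "k < r" for k
    proof (cases "k = i0")
      case False
      have "(\<Sum>i = 0..<r. T $$ (k, i) * x $ i) = (\<Sum>i = 0..<r. if i = k then q * x $ k else 0)"
        using that xi0 False by (intro sum.cong) (auto simp: T_def)
      then show ?thesis using Tx[OF that] that q by simp
    qed (use xi0 in simp)
    then show "x = 0\<^sub>v (dim_col K')" using x c by (intro eq_vecI) auto
  qed
  have "polynomial_basis m (col_range K) (cols K')"
    unfolding polynomial_basis_cols_iff[OF c(1)] using fc' range by simp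
  then have "basis_order (cols K) \<le> basis_order (cols K')"
    using min K unfolding minimal_basis_mat_def minimal_basis_def by auto
  moreover have order: "basis_order (cols N) = (\<Sum>i = 0..<r. vec_degree (col N i))"
    if "N \<in> carrier_mat m r" for N :: "'a poly mat"
    using that by (simp add: basis_order_def cols_def sum_list_distinct_conv_sum_set comp_def)
  moreover have "(\<Sum>i = 0..<r. vec_degree (col K i)) = vec_degree (col K i0) + (\<Sum>i\<in>{0..<r} - {i0}. vec_degree (col K i))"
    using i0 by (intro sum.remove) auto
  moreover have "(\<Sum>i = 0..<r. vec_degree (col K' i)) = vec_degree v + (\<Sum>i\<in>{0..<r} - {i0}. vec_degree (col K i))"
  proof -
    have "col K' i = col K i" if "i \<noteq> i0" "i < r" for i
      using that K by (intro eq_vecI) (auto simp: K'_def)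
    moreover have "col K' i0 = v" using i0 v by (intro eq_vecI) (auto simp: K'_def)
    ultimately show ?thesis using i0 by (subst sum.remove[of _ i0]) auto
  qed
  ultimately have "vec_degree (col K i0) \<le> vec_degree v" using K c by simp
  moreover have "v \<noteq> 0\<^sub>v (dim_vec v)"
  proof
    assume "v = 0\<^sub>v (dim_vec v)"
    then have "v = 0\<^sub>v m" using v by (metis carrier_vecD)
    moreover have "q \<cdot>\<^sub>v 0\<^sub>v m = 0\<^sub>v m" by (rule eq_vecI) auto
    ultimately have "K *\<^sub>v y = 0\<^sub>v m" using eq by simp
    then have "y = 0\<^sub>v r" using fc K y unfolding full_column_rank_def by auto
    then show False using i0 by simp
  qed
  ultimately show ?thesis using vec_degree_attained[of v] v by auto
qed

text \<open>After reducing \<open>y\<close> modulo \<open>q\<close>, a nonzero remainder would give a vector \<open>v'\<close> of degree less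
  than the largest column used in it, against the exchange lemma.\<close>

lemma minimal_basis_saturated:
  fixes K :: "'a::field poly mat"
  assumes K: "K \<in> carrier_mat m r" and min: "minimal_basis_mat K"
    and q: "q \<noteq> 0" and v: "v \<in> carrier_vec m" and y: "y \<in> carrier_vec r"
    and eq: "q \<cdot>\<^sub>v v = K *\<^sub>v y" and i: "i < r"
  shows "q dvd y $ i"
proof (rule ccontr)
  assume ndvd: "\<not> q dvd y $ i"
  define z where "z = vec r (\<lambda>i. y $ i mod q)"
  define u where "u = vec r (\<lambda>i. y $ i div q)"
  define v' where "v' = v - K *\<^sub>v u"
  have c: "z \<in> carrier_vec r" "u \<in> carrier_vec r" "v' \<in> carrier_vec m"
    using v K unfolding z_def u_def v'_def by auto
  have sum: "q * v' $ a = (\<Sum>i = 0..<r. K $$ (a, i) * z $ i)" if "a < m" for a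
  proof -
    have "q * v $ a = (\<Sum>i = 0..<r. K $$ (a, i) * y $ i)"
      using arg_cong[OF eq, of "\<lambda>w. w $ a"] mult_mat_vec_nth[OF K y that] that v by simp
    moreover have "v' $ a = v $ a - (\<Sum>i = 0..<r. K $$ (a, i) * u $ i)"
      using that v K mult_mat_vec_nth[OF K c(2) that] by (simp add: v'_def)
    moreover have "K $$ (a, i) * z $ i = K $$ (a, i) * y $ i - q * (K $$ (a, i) * u $ i)" if "i < r" for i
    proof -
      have zi: "z $ i = y $ i - q * u $ i" using that by (simp add: z_def u_def minus_mult_div_eq_mod)
      show ?thesis unfolding zi by (simp add: right_diff_distrib mult.left_commute)
    qed
    ultimately show ?thesis
      by (simp add: right_diff_distrib sum_subtractf sum_distrib_left)
  qed
  have eq': "q \<cdot>\<^sub>v v' = K *\<^sub>v z"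
    using sum K c by (intro eq_vecI) (auto simp: scalar_prod_def)
  have "z $ i \<noteq> 0" using ndvd i by (auto simp: z_def)
  define I where "I = {i. i < r \<and> z $ i \<noteq> 0}"
  have I: "finite I" "I \<noteq> {}" using i \<open>z $ i \<noteq> 0\<close> by (auto simp: I_def)
  \<comment> \<open>The offending column of largest degree is replaced.\<close>
  obtain i0 where i0: "i0 \<in> I" "\<And>i. i \<in> I \<Longrightarrow> vec_degree (col K i) \<le> vec_degree (col K i0)"
    using I obtains_MAX[of I "\<lambda>i. vec_degree (col K i)"] by (metis Max_ge finite_imageI image_eqI)
  obtain a where a: "a < m" "v' $ a \<noteq> 0" "vec_degree (col K i0) \<le> degree (v' $ a)"
    using minimal_basis_exchange[OF K min q c(3,1) eq', of i0] i0 by (auto simp: I_def)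
  have "degree q > 0"
  proof (rule ccontr)
    assume "\<not> 0 < degree q"
    then have "is_unit q" using q by (simp add: is_unit_iff_degree)
    then show False using ndvd unit_imp_dvd by blast
  qed
  have "degree (\<Sum>i = 0..<r. K $$ (a, i) * z $ i) < vec_degree (col K i0) + degree q"
  proof (rule degree_sum_less)
    fix k assume k: "k \<in> {0..<r}"
    show "degree (K $$ (a, k) * z $ k) < vec_degree (col K i0) + degree q"
    proof (cases "z $ k = 0")
      case False
      then have "vec_degree (col K k) \<le> vec_degree (col K i0)" using i0 k by (auto simp: I_def)
      moreover have "degree (K $$ (a, k)) \<le> vec_degree (col K k)"
        using vec_degree_ge[of a "col K k"] a K k by auto
      moreover have "degree (z $ k) < degree q"
        using False k degree_mod_less'[OF q, of "y $ k"] by (auto simp: z_def)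
      ultimately show ?thesis using degree_mult_le[of "K $$ (a, k)" "z $ k"] by linarith
    qed (use \<open>degree q > 0\<close> in simp)
  qed (use \<open>degree q > 0\<close> in simp)
  moreover have "degree (q * v' $ a) = degree q + degree (v' $ a)"
    using a q by (simp add: degree_mult_eq)
  ultimately show False using a sum[OF a(1)] by simp
qed

text \<open>No cancellation of leading terms can occur in \<open>K y\<close>: a vanishing combination of leading
  coefficient vectors would, by homogenizing it with powers of the variable, give a vector that is
  too small for the exchange lemma.\<close>

lemma minimal_basis_predictable_degree:
  fixes K :: "'a::field poly mat"
  assumes K: "K \<in> carrier_mat m r" and min: "minimal_basis_mat K"
    and y: "y \<in> carrier_vec r" and i: "i < r" "y $ i \<noteq> 0"
  shows "\<exists>a<m. (K *\<^sub>v y) $ a \<noteq> 0 \<and> degree (y $ i) + vec_degree (col K i) \<le> degree ((K *\<^sub>v y) $ a)"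
proof (rule ccontr)
  assume contr: "\<not> ?thesis"
  let ?k = "\<lambda>i. vec_degree (col K i)"
  define I where "I = {i. i < r \<and> y $ i \<noteq> 0}"
  have I: "finite I" "I \<noteq> {}" using i by (auto simp: I_def)
  define D where "D = Max ((\<lambda>i. degree (y $ i) + ?k i) ` I)"
  have Dge: "degree (y $ i) + ?k i \<le> D" if "i \<in> I" for i
    unfolding D_def using that I by auto
  define J where "J = {i\<in>I. degree (y $ i) + ?k i = D}"
  have "D \<in> (\<lambda>i. degree (y $ i) + ?k i) ` I" unfolding D_def using I by (intro Max_in) auto
  then have J: "finite J" "J \<noteq> {}" using I by (auto simp: J_def)
  obtain i0 where i0: "i0 \<in> J" "\<And>i. i \<in> J \<Longrightarrow> ?k i \<le> ?k i0"
    using J obtains_MAX[of J ?k] by (metis Max_ge finite_imageI image_eqI)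
  have Kdeg: "degree (K $$ (a, k)) \<le> ?k k" if "a < m" "k < r" for a k
    using vec_degree_ge[of a "col K k"] that K by auto
  have Ky: "(K *\<^sub>v y) $ a = (\<Sum>i = 0..<r. K $$ (a, i) * y $ i)" if "a < m" for a
    using mult_mat_vec_nth[OF K y that] .
  have small: "coeff ((K *\<^sub>v y) $ a) D = 0" if a: "a < m" for a
  proof -
    have "degree (y $ i) + ?k i \<le> D" using Dge i by (auto simp: I_def)
    moreover have "(K *\<^sub>v y) $ a = 0 \<or> degree ((K *\<^sub>v y) $ a) < degree (y $ i) + ?k i"
      using contr a by (meson not_le)
    ultimately show ?thesis by (cases "(K *\<^sub>v y) $ a = 0") (auto intro!: coeff_eq_0)
  qed
  \<comment> \<open>The leading terms alone give a combination of smaller degree than the column \<open>i0\<close>.\<close>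
  define w where "w = vec r (\<lambda>i. if i \<in> J then monom (lead_coeff (y $ i)) (?k i0 - ?k i) else 0)"
  have w: "w \<in> carrier_vec r" by (simp add: w_def)
  have i0r: "i0 < r" "y $ i0 \<noteq> 0" using i0 by (auto simp: J_def I_def)
  have wi0: "w $ i0 \<noteq> 0" using i0 i0r by (simp add: w_def monom_eq_0_iff)
  obtain a where a: "a < m" "(K *\<^sub>v w) $ a \<noteq> 0" "?k i0 \<le> degree ((K *\<^sub>v w) $ a)"
    using minimal_basis_exchange[OF K min, of 1 "K *\<^sub>v w" w i0] K w wi0 i0r by auto
  have Kw: "(K *\<^sub>v w) $ a = (\<Sum>i = 0..<r. K $$ (a, i) * w $ i)"
    using mult_mat_vec_nth[OF K w a(1)] .
  have "degree ((K *\<^sub>v w) $ a) \<le> ?k i0"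
    unfolding Kw
  proof (rule degree_sum_le)
    fix k assume k: "k \<in> {0..<r}"
    show "degree (K $$ (a, k) * w $ k) \<le> ?k i0"
    proof (cases "k \<in> J")
      case True
      then have "degree (w $ k) \<le> ?k i0 - ?k k" using k by (simp add: w_def degree_monom_le)
      then show ?thesis
        using i0(2)[OF True] Kdeg[OF a(1), of k] k degree_mult_le[of "K $$ (a, k)" "w $ k"] by auto
    qed (use k in \<open>simp add: w_def\<close>)
  qed simp
  moreover have "coeff ((K *\<^sub>v w) $ a) (?k i0) = coeff ((K *\<^sub>v y) $ a) D"
    unfolding Kw Ky[OF a(1)] coeff_sum
  proof (rule sum.cong[OF refl])
    fix k assume k: "k \<in> {0..<r}"
    have top: "coeff (p * q) (b + c) = coeff p b * coeff q c" if "degree p \<le> b" "degree q \<le> c" for p q :: "'a poly" and b c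
    proof -
      have "coeff (p * q) (b + c) = (\<Sum>i\<le>b + c. coeff p i * coeff q (b + c - i))" by (simp add: coeff_mult)
      also have "\<dots> = (\<Sum>i\<le>b + c. if i = b then coeff p b * coeff q c else 0)"
      proof (rule sum.cong[OF refl])
        fix i assume "i \<in> {..b + c}"
        show "coeff p i * coeff q (b + c - i) = (if i = b then coeff p b * coeff q c else 0)"
        proof (cases i b rule: linorder_cases)
          case less
          then have "degree q < b + c - i" using that by simp
          then show ?thesis using less by (simp add: coeff_eq_0)
        next
          case greater
          then have "degree p < i" using that by simp
          then show ?thesis using greater by (simp add: coeff_eq_0)
        qed auto
      qed
      finally show ?thesis by simp
    qed
    show "coeff (K $$ (a, k) * w $ k) (?k i0) = coeff (K $$ (a, k) * y $ k) D"
    proof (cases "k \<in> J")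
      case True
      have "coeff (K $$ (a, k) * w $ k) (?k k + (?k i0 - ?k k)) = coeff (K $$ (a, k)) (?k k) * lead_coeff (y $ k)"
        using True k Kdeg[OF a(1), of k] by (subst top) (auto simp: w_def degree_monom_le)
      moreover have "?k k + (?k i0 - ?k k) = ?k i0" using i0(2)[OF True] by simp
      moreover have "coeff (K $$ (a, k) * y $ k) (?k k + degree (y $ k)) = coeff (K $$ (a, k)) (?k k) * lead_coeff (y $ k)"
        using k Kdeg[OF a(1), of k] by (subst top) auto
      moreover have "?k k + degree (y $ k) = D" using True by (auto simp: J_def)
      ultimately show ?thesis by simp
    next
      case False
      then have "K $$ (a, k) * y $ k = 0 \<or> degree (K $$ (a, k) * y $ k) < D"
        using Dge[of k] Kdeg[OF a(1), of k] k degree_mult_le[of "K $$ (a, k)" "y $ k"]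
        by (cases "y $ k = 0") (fastforce simp: J_def I_def)+
      then show ?thesis using False k by (auto simp: w_def coeff_eq_0)
    qed
  qed
  ultimately show False using a small[OF a(1)] by (metis le_antisym leading_coeff_0_iff)
qed

text \<open>For \<open>x = X - a\<close> this says that the columns of \<open>P\<close> remain linearly independent when
  evaluated at \<open>a\<close>. It decides which factors a left inverse must have as denominators.\<close>

definition saturated_at :: "'a::comm_ring_1 \<Rightarrow> 'a mat \<Rightarrow> bool" where
  "saturated_at x P \<longleftrightarrow> (\<forall>v\<in>carrier_vec (dim_row P). \<forall>y\<in>carrier_vec (dim_col P).
     x \<cdot>\<^sub>v v = P *\<^sub>v y \<longrightarrow> (\<forall>i<dim_col P. x dvd y $ i))"

text \<open>The \<open>h i\<close> are the invariant factors of \<open>P\<close>, with zeros appended; \<open>W\<close> is obtained by inverting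
  the Smith form up to their product. If \<open>U P V\<close> is the Smith form, then \<open>P\<close> maps
  the column \<open>i\<close> of \<open>V\<close> to a multiple of \<open>h i\<close>. A divisor of \<open>h i\<close> at which \<open>P\<close> is saturated
  therefore divides a column of a unimodular matrix and is a unit.\<close>

lemma left_inverse_up_to_factor:
  fixes P :: "'a::field poly mat"
  assumes P: "P \<in> carrier_mat m r" and r: "r \<le> m"
  obtains W h where "W \<in> carrier_mat r m" "W * P = (\<Prod>i<r. h i) \<cdot>\<^sub>m 1\<^sub>m r"
    "\<And>i x. i < r \<Longrightarrow> saturated_at x P \<Longrightarrow> x dvd h i \<Longrightarrow> is_unit x"
    "\<And>i. i < r \<Longrightarrow> h i = 0 \<or> lead_coeff (h i) = 1"
proof -
  obtain \<beta>s where \<beta>: "\<forall>\<beta>\<in>set \<beta>s. lead_coeff \<beta> = 1" "unimod_equiv m r P (smith_mat m r \<beta>s)"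
    using Smith_form_exists[OF P] by blast
  obtain U V where U: "unimod m U" and V: "unimod r V" and UPV: "U * P * V = smith_mat m r \<beta>s"
    using \<beta>(2) unfolding unimod_equiv_def by blast
  obtain U' where U': "U' \<in> carrier_mat m m" "U' * U = 1\<^sub>m m" using unimod_inverse[OF U] by metis
  obtain V' where V': "V' \<in> carrier_mat r r" "V * V' = 1\<^sub>m r" "V' * V = 1\<^sub>m r" using unimod_inverse[OF V] by metis
  note c = P unimod_carrier[OF U] unimod_carrier[OF V] U'(1) V'(1)
  let ?S = "smith_mat m r \<beta>s"
  define h where "h = padded \<beta>s"
  have S: "?S $$ (a, i) = (if a = i then h i else 0)" if "a < m" "i < r" for a i
    using that by (auto simp: smith_mat_def h_def padded_def)
  have PV: "P * V = U' * ?S"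
  proof -
    have "U' * ?S = U' * (U * (P * V))" using c by (simp add: UPV[symmetric] assoc_mult_mat[of _ m m _ r _ r])
    also have "\<dots> = (U' * U) * (P * V)" using c by (simp add: assoc_mult_mat[of U' m m U m "P * V" r])
    also have "\<dots> = P * V" using c U' by simp
    finally show ?thesis ..
  qed
  have UP: "U * P = ?S * V'"
  proof -
    have "?S * V' = (U * P) * (V * V')" unfolding UPV[symmetric] using c by (intro assoc_mult_mat) auto
    also have "\<dots> = U * P" using c V' by simp
    finally show ?thesis ..
  qed
  define G where "G = mat r m (\<lambda>(i, a). if i = a then (\<Prod>k\<in>{..<r} - {i}. h k) else 0)"
  have G: "G \<in> carrier_mat r m" by (simp add: G_def)
  have GS: "G * ?S = (\<Prod>i<r. h i) \<cdot>\<^sub>m 1\<^sub>m r"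
  proof (rule eq_matI)
    fix i k assume "i < dim_row ((\<Prod>i<r. h i) \<cdot>\<^sub>m 1\<^sub>m r)" "k < dim_col ((\<Prod>i<r. h i) \<cdot>\<^sub>m 1\<^sub>m r)"
    then have ik: "i < r" "k < r" by auto
    have "(G * ?S) $$ (i, k) = (\<Sum>a = 0..<m. G $$ (i, a) * ?S $$ (a, k))"
      using ik G by (auto simp: scalar_prod_def smith_mat_def)
    also have "\<dots> = (\<Sum>a = 0..<m. if a = i then (if i = k then (\<Prod>k\<in>{..<r} - {i}. h k) * h i else 0) else 0)"
      using ik by (intro sum.cong) (auto simp: G_def S)
    also have "\<dots> = (if i = k then (\<Prod>k\<in>{..<r} - {i}. h k) * h i else 0)" using ik r by simp
    also have "\<dots> = (if i = k then (\<Prod>i<r. h i) else 0)"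
      using ik prod.remove[of "{..<r}" i h] by (simp add: mult.commute)
    finally show "(G * ?S) $$ (i, k) = ((\<Prod>i<r. h i) \<cdot>\<^sub>m 1\<^sub>m r) $$ (i, k)" using ik by simp
  qed (auto simp: G_def smith_mat_def)
  have "(V * G * U) * P = V * (G * (U * P))"
    using c G by (simp add: assoc_mult_mat[of _ r m _ m _ r] assoc_mult_mat[of _ r r _ m _ r] assoc_mult_mat[of _ r r _ m _ m])
  also have "\<dots> = V * ((G * ?S) * V')"
    unfolding UP using c G by (simp add: assoc_mult_mat[of _ r m _ r _ r])
  also have "\<dots> = (\<Prod>i<r. h i) \<cdot>\<^sub>m 1\<^sub>m r"
    unfolding GS using c V' by (simp add: mult_smult_distrib[of _ r r] mult_smult_assoc_mat[of _ r r])
  finally have W: "(V * G * U) * P = (\<Prod>i<r. h i) \<cdot>\<^sub>m 1\<^sub>m r" .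
  have unit: "is_unit x" if i: "i < r" and sat: "saturated_at x P" and x: "x dvd h i" for i x
  proof -
    obtain u where u: "h i = x * u" using x by (elim dvdE)
    have "P *\<^sub>v col V i = col (P * V) i" by (rule col_mult2[OF P unimod_carrier[OF V] i, symmetric])
    also have "\<dots> = U' *\<^sub>v col ?S i" unfolding PV by (rule col_mult2[OF U'(1) smith_mat_carrier i])
    also have "col ?S i = h i \<cdot>\<^sub>v unit_vec m i"
      using i r by (intro eq_vecI) (auto simp: S unit_vec_def smith_mat_def h_def padded_def)
    also have "U' *\<^sub>v (h i \<cdot>\<^sub>v unit_vec m i) = h i \<cdot>\<^sub>v col U' i"
      using c i r by (subst mult_mat_smult_vec[of _ m m]) (auto simp: mult_mat_unit_vec)
    also have "\<dots> = x \<cdot>\<^sub>v (u \<cdot>\<^sub>v col U' i)" by (simp add: u smult_smult_assoc)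
    finally have eq: "x \<cdot>\<^sub>v (u \<cdot>\<^sub>v col U' i) = P *\<^sub>v col V i" by simp
    have xV: "x dvd V $$ (k, i)" if "k < r" for k
    proof -
      have "u \<cdot>\<^sub>v col U' i \<in> carrier_vec (dim_row P)" "col V i \<in> carrier_vec (dim_col P)"
        using c i r by auto
      then have "x dvd col V i $ k"
        using sat[unfolded saturated_at_def, rule_format, OF _ _ eq] c that by simp
      then show ?thesis using c i that by simp
    qed
    have "1 = (V' * V) $$ (i, i)" using V' i by simp
    also have "\<dots> = (\<Sum>k = 0..<r. V' $$ (i, k) * V $$ (k, i))"
      using c i by (auto simp: scalar_prod_def simp del: V'(3))
    finally have one: "1 = (\<Sum>k = 0..<r. V' $$ (i, k) * V $$ (k, i))" .
    have "x dvd (\<Sum>k = 0..<r. V' $$ (i, k) * V $$ (k, i))"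
      using xV by (intro dvd_sum dvd_mult) auto
    then show ?thesis using one by simp
  qed
  show ?thesis
    using W unit c G \<beta>(1) by (intro that[of "V * G * U" h]) (auto simp: h_def padded_def)
qed

lemma minimal_basis_left_inverse:
  fixes K :: "'a::field poly mat"
  assumes K: "K \<in> carrier_mat m r" and r: "r \<le> m" and min: "minimal_basis_mat K"
  obtains W where "W \<in> carrier_mat r m" "W * K = 1\<^sub>m r"
proof -
  have sat: "saturated_at x K" if "x \<noteq> 0" for x
    unfolding saturated_at_def using minimal_basis_saturated[OF K min that] K by auto
  obtain W h where W: "W \<in> carrier_mat r m" "W * K = (\<Prod>i<r. h i) \<cdot>\<^sub>m 1\<^sub>m r"
    and unit: "\<And>i x. i < r \<Longrightarrow> saturated_at x K \<Longrightarrow> x dvd h i \<Longrightarrow> is_unit x"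
    and monic: "\<And>i. i < r \<Longrightarrow> h i = 0 \<or> lead_coeff (h i) = 1"
    using left_inverse_up_to_factor[OF K r] by metis
  have "h i = 1" if i: "i < r" for i
  proof -
    have "h i \<noteq> 0" using unit[OF i sat, of "[:0, 1:]"] by (auto simp: is_unit_pCons_iff)
    then have "is_unit (h i)" "lead_coeff (h i) = 1" using unit[OF i sat] monic[OF i] by auto
    then show ?thesis by (metis degree_0_id is_unit_iff_degree one_pCons \<open>h i \<noteq> 0\<close>)
  qed
  then have "W * K = 1\<^sub>m r" using W(2) by (auto intro!: eq_matI)
  then show ?thesis using that W(1) by blast
qed

text \<open>The behaviour of \<open>K\<close> at infinity after the poles given by the column degrees are removed.\<close>

definition column_reversal :: "'a::field poly mat \<Rightarrow> 'a poly mat" where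
  "column_reversal K = mat (dim_row K) (dim_col K) (\<lambda>(a, i). poly_reversal (vec_degree (col K i)) (K $$ (a, i)))"

lemma X_dvd_iff: "[:0, 1:] dvd (p :: 'a::field poly) \<longleftrightarrow> coeff p 0 = 0"
  using poly_eq_0_iff_dvd[of p 0] by (simp add: poly_0_coeff_0)

text \<open>The reversed matrix has, at \<open>0\<close>, the leading coefficient vectors of the columns of \<open>K\<close> as its
  columns. That they are independent is the predictable degree property.\<close>

lemma minimal_basis_reversal_left_inverse:
  fixes K :: "'a::field poly mat"
  assumes K: "K \<in> carrier_mat m r" and r: "r \<le> m" and min: "minimal_basis_mat K"
  obtains W q where "W \<in> carrier_mat r m" "W * column_reversal K = q \<cdot>\<^sub>m 1\<^sub>m r" "poly q 0 \<noteq> 0"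
proof -
  let ?R = "column_reversal K" and ?k = "\<lambda>i. vec_degree (col K i)"
  have R: "?R \<in> carrier_mat m r" using K by (simp add: column_reversal_def)
  have sat: "saturated_at [:0, 1:] ?R"
    unfolding saturated_at_def
  proof (intro ballI impI)
    fix v y
    assume "v \<in> carrier_vec (dim_row ?R)" "y \<in> carrier_vec (dim_col ?R)" and eq: "[:0, 1:] \<cdot>\<^sub>v v = ?R *\<^sub>v y"
    then have v: "v \<in> carrier_vec m" and y: "y \<in> carrier_vec r" using R by auto
    show "\<forall>i<dim_col ?R. [:0, 1:] dvd y $ i"
    proof (rule ccontr)
      assume "\<not> ?thesis"
      then obtain i where i: "i < r" "coeff (y $ i) 0 \<noteq> 0" using R by (auto simp: X_dvd_iff)
      define D where "D = Max (insert 0 (?k ` {0..<r}))"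
      have D: "?k i \<le> D" if "i < r" for i unfolding D_def using that by (intro Max_ge) auto
      define w where "w = vec r (\<lambda>i. monom (coeff (y $ i) 0) (D - ?k i))"
      have w: "w \<in> carrier_vec r" by (simp add: w_def)
      have wi: "w $ i \<noteq> 0" using i by (simp add: w_def monom_eq_0_iff)
      obtain a where a: "a < m" "(K *\<^sub>v w) $ a \<noteq> 0" "degree (w $ i) + ?k i \<le> degree ((K *\<^sub>v w) $ a)"
        using minimal_basis_predictable_degree[OF K min w i(1) wi] by blast
      have "degree (w $ i) + ?k i = D" using i D[OF i(1)] by (simp add: w_def degree_monom_eq)
      then have le: "D \<le> degree ((K *\<^sub>v w) $ a)" using a by simp
      have Kw: "(K *\<^sub>v w) $ a = (\<Sum>k = 0..<r. K $$ (a, k) * w $ k)"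
        using mult_mat_vec_nth[OF K w a(1)] .
      have Kdeg: "degree (K $$ (a, k)) \<le> ?k k" if "k < r" for k
        using vec_degree_ge[of a "col K k"] that K a by auto
      have "degree ((K *\<^sub>v w) $ a) \<le> D"
        unfolding Kw
      proof (rule degree_sum_le)
        fix k assume k: "k \<in> {0..<r}"
        have "degree (w $ k) \<le> D - ?k k" using k by (simp add: w_def degree_monom_le)
        then show "degree (K $$ (a, k) * w $ k) \<le> D"
          using D[of k] Kdeg[of k] k degree_mult_le[of "K $$ (a, k)" "w $ k"] by auto
      qed simp
      moreover have "coeff ((K *\<^sub>v w) $ a) D = 0"
      proof -
        have "coeff ((K *\<^sub>v w) $ a) D = (\<Sum>k = 0..<r. coeff (K $$ (a, k)) (?k k) * coeff (y $ k) 0)"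
          unfolding Kw coeff_sum
        proof (rule sum.cong[OF refl])
          fix k assume k: "k \<in> {0..<r}"
          then show "coeff (K $$ (a, k) * w $ k) D = coeff (K $$ (a, k)) (?k k) * coeff (y $ k) 0"
            using D[of k] by (simp add: w_def mult.commute[of _ "monom _ _"] coeff_monom_mult)
        qed
        also have "\<dots> = coeff ((?R *\<^sub>v y) $ a) 0"
          unfolding mult_mat_vec_nth[OF R y a(1)] coeff_sum
          using a K by (intro sum.cong) (auto simp: column_reversal_def coeff_mult_0 coeff_poly_reversal)
        also have "\<dots> = coeff ([:0, 1:] * v $ a) 0"
          using a v arg_cong[OF eq, of "\<lambda>w. w $ a"] by simp
        also have "\<dots> = 0" by (simp add: coeff_mult_0)
        finally show ?thesis .
      qed
      ultimately show False using a le by (metis le_antisym leading_coeff_0_iff)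
    qed
  qed
  obtain W h where W: "W \<in> carrier_mat r m" "W * ?R = (\<Prod>i<r. h i) \<cdot>\<^sub>m 1\<^sub>m r"
    and unit: "\<And>i x. i < r \<Longrightarrow> saturated_at x ?R \<Longrightarrow> x dvd h i \<Longrightarrow> is_unit x"
    using left_inverse_up_to_factor[OF R r] by metis
  have "poly (h i) 0 \<noteq> 0" if "i < r" for i
    using unit[OF that sat] by (auto simp: is_unit_pCons_iff X_dvd_iff poly_0_coeff_0)
  then have "poly (\<Prod>i<r. h i) 0 \<noteq> 0" by (simp add: poly_prod)
  then show ?thesis using that W by blast
qed

section \<open>Triangular matrices with prescribed invariant factors and diagonal degrees\<close>

text \<open>The rows and columns \<open>p\<close> and \<open>r\<close> carry the block with rows \<open>(g u, g)\<close> and \<open>(0, g v)\<close>. Its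
  entries have the common divisor \<open>g\<close>, which is one of the entries, and its determinant is
  \<open>g\<^sup>2 u v\<close>; so it is equivalent to the diagonal matrix of \<open>g\<close> and \<open>g u v\<close>.\<close>

lemma unimod_equiv_split_corner:
  fixes g u v :: "'a::comm_ring_1"
  assumes p: "p < r" and len: "length \<delta>s = r" and dp: "\<delta>s ! p = g * u"
  defines "D \<equiv> mat (Suc r) (Suc r) (\<lambda>(a, b). if a = b then (if a < r then \<delta>s ! a else g * v)
      else if a = p \<and> b = r then g else 0)"
  defines "D' \<equiv> mat (Suc r) (Suc r) (\<lambda>(a, b). if a = b then (\<delta>s[p := g] @ [g * v * u]) ! a else 0)"
  shows "unimod_equiv (Suc r) (Suc r) D D'"
proof -
  let ?E = "unimod_equiv (Suc r) (Suc r)"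
  define D1 where "D1 = addcol (- u) p r D"
  define D2 where "D2 = addrow (- v) r p D1"
  define D3 where "D3 = swapcols p r D2"
  define D4 where "D4 = multrow r (- 1) D3"
  have c: "D \<in> carrier_mat (Suc r) (Suc r)" by (simp add: D_def)
  have c1: "D1 \<in> carrier_mat (Suc r) (Suc r)" using c by (auto simp: D1_def)
  have c2: "D2 \<in> carrier_mat (Suc r) (Suc r)" using c1 by (auto simp: D2_def)
  have c3: "D3 \<in> carrier_mat (Suc r) (Suc r)" using c2 by (auto simp: D3_def)
  have "?E D D1" unfolding D1_def using c p by (intro unimod_equiv_addcol) auto
  also have "?E D1 D2" unfolding D2_def using c1 p by (intro unimod_equiv_addrow) auto
  also have "?E D2 D3" unfolding D3_def using c2 p by (intro unimod_equiv_swapcols) auto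
  also have "?E D3 D4" unfolding D4_def using c3 by (intro unimod_equiv_multrow[where b = "- 1"]) auto
  also have "D4 = D'"
  proof (rule eq_matI)
    have pr: "p \<noteq> r" "r \<noteq> p" using p by auto
    have e0: "D $$ (a, b) = (if a = b then (if a = r then g * v else \<delta>s ! a) else if a = p \<and> b = r then g else 0)"
      if "a < Suc r" "b < Suc r" for a b
      using that by (simp add: D_def)
    (* Many disequations between indices occur below; linear arithmetic must not split them. *)
    note [[linarith_neq_limit = 0]]
    have e1: "D1 $$ (a, b) = (if a = b \<and> a \<noteq> r \<and> a \<noteq> p then \<delta>s ! a else if a = p \<and> b = r then g
        else if a = r \<and> b = r then g * v else if a = r \<and> b = p then - (u * (g * v)) else 0)"
      if ab: "a < Suc r" "b < Suc r" for a b
    proof -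
      have 1: "D1 $$ (a, b) = (if p = b then (- u) * D $$ (a, r) + D $$ (a, b) else D $$ (a, b))"
        unfolding D1_def using ab c by (subst index_mat_addcol) auto
      have 2: "D $$ (a, r) = (if a = r then g * v else if a = p then g else 0)"
        using ab pr by (subst e0) auto
      show ?thesis
        unfolding 1 2 e0[OF ab] using pr dp by (cases "a = p"; cases "b = p"; cases "a = r"; hypsubst?; simp)
    qed
    have e2: "D2 $$ (a, b) = (if a = b \<and> a \<noteq> r \<and> a \<noteq> p then \<delta>s ! a else if a = p \<and> b = r then g
        else if a = r \<and> b = p then - (u * (g * v)) else 0)"
      if ab: "a < Suc r" "b < Suc r" for a b
    proof -
      have 1: "D2 $$ (a, b) = (if r = a then (- v) * D1 $$ (p, b) + D1 $$ (a, b) else D1 $$ (a, b))"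
        unfolding D2_def using ab c1 by (subst index_mat_addrow) auto
      have 2: "D1 $$ (p, b) = (if b = r then g else 0)"
        using ab pr p by (subst e1) auto
      show ?thesis
        unfolding 1 2 e1[OF ab] using pr by (cases "a = r"; cases "b = r"; hypsubst?; auto)
    qed
    have e3: "D3 $$ (a, b) = (if a = b \<and> a \<noteq> r \<and> a \<noteq> p then \<delta>s ! a else if a = p \<and> b = p then g
        else if a = r \<and> b = r then - (u * (g * v)) else 0)"
      if ab: "a < Suc r" "b < Suc r" for a b
    proof -
      have 1: "D3 $$ (a, b) = (if p = b then D2 $$ (a, r) else if r = b then D2 $$ (a, p) else D2 $$ (a, b))"
        unfolding D3_def using ab c2 by (subst index_mat_swapcols) auto
      have 2: "D2 $$ (a, r) = (if a = p then g else 0)"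
        using ab pr by (subst e2) auto
      have 3: "D2 $$ (a, p) = (if a = r then - (u * (g * v)) else 0)"
        using ab pr p by (subst e2) auto
      show ?thesis
        unfolding 1 2 3 e2[OF ab] using pr by (cases "b = p"; cases "b = r"; hypsubst?; auto)
    qed
    fix a b assume "a < dim_row D'" "b < dim_col D'"
    then have ab: "a < Suc r" "b < Suc r" by (auto simp: D'_def)
    show "D4 $$ (a, b) = D' $$ (a, b)"
    proof -
      have "D4 $$ (a, b) = (if r = a then (- 1) * D3 $$ (a, b) else D3 $$ (a, b))"
        unfolding D4_def using ab c3 by (subst index_mat_multrow) auto
      moreover have "D' $$ (a, b) = (if a = b then (\<delta>s[p := g] @ [g * v * u]) ! a else 0)"
        using ab by (simp add: D'_def)
      moreover have "a < r \<or> a = r" using ab(1) by (simp only: less_Suc_eq)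
      ultimately show ?thesis
        unfolding e3[OF ab] using pr p len by (elim disjE) (auto simp: nth_append mult_ac)
    qed
  qed (use c3 in \<open>auto simp: D4_def D'_def\<close>)
  finally show ?thesis .
qed

text \<open>A border can be prescribed after the equivalence: the transformation of the rows of \<open>T\<close> is
  undone on the border \<open>Y\<close>.\<close>

lemma unimod_equiv_border:
  fixes T :: "'a::comm_ring_1 mat"
  assumes T: "unimod_equiv r r T \<Delta>" and Y: "Y \<in> carrier_mat r 1"
  obtains X where "X \<in> carrier_mat r 1"
    "\<And>\<pi>. unimod_equiv (r + 1) (r + 1) (four_block_mat T X (0\<^sub>m 1 r) (mat 1 1 (\<lambda>_. \<pi>)))
      (four_block_mat \<Delta> Y (0\<^sub>m 1 r) (mat 1 1 (\<lambda>_. \<pi>)))"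
proof -
  obtain U V where UV: "T \<in> carrier_mat r r" "unimod r U" "unimod r V" "U * T * V = \<Delta>"
    using T unfolding unimod_equiv_def by blast
  obtain U' where U': "U' \<in> carrier_mat r r" "U * U' = 1\<^sub>m r" using unimod_inverse[OF UV(2)] by metis
  note c = UV(1) UV(2,3)[THEN unimod_carrier] U'(1) Y
  have UX: "U * (U' * Y) = Y" using c U' by (simp flip: assoc_mult_mat[of _ r r _ r _ 1])
  let ?P = "\<lambda>\<pi>. mat 1 1 (\<lambda>_. \<pi>)"
  have "unimod_equiv (r + 1) (r + 1) (four_block_mat T (U' * Y) (0\<^sub>m 1 r) (?P \<pi>))
      (four_block_mat \<Delta> Y (0\<^sub>m 1 r) (?P \<pi>))" for \<pi>
  proof (rule unimod_equivI)
    show "unimod (r + 1) (four_block_mat U (0\<^sub>m r 1) (0\<^sub>m 1 r) (1\<^sub>m 1))"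
      "unimod (r + 1) (four_block_mat V (0\<^sub>m r 1) (0\<^sub>m 1 r) (1\<^sub>m 1))"
      by (intro unimod_block_diag UV unimod_one)+
    have "four_block_mat U (0\<^sub>m r 1) (0\<^sub>m 1 r) (1\<^sub>m 1) * four_block_mat T (U' * Y) (0\<^sub>m 1 r) (?P \<pi>) =
        four_block_mat (U * T) Y (0\<^sub>m 1 r) (?P \<pi>)"
      using c UX by (subst mult_four_block_mat[of _ r r _ 1 _ 1 _ _ r _ 1]) auto
    also have "\<dots> * four_block_mat V (0\<^sub>m r 1) (0\<^sub>m 1 r) (1\<^sub>m 1) = four_block_mat \<Delta> Y (0\<^sub>m 1 r) (?P \<pi>)"
      using c UV(4) by (subst mult_four_block_mat[of _ r r _ 1 _ 1 _ _ r _ 1]) auto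
    finally show "four_block_mat U (0\<^sub>m r 1) (0\<^sub>m 1 r) (1\<^sub>m 1) * four_block_mat T (U' * Y) (0\<^sub>m 1 r) (?P \<pi>)
        * four_block_mat V (0\<^sub>m r 1) (0\<^sub>m 1 r) (1\<^sub>m 1) = four_block_mat \<Delta> Y (0\<^sub>m 1 r) (?P \<pi>)" .
  qed (use c in auto)
  then show ?thesis using that[of "U' * Y"] c by auto
qed

lemma unimod_equiv_reduce_border:
  fixes T :: "'a::field poly mat"
  assumes T: "T \<in> carrier_mat r r" and X: "X \<in> carrier_mat r 1"
  shows "unimod_equiv (r + 1) (r + 1) (four_block_mat T X (0\<^sub>m 1 r) (mat 1 1 (\<lambda>_. \<pi>)))
    (four_block_mat T (map_mat (\<lambda>x. x mod \<pi>) X) (0\<^sub>m 1 r) (mat 1 1 (\<lambda>_. \<pi>)))"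
proof -
  let ?P = "mat 1 1 (\<lambda>_. \<pi>)" and ?Z = "map_mat (\<lambda>x. - (x div \<pi>)) X"
  have "X + ?Z * ?P = map_mat (\<lambda>x. x mod \<pi>) X"
    using X by (intro eq_matI) (auto simp: scalar_prod_def minus_div_mult_eq_mod[symmetric])
  then have eq: "four_block_mat (1\<^sub>m r) ?Z (0\<^sub>m 1 r) (1\<^sub>m 1) * four_block_mat T X (0\<^sub>m 1 r) ?P =
      four_block_mat T (map_mat (\<lambda>x. x mod \<pi>) X) (0\<^sub>m 1 r) ?P"
    using T X by (subst mult_four_block_mat[of _ r r _ 1 _ 1 _ _ r _ 1]) auto
  show ?thesis
    unfolding eq[symmetric] using T X
    by (intro unimod_equiv_mult_left unimod_block_upper four_block_carrier_mat) auto
qed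

lemma index_between:
  fixes f :: "nat \<Rightarrow> nat"
  assumes "0 < r" "f 0 \<le> e" "e \<le> f r"
  shows "\<exists>i<r. f i \<le> e \<and> e \<le> f (Suc i)"
proof (rule ccontr)
  assume contr: "\<not> ?thesis"
  have "f i \<le> e" if "i \<le> r" for i
    using that by (induction i) (use contr assms in \<open>auto simp: Suc_le_eq\<close>)
  then show False using contr assms by (metis Suc_pred diff_less le_less_linear less_imp_le less_one not_less_eq_eq order_refl)
qed

text \<open>Induction that removes the last degree \<open>e r\<close>. It lies between the degrees of two consecutive
  invariant factors \<open>g dvd g'\<close>, so there is a monic \<open>\<pi>\<close> of degree \<open>e r\<close> between them. The
  remaining matrix is to have \<open>\<delta> = g g' / \<pi>\<close> in place of \<open>g\<close> and \<open>g'\<close>; this is again a chain,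
  and the remaining degrees satisfy the hypothesis for it. After diagonalization, bordering that
  matrix by the diagonal entry \<open>\<pi>\<close> and a column with the entry \<open>g\<close> opposite to \<open>\<delta>\<close> gives back \<open>g\<close> and \<open>g'\<close>, and
  the column can be reduced modulo \<open>\<pi>\<close>.

  The hypothesis is majorization in a form that is independent of the order of the degrees: the
  order of the diagonal is prescribed. The diagonal form \<open>\<gamma>s'\<close> is an unsorted version of \<open>\<gamma>s\<close>,
  since the new factors end up wherever \<open>\<delta>\<close> was.\<close>

lemma exists_triangular_with_invariants:
  fixes \<gamma>s :: "'a::field poly list" and e :: "nat \<Rightarrow> nat"
  assumes closed: "\<forall>p :: 'a poly. 0 < degree p \<longrightarrow> (\<exists>x. poly p x = 0)"
    and "length \<gamma>s = r" "\<forall>\<gamma>\<in>set \<gamma>s. lead_coeff \<gamma> = 1" "sorted_wrt (dvd) \<gamma>s"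
    and "\<And>S. S \<subseteq> {0..<r} \<Longrightarrow> (\<Sum>i<card S. degree (\<gamma>s ! i)) \<le> (\<Sum>i\<in>S. e i)"
    and "(\<Sum>i<r. degree (\<gamma>s ! i)) = (\<Sum>i = 0..<r. e i)"
  shows "\<exists>G \<gamma>s'. mset \<gamma>s' = mset \<gamma>s \<and> unimod_equiv r r G (smith_mat r r \<gamma>s') \<and>
    (\<forall>i<r. lead_coeff (G $$ (i, i)) = 1 \<and> degree (G $$ (i, i)) = e i) \<and>
    (\<forall>i<r. \<forall>k<i. G $$ (i, k) = 0) \<and>
    (\<forall>k<r. \<forall>i<k. G $$ (i, k) = 0 \<or> degree (G $$ (i, k)) < e k)"
  using assms(2-)
proof (induction r arbitrary: \<gamma>s)
  case 0
  then show ?case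
    using unimod_equiv_refl[of "smith_mat 0 0 \<gamma>s" 0 0]
    by (intro exI[of _ "smith_mat 0 0 \<gamma>s"] exI[of _ \<gamma>s]) auto
next
  case (Suc r)
  note len = Suc.prems(1) and monic = Suc.prems(2) and srt = Suc.prems(3)
    and maj = Suc.prems(4) and total = Suc.prems(5)
  have chain: "\<gamma>s ! i dvd \<gamma>s ! k" if "i \<le> k" "k < Suc r" for i k
    using that srt len by (cases "i = k") (auto simp: sorted_wrt_iff_nth_less)
  have mon: "lead_coeff (\<gamma>s ! i) = 1" if "i < Suc r" for i
    using that len monic by auto
  then have nz: "\<gamma>s ! i \<noteq> 0" if "i < Suc r" for i using that by fastforce
  show ?case
  proof (cases "r = 0")
    case True
    then have "degree (\<gamma>s ! 0) = e 0" using total by simp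
    then show ?thesis
      using True len mon[of 0] unimod_equiv_refl[of "smith_mat 1 1 \<gamma>s" 1 1]
      by (intro exI[of _ "smith_mat 1 1 \<gamma>s"] exI[of _ \<gamma>s]) (auto simp: smith_mat_def)
  next
    case False
    have "degree (\<gamma>s ! 0) \<le> e r" using maj[of "{r}"] by simp
    moreover have "e r \<le> degree (\<gamma>s ! r)" using maj[of "{0..<r}"] total by simp
    ultimately obtain i where i: "i < r" "degree (\<gamma>s ! i) \<le> e r" "e r \<le> degree (\<gamma>s ! Suc i)"
      using index_between[of r "\<lambda>i. degree (\<gamma>s ! i)" "e r"] False by auto
    let ?g = "\<gamma>s ! i"
    obtain \<pi> where \<pi>: "?g dvd \<pi>" "\<pi> dvd \<gamma>s ! Suc i" "lead_coeff \<pi> = 1" "degree \<pi> = e r"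
      using ex_monic_between[OF closed, of ?g "\<gamma>s ! Suc i" "e r"] chain[of i "Suc i"] nz mon i by auto
    obtain v where v: "\<pi> = ?g * v" using \<pi>(1) by (elim dvdE)
    obtain u where u: "\<gamma>s ! Suc i = \<pi> * u" using \<pi>(2) by (elim dvdE)
    have lu: "lead_coeff u = 1" using arg_cong[OF u, of lead_coeff] mon[of "Suc i"] i \<pi>(3) by (simp add: lead_coeff_mult)
    define \<delta> where "\<delta> = ?g * u"
    have l\<delta>: "lead_coeff \<delta> = 1" unfolding \<delta>_def using mon[of i] i lu by (simp add: lead_coeff_mult)
    have unz: "u \<noteq> 0" "\<pi> \<noteq> 0" using lu \<pi>(3) by auto
    have deg\<delta>: "degree \<delta> + e r = degree ?g + degree (\<gamma>s ! Suc i)"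
      unfolding \<delta>_def u using nz[of i] i unz \<pi>(4) by (simp add: degree_mult_eq)
    have dvd\<delta>: "?g dvd \<delta>" "\<delta> dvd \<gamma>s ! Suc i"
      unfolding u v \<delta>_def by (auto simp: mult_ac)
    define \<delta>s where "\<delta>s = take i \<gamma>s @ \<delta> # drop (Suc (Suc i)) \<gamma>s"
    have len\<delta>: "length \<delta>s = r" using len i by (simp add: \<delta>s_def)
    have nth\<delta>: "\<delta>s ! k = (if k < i then \<gamma>s ! k else if k = i then \<delta> else \<gamma>s ! Suc k)" if "k < r" for k
      using that len i by (auto simp: \<delta>s_def nth_append nth_Cons' min_def)
    have mon\<delta>: "\<forall>d\<in>set \<delta>s. lead_coeff d = 1"
      unfolding all_set_conv_all_nth using mon l\<delta> nth\<delta> len\<delta> by simp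
    have srt\<delta>: "sorted_wrt (dvd) \<delta>s"
      unfolding sorted_wrt_iff_nth_less
    proof (intro allI impI)
      fix j k assume jk: "j < k" "k < length \<delta>s"
      then have k: "k < r" using len\<delta> by simp
      consider "k < i" | "k = i" | "k > i" "j < i" | "k > i" "j = i" | "j > i" by linarith
      then show "\<delta>s ! j dvd \<delta>s ! k"
      proof cases
        case 2
        then have "\<gamma>s ! j dvd ?g" using chain[of j i] jk k by simp
        then show ?thesis using 2 jk k dvd\<delta>(1) dvd_trans by (simp add: nth\<delta>) blast
      next
        case 4
        then have "\<gamma>s ! Suc i dvd \<gamma>s ! Suc k" using chain[of "Suc i" "Suc k"] jk k by simp
        then show ?thesis using 4 jk k dvd\<delta>(2) dvd_trans by (simp add: nth\<delta>) blast
      qed (use jk k chain in \<open>auto simp: nth\<delta>\<close>)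
    qed
    \<comment> \<open>Up to \<open>i\<close> the partial sums of degrees do not change, and beyond \<open>i\<close> they are the next ones
      for \<open>\<gamma>s\<close> without \<open>e r\<close>. In the second case the hypothesis is used for a set with \<open>r\<close> added.\<close>
    have small: "(\<Sum>k<j. degree (\<delta>s ! k)) = (\<Sum>k<j. degree (\<gamma>s ! k))" if "j \<le> i" for j
      using that i by (intro sum.cong) (auto simp: nth\<delta>)
    have large: "(\<Sum>k<j. degree (\<delta>s ! k)) + e r = (\<Sum>k<Suc j. degree (\<gamma>s ! k))" if "i < j" "j \<le> r" for j
      using that
    proof (induction j)
      case (Suc j)
      show ?case
      proof (cases "j = i")
        case True
        then show ?thesis using small[of i] deg\<delta> i by (simp add: nth\<delta>)
      next
        case False
        then show ?thesis using Suc by (simp add: nth\<delta>)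
      qed
    qed simp
    have "\<exists>T \<delta>s'. mset \<delta>s' = mset \<delta>s \<and> unimod_equiv r r T (smith_mat r r \<delta>s') \<and>
      (\<forall>i<r. lead_coeff (T $$ (i, i)) = 1 \<and> degree (T $$ (i, i)) = e i) \<and>
      (\<forall>i<r. \<forall>k<i. T $$ (i, k) = 0) \<and>
      (\<forall>k<r. \<forall>i<k. T $$ (i, k) = 0 \<or> degree (T $$ (i, k)) < e k)"
    proof (rule Suc.IH[OF len\<delta> mon\<delta> srt\<delta>])
      fix S assume S: "S \<subseteq> {0..<r}"
      then have fin: "finite S" "r \<notin> S" "card S \<le> r"
        using finite_subset card_mono[of "{0..<r}" S] by auto
      show "(\<Sum>k<card S. degree (\<delta>s ! k)) \<le> (\<Sum>i\<in>S. e i)"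
      proof (cases "card S \<le> i")
        case True
        have "S \<subseteq> {0..<Suc r}" using S by auto
        then show ?thesis using small[OF True] maj by simp
      next
        case False
        have "insert r S \<subseteq> {0..<Suc r}" using S by auto
        then have "(\<Sum>k<Suc (card S). degree (\<gamma>s ! k)) \<le> (\<Sum>i\<in>S. e i) + e r"
          using maj[of "insert r S"] fin by (simp add: add.commute)
        then show ?thesis using large[of "card S"] False fin by simp
      qed
    next
      show "(\<Sum>k<r. degree (\<delta>s ! k)) = (\<Sum>i = 0..<r. e i)"
        using large[of r] i total by simp
    qed
    then obtain T \<delta>s' where mset: "mset \<delta>s' = mset \<delta>s" and ET: "unimod_equiv r r T (smith_mat r r \<delta>s')"
      and diagT: "\<forall>i<r. lead_coeff (T $$ (i, i)) = 1 \<and> degree (T $$ (i, i)) = e i"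
      and lowT: "\<forall>i<r. \<forall>k<i. T $$ (i, k) = 0"
      and upT: "\<forall>k<r. \<forall>i<k. T $$ (i, k) = 0 \<or> degree (T $$ (i, k)) < e k"
      by (elim exE conjE) (rule that)
    have cT: "T \<in> carrier_mat r r" using unimod_equiv_carrier[OF ET] by simp
    have len\<delta>': "length \<delta>s' = r" using mset_eq_length[OF mset] len\<delta> by simp
    have "\<delta> \<in> set \<delta>s'" using mset_eq_setD[OF mset] by (simp add: \<delta>s_def)
    then obtain p where p: "p < r" "\<delta>s' ! p = \<delta>" using len\<delta>' by (auto simp: in_set_conv_nth)
    define Y where "Y = mat r 1 (\<lambda>(a, _). if a = p then ?g else 0)"
    let ?\<Pi> = "mat 1 1 (\<lambda>_. \<pi>)"
    obtain X where X: "X \<in> carrier_mat r 1"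
      and EX: "unimod_equiv (r + 1) (r + 1) (four_block_mat T X (0\<^sub>m 1 r) ?\<Pi>)
        (four_block_mat (smith_mat r r \<delta>s') Y (0\<^sub>m 1 r) ?\<Pi>)"
      using unimod_equiv_border[OF ET, of Y] by (auto simp: Y_def)
    let ?X' = "map_mat (\<lambda>x. x mod \<pi>) X"
    define G where "G = four_block_mat T ?X' (0\<^sub>m 1 r) ?\<Pi>"
    define \<gamma>s' where "\<gamma>s' = \<delta>s'[p := ?g] @ [\<gamma>s ! Suc i]"
    have "unimod_equiv (Suc r) (Suc r) G (four_block_mat (smith_mat r r \<delta>s') Y (0\<^sub>m 1 r) ?\<Pi>)"
      using unimod_equiv_trans[OF unimod_equiv_sym[OF unimod_equiv_reduce_border[OF cT X]] EX] by (simp add: G_def)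
    also have "four_block_mat (smith_mat r r \<delta>s') Y (0\<^sub>m 1 r) ?\<Pi> =
        mat (Suc r) (Suc r) (\<lambda>(a, b). if a = b then (if a < r then \<delta>s' ! a else ?g * v)
          else if a = p \<and> b = r then ?g else 0)"
      using p len\<delta>' by (intro eq_matI) (auto simp: smith_mat_def Y_def v)
    also have "unimod_equiv (Suc r) (Suc r) \<dots>
        (mat (Suc r) (Suc r) (\<lambda>(a, b). if a = b then (\<delta>s'[p := ?g] @ [?g * v * u]) ! a else 0))"
      using p len\<delta>' \<delta>_def by (intro unimod_equiv_split_corner) auto
    also have "\<dots> = smith_mat (Suc r) (Suc r) \<gamma>s'"
      using len\<delta>' u v by (intro eq_matI) (auto simp: smith_mat_def \<gamma>s'_def)
    finally have EG: "unimod_equiv (Suc r) (Suc r) G (smith_mat (Suc r) (Suc r) \<gamma>s')" .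
    have "mset \<gamma>s' = mset \<gamma>s"
    proof -
      have "\<gamma>s = take i \<gamma>s @ ?g # \<gamma>s ! Suc i # drop (Suc (Suc i)) \<gamma>s"
        using i len by (metis Cons_nth_drop_Suc Suc_less_eq append_take_drop_id less_SucI)
      then have "mset \<gamma>s = mset (take i \<gamma>s) + {#?g#} + {#\<gamma>s ! Suc i#} + mset (drop (Suc (Suc i)) \<gamma>s)"
        by (metis (no_types, lifting) add_mset_add_single mset.simps(2) mset_append union_mset_add_mset_right union_mset_add_mset_left)
      moreover have "mset \<gamma>s' = mset \<delta>s - {#\<delta>#} + {#?g#} + {#\<gamma>s ! Suc i#}"
        using p len\<delta>' mset by (simp add: \<gamma>s'_def mset_update)
      moreover have "mset \<delta>s - {#\<delta>#} = mset (take i \<gamma>s) + mset (drop (Suc (Suc i)) \<gamma>s)"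
        by (simp add: \<delta>s_def)
      ultimately show ?thesis by simp
    qed
    moreover have "lead_coeff (G $$ (a, a)) = 1 \<and> degree (G $$ (a, a)) = e a" if "a < Suc r" for a
      using that cT X diagT[rule_format, of a] \<pi>(3,4) by (cases "a < r") (auto simp: G_def less_Suc_eq)
    moreover have "G $$ (a, b) = 0" if "a < Suc r" "b < a" for a b
      using that cT X lowT[rule_format, of a b] by (cases "a < r") (auto simp: G_def less_Suc_eq)
    moreover have "G $$ (a, b) = 0 \<or> degree (G $$ (a, b)) < e b" if "b < Suc r" "a < b" for a b
      using that cT X upT[rule_format, of b a] degree_mod_less[OF unz(2), of "X $$ (a, 0)"] \<pi>(4)
      by (cases "b < r") (auto simp: G_def less_Suc_eq)
    ultimately show ?thesis using EG by blast
  qed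
qed

section \<open>Factoring a matrix through two minimal bases\<close>

lemma mult3_nth:
  fixes K :: "'a::comm_ring_1 mat"
  assumes "K \<in> carrier_mat m r" "E \<in> carrier_mat r r" "L \<in> carrier_mat r n" "a < m" "b < n"
  shows "(K * E * L) $$ (a, b) = (\<Sum>k = 0..<r. \<Sum>i = 0..<r. K $$ (a, i) * E $$ (i, k) * L $$ (k, b))"
proof -
  define Q where "Q = K * E"
  have "Q \<in> carrier_mat m r" unfolding Q_def using assms by auto
  then have "(Q * L) $$ (a, b) = (\<Sum>k = 0..<r. Q $$ (a, k) * L $$ (k, b))"
    using assms by (auto simp: scalar_prod_def)
  also have "\<dots> = (\<Sum>k = 0..<r. (\<Sum>i = 0..<r. K $$ (a, i) * E $$ (i, k)) * L $$ (k, b))"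
    unfolding Q_def using assms by (intro sum.cong) (auto simp: scalar_prod_def)
  finally show ?thesis by (simp add: Q_def sum_distrib_right)
qed

lemma assoc_mult_middle:
  assumes "W \<in> carrier_mat a m" "R \<in> carrier_mat m r" "N \<in> carrier_mat r s"
    "S \<in> carrier_mat s n" "Y \<in> carrier_mat n b"
  shows "W * (R * N * S) * Y = (W * R) * N * (S * Y)"
proof -
  have "W * (R * N * S) = W * (R * N) * S"
    by (rule assoc_mult_mat[symmetric]) (use assms in auto)
  also have "W * (R * N) = W * R * N"
    by (rule assoc_mult_mat[symmetric]) (use assms in auto)
  finally have "W * (R * N * S) * Y = W * R * N * S * Y" by simp
  also have "\<dots> = (W * R) * N * (S * Y)"
    by (rule assoc_mult_mat) (use assms in auto)
  finally show ?thesis .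
qed

lemma assoc_mult_inner:
  assumes "F \<in> carrier_mat a r" "M \<in> carrier_mat r s" "Y \<in> carrier_mat s t" "G \<in> carrier_mat t b"
  shows "(F * M) * (Y * G) = F * (M * Y) * G"
proof -
  have "F * (M * Y) = F * M * Y" by (rule assoc_mult_mat[symmetric]) (use assms in auto)
  then have "F * (M * Y) * G = F * M * Y * G" by simp
  also have "\<dots> = (F * M) * (Y * G)" by (rule assoc_mult_mat) (use assms in auto)
  finally show ?thesis ..
qed

lemma dvd_minors_cong:
  assumes "M \<in> carrier_mat m n" "M' \<in> carrier_mat m n"
    and "\<And>\<rho> \<gamma>. \<rho> \<in> {0..<j} \<rightarrow> {0..<m} \<Longrightarrow> \<gamma> \<in> {0..<j} \<rightarrow> {0..<n} \<Longrightarrow>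
      x dvd minor M j \<rho> \<gamma> \<longleftrightarrow> x' dvd minor M' j \<rho> \<gamma>"
  shows "dvd_minors j x M \<longleftrightarrow> dvd_minors j x' M'"
proof -
  have "dim_row M = m" "dim_col M = n" "dim_row M' = m" "dim_col M' = n" using assms by auto
  then show ?thesis unfolding dvd_minors_def using assms(3) by auto
qed

lemma linear_power_dvd_mult_iff:
  fixes u p :: "'a::field poly"
  assumes u: "poly u b \<noteq> 0"
  shows "[:- b, 1:] ^ k dvd u * p \<longleftrightarrow> [:- b, 1:] ^ k dvd p"
proof (cases "p = 0")
  case False
  have "u \<noteq> 0" using u by auto
  then have "u * p \<noteq> 0" using False by simp
  moreover have "order b u = 0" using u order_0I by blast
  ultimately show ?thesis using False by (simp add: order_divides order_mult)
qed simp

lemma mat_degree_le_iff: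
  assumes "P \<in> carrier_mat m n"
  shows "mat_degree P \<le> d \<longleftrightarrow> (\<forall>a<m. \<forall>b<n. degree (P $$ (a, b)) \<le> d)"
proof -
  have "elements_mat P = (\<lambda>(a, b). P $$ (a, b)) ` ({0..<m} \<times> {0..<n})"
    using assms by (auto simp: elements_mat_def)
  then show ?thesis unfolding mat_degree_def by (subst Max_le_iff) auto
qed

lemma mat_degree_attained:
  assumes P: "P \<in> carrier_mat m n" and nz: "a < m" "b < n" "P $$ (a, b) \<noteq> 0"
  shows "\<exists>a<m. \<exists>b<n. P $$ (a, b) \<noteq> 0 \<and> degree (P $$ (a, b)) = mat_degree P"
proof (cases "mat_degree P = 0")
  case True
  then show ?thesis using nz mat_degree_le_iff[OF P, of 0] by auto
next
  case False
  have el: "elements_mat P = (\<lambda>(a, b). P $$ (a, b)) ` ({0..<m} \<times> {0..<n})"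
    using P by (auto simp: elements_mat_def)
  have "mat_degree P \<in> insert 0 (degree ` elements_mat P)"
    unfolding mat_degree_def by (rule Max_in) (auto simp: el)
  then have "mat_degree P \<in> degree ` elements_mat P" using False by simp
  then obtain a b where "a < m" "b < n" "degree (P $$ (a, b)) = mat_degree P"
    unfolding el by auto
  then show ?thesis using False by (intro exI[of _ a] conjI exI[of _ b]) auto
qed

lemma invariant_factors_dvd_minors:
  fixes P :: "'a::field poly mat"
  assumes P: "P \<in> carrier_mat m n" and inv: "invariant_factors P \<alpha>s" and j: "j \<le> min m n"
  shows "dvd_minors j x P \<longleftrightarrow> x dvd (\<Prod>i<j. padded \<alpha>s i)"
proof -
  obtain U V where "U \<in> carrier_mat m m" "invertible_mat U" "V \<in> carrier_mat n n" "invertible_mat V"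
    "U * P * V = smith_mat m n \<alpha>s"
    using inv P unfolding invariant_factors_def by auto
  then have "unimod_equiv m n P (smith_mat m n \<alpha>s)"
    using P by (intro unimod_equivI[of _ _ _ U V]) (auto simp: unimod_iff_invertible_mat)
  then show ?thesis
    using inv j by (intro dvd_minors_Smith) (auto simp: invariant_factors_def)
qed

lemma prod_padded: "j \<le> length xs \<Longrightarrow> (\<Prod>i<j. padded xs i) = (\<Prod>i<j. xs ! i)"
  by (intro prod.cong) (auto simp: padded_def)

lemma monic_prod:
  fixes xs :: "'a::field poly list"
  assumes "\<forall>x\<in>set xs. lead_coeff x = 1" "j \<le> length xs"
  shows "lead_coeff (\<Prod>i<j. xs ! i) = 1" "(\<Prod>i<j. xs ! i) \<noteq> 0"
    "degree (\<Prod>i<j. xs ! i) = (\<Sum>i<j. degree (xs ! i))"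
proof -
  have mon: "lead_coeff (xs ! i) = 1" if "i < j" for i using assms that by auto
  then have nz: "xs ! i \<noteq> 0" if "i < j" for i using that by fastforce
  show "lead_coeff (\<Prod>i<j. xs ! i) = 1"
    unfolding lead_coeff_prod by (intro prod.neutral) (use mon in auto)
  then show "(\<Prod>i<j. xs ! i) \<noteq> 0" by (metis leading_coeff_0_iff zero_neq_one)
  show "degree (\<Prod>i<j. xs ! i) = (\<Sum>i<j. degree (xs ! i))"
    using nz by (intro degree_prod_eq_sum_degree) auto
qed

text \<open>The two conditions on minors say that the rank is \<open>r\<close> in terms of the Smith form; the list of
  invariant factors then has exactly \<open>r\<close> elements.\<close>

lemma invariant_factors_exist:
  fixes P :: "'a::field poly mat"
  assumes P: "P \<in> carrier_mat m n" and rank: "poly_rank P = r" and r: "r \<le> min m n"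
    and zero: "dvd_minors (Suc r) 0 P" and nonzero: "\<not> dvd_minors r 0 P"
  obtains \<beta>s where "invariant_factors P \<beta>s" "length \<beta>s = r" "\<forall>\<beta>\<in>set \<beta>s. lead_coeff \<beta> = 1"
    "\<And>j x. j \<le> r \<Longrightarrow> dvd_minors j x P \<longleftrightarrow> x dvd (\<Prod>i<j. \<beta>s ! i)"
proof -
  obtain \<beta>s where len: "length \<beta>s \<le> min m n" and mon: "\<forall>\<beta>\<in>set \<beta>s. lead_coeff \<beta> = 1"
    and srt: "sorted_wrt (dvd) \<beta>s" and E: "unimod_equiv m n P (smith_mat m n \<beta>s)"
    using Smith_form_exists[OF P] by blast
  note D = dvd_minors_Smith[OF E srt]
  have "\<not> r < length \<beta>s"
  proof
    assume lt: "r < length \<beta>s"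
    then have "Suc r \<le> min m n" using len by simp
    from D[OF this, of 0] zero have "0 dvd (\<Prod>i<Suc r. padded \<beta>s i)" by blast
    then have "(\<Prod>i<Suc r. \<beta>s ! i) = 0" using lt by (simp only: prod_padded Suc_le_eq dvd_0_left_iff)
    then show False using monic_prod(2)[OF mon, of "Suc r"] lt by simp
  qed
  moreover have "\<not> length \<beta>s < r"
  proof
    assume lt: "length \<beta>s < r"
    then have "(\<Prod>i<r. padded \<beta>s i) = 0" by (intro prod_zero) (auto simp: padded_def)
    then show False using nonzero D[OF r, of 0] by simp
  qed
  ultimately have l: "length \<beta>s = r" by simp
  have "invariant_factors P \<beta>s"
    using E P mon srt l rank unfolding invariant_factors_def unimod_equiv_def
    by (auto simp: unimod_iff_invertible_mat)
  moreover have "dvd_minors j x P \<longleftrightarrow> x dvd (\<Prod>i<j. \<beta>s ! i)" if "j \<le> r" for j x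
    using D[of j x] prod_padded[of j \<beta>s] that l r by auto
  ultimately show ?thesis using that l mon by blast
qed

text \<open>Rows of \<open>L\<close> are handled as columns of its transpose.\<close>

locale minimal_basis_pair =
  fixes m n r :: nat and K L :: "'a::field poly mat" and \<kappa> l :: "nat \<Rightarrow> nat"
  assumes r: "r \<le> m" "r \<le> n"
    and K: "K \<in> carrier_mat m r" and L: "L \<in> carrier_mat r n"
    and minK: "minimal_basis_mat K" and minL: "minimal_basis_mat L\<^sup>T"
    and \<kappa>: "\<And>i. i < r \<Longrightarrow> vec_degree (col K i) = \<kappa> i"
    and l: "\<And>i. i < r \<Longrightarrow> vec_degree (col L\<^sup>T i) = l i"
begin

lemma LT: "L\<^sup>T \<in> carrier_mat n r" using L by simp

lemma left_inverse: obtains Kl where "Kl \<in> carrier_mat r m" "Kl * K = 1\<^sub>m r"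
  using minimal_basis_left_inverse[OF K r(1) minK] by metis

lemma right_inverse: obtains Lr where "Lr \<in> carrier_mat n r" "L * Lr = 1\<^sub>m r"
proof -
  obtain W where W: "W \<in> carrier_mat r n" "W * L\<^sup>T = 1\<^sub>m r"
    using minimal_basis_left_inverse[OF LT r(2) minL] by metis
  have "L * W\<^sup>T = (W * L\<^sup>T)\<^sup>T" using transpose_mult[OF W(1) LT] by simp
  then show ?thesis using that[of "W\<^sup>T"] W by simp
qed

text \<open>The one-sided inverses of \<open>K\<close> and \<open>L\<close> recover \<open>E\<close> from \<open>K E L\<close>.\<close>

lemma dvd_minors_KEL:
  assumes E: "E \<in> carrier_mat r r"
  shows "dvd_minors j x (K * E * L) \<longleftrightarrow> dvd_minors j x E"
proof
  assume "dvd_minors j x (K * E * L)"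
  obtain Kl where Kl: "Kl \<in> carrier_mat r m" "Kl * K = 1\<^sub>m r" by (rule left_inverse)
  obtain Lr where Lr: "Lr \<in> carrier_mat n r" "L * Lr = 1\<^sub>m r" by (rule right_inverse)
  have 1: "K * E * L \<in> carrier_mat m n" using K E L by auto
  have "Kl * (K * E * L) * Lr = (Kl * K) * E * (L * Lr)"
    by (rule assoc_mult_middle[OF Kl(1) K E L Lr(1)])
  also have "\<dots> = E" using Kl(2) Lr(2) E by simp
  finally have "E = Kl * (K * E * L) * Lr" ..
  then show "dvd_minors j x E"
    using dvd_minors_mult[OF Kl(1) 1 Lr(1) \<open>dvd_minors j x (K * E * L)\<close>] by simp
next
  assume "dvd_minors j x E"
  then show "dvd_minors j x (K * E * L)" by (rule dvd_minors_mult[OF K E L])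
qed

lemma K_degree: "a < m \<Longrightarrow> i < r \<Longrightarrow> degree (K $$ (a, i)) \<le> \<kappa> i"
  using vec_degree_ge[of a "col K i"] \<kappa>[of i] K by auto

lemma L_degree: "b < n \<Longrightarrow> i < r \<Longrightarrow> degree (L $$ (i, b)) \<le> l i"
  using vec_degree_ge[of b "col L\<^sup>T i"] l[of i] L by auto

text \<open>The predictable degree property, used for the rows of \<open>L\<close> and then for the columns of \<open>K\<close>.\<close>

lemma degree_bounded_if_mat_degree_le:
  assumes E: "E \<in> carrier_mat r r" and deg: "mat_degree (K * E * L) \<le> d"
  shows "degree_bounded d \<kappa> l E"
  unfolding degree_bounded_def
proof (intro allI impI)
  fix i k assume "i < dim_row E" "k < dim_col E"
  then have ik: "i < r" "k < r" using E by auto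
  define X where "X = E * L"
  have X: "X \<in> carrier_mat r n" using E L by (auto simp: X_def)
  show "E $$ (i, k) = 0 \<or> degree (E $$ (i, k)) + \<kappa> i + l k \<le> d"
  proof (cases "E $$ (i, k) = 0")
    case False
    have c: "row E i \<in> carrier_vec r" "row E i $ k = E $$ (i, k)" using E ik by auto
    obtain b where b: "b < n" "(L\<^sup>T *\<^sub>v row E i) $ b \<noteq> 0" "degree (E $$ (i, k)) + l k \<le> degree ((L\<^sup>T *\<^sub>v row E i) $ b)"
      using minimal_basis_predictable_degree[OF LT minL c(1) ik(2)] c(2) False l[OF ik(2)] by auto
    have "(L\<^sup>T *\<^sub>v row E i) $ b = X $$ (i, b)"
      unfolding X_def using b ik E L by (auto simp: scalar_prod_def mult.commute)
    then have Xb: "X $$ (i, b) \<noteq> 0" "degree (E $$ (i, k)) + l k \<le> degree (X $$ (i, b))"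
      using b by auto
    have c': "col X b \<in> carrier_vec r" "col X b $ i = X $$ (i, b)" using X b ik by auto
    obtain a where a: "a < m" "degree (X $$ (i, b)) + \<kappa> i \<le> degree ((K *\<^sub>v col X b) $ a)"
      using minimal_basis_predictable_degree[OF K minK c'(1) ik(1)] c'(2) Xb(1) \<kappa>[OF ik(1)] by auto
    have "(K *\<^sub>v col X b) $ a = (K * X) $$ (a, b)" using a b K X by simp
    also have "K * X = K * E * L" unfolding X_def using K E L by simp
    finally have "degree ((K *\<^sub>v col X b) $ a) \<le> d"
      using deg mat_degree_le_iff[of "K * E * L" m n d] a b K E L by auto
    then show ?thesis using a Xb by simp
  qed simp
qed

lemma mat_degree_le_if_degree_bounded:
  assumes E: "E \<in> carrier_mat r r" and bd: "degree_bounded d \<kappa> l E"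
  shows "mat_degree (K * E * L) \<le> d"
proof -
  have "degree ((K * E * L) $$ (a, b)) \<le> d" if ab: "a < m" "b < n" for a b
    unfolding mult3_nth[OF K E L ab]
  proof (intro degree_sum_le)
    fix k i assume "k \<in> {0..<r}" "i \<in> {0..<r}"
    then have ik: "i < r" "k < r" by auto
    show "degree (K $$ (a, i) * E $$ (i, k) * L $$ (k, b)) \<le> d"
    proof (cases "E $$ (i, k) = 0")
      case False
      then have "degree (E $$ (i, k)) + \<kappa> i + l k \<le> d"
        using bd ik E unfolding degree_bounded_def by auto
      moreover have "degree (K $$ (a, i) * E $$ (i, k) * L $$ (k, b)) \<le>
          degree (K $$ (a, i)) + degree (E $$ (i, k)) + degree (L $$ (k, b))"
        using degree_mult_le[of "K $$ (a, i) * E $$ (i, k)" "L $$ (k, b)"]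
          degree_mult_le[of "K $$ (a, i)" "E $$ (i, k)"] by linarith
      ultimately show ?thesis using K_degree[OF ab(1) ik(1)] L_degree[OF ab(2) ik(2)] by linarith
    qed simp
  qed auto
  then show ?thesis using mat_degree_le_iff[of "K * E * L" m n d] K E L by auto
qed

lemma mat_reversal_KEL:
  assumes E: "E \<in> carrier_mat r r" and d: "mat_degree (K * E * L) = d"
  shows "mat_reversal (K * E * L) = column_reversal K * weighted_reversal d \<kappa> l E * (column_reversal L\<^sup>T)\<^sup>T"
proof (rule eq_matI)
  let ?R = "column_reversal K" and ?S = "(column_reversal L\<^sup>T)\<^sup>T" and ?E = "weighted_reversal d \<kappa> l E"
  have bd: "degree_bounded d \<kappa> l E" using degree_bounded_if_mat_degree_le[OF E] d by simp
  have c: "?R \<in> carrier_mat m r" "?S \<in> carrier_mat r n" "?E \<in> carrier_mat r r"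
    using K L E by (auto simp: column_reversal_def weighted_reversal_def)
  fix a b assume "a < dim_row (?R * ?E * ?S)" "b < dim_col (?R * ?E * ?S)"
  then have ab: "a < m" "b < n" using c by auto
  have "mat_reversal (K * E * L) $$ (a, b) = poly_reversal d ((K * E * L) $$ (a, b))"
    using ab K E L d by (simp add: mat_reversal_def)
  also have "\<dots> = (\<Sum>k = 0..<r. \<Sum>i = 0..<r. poly_reversal d (K $$ (a, i) * E $$ (i, k) * L $$ (k, b)))"
    unfolding mult3_nth[OF K E L ab] poly_reversal_sum ..
  also have "\<dots> = (\<Sum>k = 0..<r. \<Sum>i = 0..<r. ?R $$ (a, i) * ?E $$ (i, k) * ?S $$ (k, b))"
  proof (intro sum.cong refl)
    fix k i assume "k \<in> {0..<r}" "i \<in> {0..<r}"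
    then have ik: "i < r" "k < r" by auto
    have R: "?R $$ (a, i) = poly_reversal (\<kappa> i) (K $$ (a, i))"
      using ab ik K \<kappa> by (simp add: column_reversal_def)
    have S: "?S $$ (k, b) = poly_reversal (l k) (L $$ (k, b))"
      using ab ik L l by (simp add: column_reversal_def)
    have W: "?E $$ (i, k) = poly_reversal (d - (\<kappa> i + l k)) (E $$ (i, k))"
      using ik E by (simp add: weighted_reversal_def)
    show "poly_reversal d (K $$ (a, i) * E $$ (i, k) * L $$ (k, b)) = ?R $$ (a, i) * ?E $$ (i, k) * ?S $$ (k, b)"
    proof (cases "E $$ (i, k) = 0")
      case False
      then have b': "degree (E $$ (i, k)) + \<kappa> i + l k \<le> d"
        using bd ik E unfolding degree_bounded_def by auto
      let ?e = "d - (\<kappa> i + l k)"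
      have "poly_reversal (\<kappa> i + ?e + l k) (K $$ (a, i) * E $$ (i, k) * L $$ (k, b)) =
          poly_reversal (\<kappa> i + ?e) (K $$ (a, i) * E $$ (i, k)) * poly_reversal (l k) (L $$ (k, b))"
        using K_degree[OF ab(1) ik(1)] L_degree[OF ab(2) ik(2)] b' degree_mult_le[of "K $$ (a, i)" "E $$ (i, k)"]
        by (intro poly_reversal_mult) linarith+
      also have "poly_reversal (\<kappa> i + ?e) (K $$ (a, i) * E $$ (i, k)) =
          poly_reversal (\<kappa> i) (K $$ (a, i)) * poly_reversal ?e (E $$ (i, k))"
        using K_degree[OF ab(1) ik(1)] b' by (intro poly_reversal_mult) linarith+
      finally show ?thesis unfolding R S W using b' by simp
    qed (simp add: W)
  qed
  also have "\<dots> = (?R * ?E * ?S) $$ (a, b)"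
    by (rule mult3_nth[OF c(1,3,2) ab, symmetric])
  finally show "mat_reversal (K * E * L) $$ (a, b) = (?R * ?E * ?S) $$ (a, b)" .
qed (use K E L in \<open>auto simp: mat_reversal_def column_reversal_def weighted_reversal_def\<close>)

lemma reversal_inverses:
  obtains W q Y q' where "W \<in> carrier_mat r m" "W * column_reversal K = q \<cdot>\<^sub>m 1\<^sub>m r" "poly q 0 \<noteq> 0"
    "Y \<in> carrier_mat n r" "(column_reversal L\<^sup>T)\<^sup>T * Y = q' \<cdot>\<^sub>m 1\<^sub>m r" "poly q' 0 \<noteq> 0"
proof -
  obtain W q where W: "W \<in> carrier_mat r m" "W * column_reversal K = q \<cdot>\<^sub>m 1\<^sub>m r" "poly q 0 \<noteq> 0"
    using minimal_basis_reversal_left_inverse[OF K r(1) minK] by metis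
  obtain Y q' where Y: "Y \<in> carrier_mat r n" "Y * column_reversal L\<^sup>T = q' \<cdot>\<^sub>m 1\<^sub>m r" "poly q' 0 \<noteq> 0"
    using minimal_basis_reversal_left_inverse[OF LT r(2) minL] by metis
  have "column_reversal L\<^sup>T \<in> carrier_mat n r" using L by (simp add: column_reversal_def)
  then have "(column_reversal L\<^sup>T)\<^sup>T * Y\<^sup>T = (q' \<cdot>\<^sub>m 1\<^sub>m r)\<^sup>T"
    using transpose_mult[OF Y(1)] Y(2) by metis
  also have "\<dots> = q' \<cdot>\<^sub>m 1\<^sub>m r" by (rule eq_matI) auto
  finally show ?thesis using that[of W q "Y\<^sup>T" q'] W Y by simp
qed

lemma mult_inverses_middle:
  fixes R N S W Y :: "'a poly mat"
  assumes "W \<in> carrier_mat r m" "R \<in> carrier_mat m r" "W * R = q \<cdot>\<^sub>m 1\<^sub>m r"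
    "N \<in> carrier_mat r r" "S \<in> carrier_mat r n" "Y \<in> carrier_mat n r" "S * Y = q' \<cdot>\<^sub>m 1\<^sub>m r"
  shows "W * (R * N * S) * Y = (q * q') \<cdot>\<^sub>m N"
proof -
  have "W * (R * N * S) * Y = (W * R) * N * (S * Y)"
    by (rule assoc_mult_middle[OF assms(1,2,4,5,6)])
  also have "\<dots> = (q * q') \<cdot>\<^sub>m N"
    unfolding assms(3,7) using assms(4)
    by (intro eq_matI) (auto simp: scalar_prod_def sum.delta if_distrib[of "\<lambda>x. x * _"] if_distrib[of "\<lambda>x. _ * x"] mult_ac cong: if_cong)
  finally show ?thesis .
qed

text \<open>The reversals of \<open>K\<close> and \<open>L\<close> have one-sided inverses up to factors that do not vanish at
  \<open>0\<close>, and such factors do not matter for powers of the variable.\<close>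

lemma dvd_minors_reversal_KEL:
  assumes E: "E \<in> carrier_mat r r" and d: "mat_degree (K * E * L) = d"
  shows "dvd_minors j ([:- 0, 1:] ^ k) (mat_reversal (K * E * L)) \<longleftrightarrow>
    dvd_minors j ([:- 0, 1:] ^ k) (weighted_reversal d \<kappa> l E)"
proof -
  let ?R = "column_reversal K" and ?S = "(column_reversal L\<^sup>T)\<^sup>T" and ?E = "weighted_reversal d \<kappa> l E"
  have c: "?R \<in> carrier_mat m r" "?S \<in> carrier_mat r n" "?E \<in> carrier_mat r r"
    using K L E by (auto simp: column_reversal_def weighted_reversal_def)
  note eq = mat_reversal_KEL[OF E d]
  obtain W q Y q' where W: "W \<in> carrier_mat r m" "W * ?R = q \<cdot>\<^sub>m 1\<^sub>m r" "poly q 0 \<noteq> 0"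
    and Y: "Y \<in> carrier_mat n r" "?S * Y = q' \<cdot>\<^sub>m 1\<^sub>m r" "poly q' 0 \<noteq> 0"
    by (rule reversal_inverses)
  show ?thesis
  proof
    assume D: "dvd_minors j ([:- 0, 1:] ^ k) (mat_reversal (K * E * L))"
    have "mat_reversal (K * E * L) \<in> carrier_mat m n" using K E L by (auto simp: mat_reversal_def)
    then have D': "dvd_minors j ([:- 0, 1:] ^ k) ((q * q') \<cdot>\<^sub>m ?E)"
      using dvd_minors_mult[OF W(1) _ Y(1) D] mult_inverses_middle[OF W(1) c(1) W(2) c(3,2) Y(1,2)]
      unfolding eq by simp
    have nz: "poly ((q * q') ^ j) 0 \<noteq> 0" using W(3) Y(3) by simp
    show "dvd_minors j ([:- 0, 1:] ^ k) ?E"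
    proof (subst dvd_minors_cong[of _ r r "(q * q') \<cdot>\<^sub>m ?E" _ _ "[:- 0, 1:] ^ k"])
      fix \<rho> \<gamma> assume "\<rho> \<in> {0..<j} \<rightarrow> {0..<r}" "\<gamma> \<in> {0..<j} \<rightarrow> {0..<r}"
      then have "minor ((q * q') \<cdot>\<^sub>m ?E) j \<rho> \<gamma> = (q * q') ^ j * minor ?E j \<rho> \<gamma>"
        using c(3) by (intro minor_smult) auto
      then show "[:- 0, 1:] ^ k dvd minor ?E j \<rho> \<gamma> \<longleftrightarrow> [:- 0, 1:] ^ k dvd minor ((q * q') \<cdot>\<^sub>m ?E) j \<rho> \<gamma>"
        using linear_power_dvd_mult_iff[OF nz] by simp
    qed (use c D' in auto)
  next
    assume "dvd_minors j ([:- 0, 1:] ^ k) ?E"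
    then show "dvd_minors j ([:- 0, 1:] ^ k) (mat_reversal (K * E * L))"
      unfolding eq by (rule dvd_minors_mult[OF c(1,3,2)])
  qed
qed

text \<open>By saturation \<open>K\<close> times its left inverse acts as the identity on polynomial vectors in the column
  space of \<open>K\<close>, and likewise for \<open>L\<close>.\<close>

lemma factor_through:
  assumes A: "A \<in> carrier_mat m n" and cA: "col_range A = col_range K" and rA: "col_range A\<^sup>T = col_range L\<^sup>T"
  obtains E where "E \<in> carrier_mat r r" "A = K * E * L"
proof -
  have proj: "N * (W * B) = B"
    if N: "N \<in> carrier_mat p r" and min: "minimal_basis_mat N" and W: "W \<in> carrier_mat r p" "W * N = 1\<^sub>m r"
      and B: "B \<in> carrier_mat p q" and range: "col_range B = col_range N" for N W B :: "'a poly mat" and p q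
  proof (rule eq_matI)
    fix a b assume "a < dim_row B" "b < dim_col B"
    then have ab: "a < p" "b < q" using B by auto
    have v: "col B b \<in> carrier_vec p" using B ab by auto
    have "fract_vec (col B b) \<in> col_range B"
      using fract_vec_in_col_range_iff[OF B v] mult_mat_unit_vec[OF B ab(2)]
      by (auto intro!: exI[of _ 1] exI[of _ "unit_vec q b"])
    then obtain h y where h: "h \<noteq> 0" "y \<in> carrier_vec r" "h \<cdot>\<^sub>v col B b = N *\<^sub>v y"
      unfolding range fract_vec_in_col_range_iff[OF N v] by blast
    have "h dvd y $ i" if "i < r" for i
      using minimal_basis_saturated[OF N min h(1) v h(2,3) that] .
    then have y: "y = h \<cdot>\<^sub>v vec r (\<lambda>i. y $ i div h)" using h(2) by (intro eq_vecI) auto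
    let ?z = "vec r (\<lambda>i. y $ i div h)"
    define w where "w = N *\<^sub>v ?z"
    have w: "w \<in> carrier_vec p" using N by (simp add: w_def)
    have eq: "h \<cdot>\<^sub>v col B b = h \<cdot>\<^sub>v w"
      using h(3) y mult_mat_smult_vec[OF N, of ?z h] by (simp add: w_def)
    have "col B b = w"
    proof (rule eq_vecI)
      fix i assume i: "i < dim_vec w"
      have "(h \<cdot>\<^sub>v col B b) $ i = (h \<cdot>\<^sub>v w) $ i" unfolding eq ..
      moreover have "(h \<cdot>\<^sub>v col B b) $ i = h * col B b $ i"
        using i w v by (subst index_smult_vec(1)) (simp_all only: carrier_vecD)
      ultimately show "col B b $ i = w $ i" using i w h(1) by simp
    qed (use w B in auto)
    then have z: "col B b = N *\<^sub>v ?z" by (simp add: w_def)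
    have "W *\<^sub>v col B b = (W * N) *\<^sub>v ?z" unfolding z by (rule assoc_mult_mat_vec[OF W(1) N, symmetric]) simp
    also have "\<dots> = ?z" unfolding W(2) by simp
    finally have "N *\<^sub>v (W *\<^sub>v col B b) = col B b" using z by simp
    moreover have "col (N * (W * B)) b = N *\<^sub>v (W *\<^sub>v col B b)"
      using ab by (simp add: col_mult2[OF N mult_carrier_mat[OF W(1) B]] col_mult2[OF W(1) B])
    ultimately have eqcol: "col (N * (W * B)) b = col B b" by simp
    have "(N * (W * B)) $$ (a, b) = col (N * (W * B)) b $ a"
      using ab N W B by (intro index_col[symmetric]) auto
    also have "\<dots> = B $$ (a, b)" unfolding eqcol using ab B by simp
    finally show "(N * (W * B)) $$ (a, b) = B $$ (a, b)" .
  qed (use N W B in auto)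
  obtain Kl where Kl: "Kl \<in> carrier_mat r m" "Kl * K = 1\<^sub>m r" by (rule left_inverse)
  obtain W where W: "W \<in> carrier_mat r n" "W * L\<^sup>T = 1\<^sub>m r"
    using minimal_basis_left_inverse[OF LT r(2) minL] by metis
  have 1: "K * (Kl * A) = A" using proj[OF K minK Kl A cA] .
  have "L\<^sup>T * (W * A\<^sup>T) = A\<^sup>T" using proj[OF LT minL W _ rA] A by simp
  then have "(L\<^sup>T * (W * A\<^sup>T))\<^sup>T = A" by simp
  then have 2: "A * W\<^sup>T * L = A"
    using transpose_mult[of "L\<^sup>T" n r "W * A\<^sup>T" m] transpose_mult[of W r n "A\<^sup>T" m] A W L by simp
  have "K * (Kl * A * W\<^sup>T) * L = (K * (Kl * A)) * W\<^sup>T * L"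
    using K Kl A W L by (simp add: assoc_mult_mat[of K m r "Kl * A" n "W\<^sup>T" r])
  also have "\<dots> = A" unfolding 1 2 ..
  finally show ?thesis using that[of "Kl * A * W\<^sup>T"] Kl A W by simp
qed

lemma ranges_KEL:
  assumes E: "E \<in> carrier_mat r r" and det: "det E \<noteq> 0"
  shows "col_range (K * E * L) = col_range K" "col_range (K * E * L)\<^sup>T = col_range L\<^sup>T"
    "poly_rank (K * E * L) = r"
proof -
  have gen: "col_range (N * (F * M)) = col_range N \<and> poly_rank (N * (F * M)) = r"
    if N: "N \<in> carrier_mat p r" and F: "F \<in> carrier_mat r r" and M: "M \<in> carrier_mat r q"
      and W: "W \<in> carrier_mat r p" "W * N = 1\<^sub>m r" and Y: "Y \<in> carrier_mat q r" "M * Y = 1\<^sub>m r"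
      and det: "det F \<noteq> 0" for N F M W Y :: "'a poly mat" and p q
  proof -
    have adj: "adj_mat F \<in> carrier_mat r r" "F * adj_mat F = det F \<cdot>\<^sub>m 1\<^sub>m r" using adj_mat[OF F] by auto
    have "(F * M) * (Y * adj_mat F) = F * (M * Y) * adj_mat F"
      by (rule assoc_mult_inner[OF F M Y(1) adj(1)])
    also have "\<dots> = det F \<cdot>\<^sub>m 1\<^sub>m r" using Y F adj by simp
    finally have FY: "(F * M) * (Y * adj_mat F) = det F \<cdot>\<^sub>m 1\<^sub>m r" .
    have W1: "W * N = 1 \<cdot>\<^sub>m 1\<^sub>m r" using W by (intro eq_matI) auto
    have "F * M \<in> carrier_mat r q" "Y * adj_mat F \<in> carrier_mat q r" using F M Y adj by auto
    then show ?thesis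
      using col_range_and_rank_mult[OF N _ W(1) W1 one_neq_zero _ FY det] by auto
  qed
  obtain Kl where Kl: "Kl \<in> carrier_mat r m" "Kl * K = 1\<^sub>m r" by (rule left_inverse)
  obtain Lr where Lr: "Lr \<in> carrier_mat n r" "L * Lr = 1\<^sub>m r" by (rule right_inverse)
  have KEL: "K * E * L = K * (E * L)" using K E L by simp
  show "col_range (K * E * L) = col_range K" "poly_rank (K * E * L) = r"
    unfolding KEL using gen[OF K E L Kl Lr det] by auto
  have T: "(K * E * L)\<^sup>T = L\<^sup>T * (E\<^sup>T * K\<^sup>T)"
    using transpose_mult[of "K * E" m r L n] transpose_mult[of K m r E r] K E L by simp
  have "Lr\<^sup>T * L\<^sup>T = 1\<^sub>m r" using transpose_mult[OF L Lr(1)] Lr(2) by simp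
  moreover have "K\<^sup>T * Kl\<^sup>T = 1\<^sub>m r" using transpose_mult[OF Kl(1) K] Kl(2) by simp
  moreover have "det E\<^sup>T \<noteq> 0" using det E by (simp add: det_transpose)
  ultimately show "col_range (K * E * L)\<^sup>T = col_range L\<^sup>T"
    unfolding T using gen[OF LT, of "E\<^sup>T" "K\<^sup>T" m "Lr\<^sup>T" "Kl\<^sup>T"] K E L Kl Lr by auto
qed

lemma rank_reversal_KEL:
  assumes E: "E \<in> carrier_mat r r" and d: "mat_degree (K * E * L) = d"
    and det: "det (weighted_reversal d \<kappa> l E) \<noteq> 0"
  shows "poly_rank (mat_reversal (K * E * L)) = r"
proof -
  let ?R = "column_reversal K" and ?S = "(column_reversal L\<^sup>T)\<^sup>T" and ?E = "weighted_reversal d \<kappa> l E"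
  have c: "?R \<in> carrier_mat m r" "?S \<in> carrier_mat r n" "?E \<in> carrier_mat r r"
    using K L E by (auto simp: column_reversal_def weighted_reversal_def)
  obtain W q Y q' where W: "W \<in> carrier_mat r m" "W * ?R = q \<cdot>\<^sub>m 1\<^sub>m r" "poly q 0 \<noteq> 0"
    and Y: "Y \<in> carrier_mat n r" "?S * Y = q' \<cdot>\<^sub>m 1\<^sub>m r" "poly q' 0 \<noteq> 0"
    by (rule reversal_inverses)
  have adj: "adj_mat ?E \<in> carrier_mat r r" "?E * adj_mat ?E = det ?E \<cdot>\<^sub>m 1\<^sub>m r" using adj_mat[OF c(3)] by auto
  have "(?E * ?S) * (Y * adj_mat ?E) = ?E * (?S * Y) * adj_mat ?E"
    by (rule assoc_mult_inner[OF c(3,2) Y(1) adj(1)])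
  also have "\<dots> = q' \<cdot>\<^sub>m (?E * adj_mat ?E)"
    unfolding Y(2) mult_smult_distrib[OF c(3) one_carrier_mat] right_mult_one_mat[OF c(3)]
    by (rule mult_smult_assoc_mat[OF c(3) adj(1)])
  also have "\<dots> = (q' * det ?E) \<cdot>\<^sub>m 1\<^sub>m r" unfolding adj(2) by (intro eq_matI) auto
  finally have FY: "(?E * ?S) * (Y * adj_mat ?E) = (q' * det ?E) \<cdot>\<^sub>m 1\<^sub>m r" .
  have "?E * ?S \<in> carrier_mat r n" "Y * adj_mat ?E \<in> carrier_mat n r" using c Y adj by auto
  moreover have "q \<noteq> 0" "q' * det ?E \<noteq> 0" using W(3) Y(3) det by auto
  ultimately have "poly_rank (?R * (?E * ?S)) = r"
    using col_range_and_rank_mult(2)[OF c(1) _ W(1,2) _ _ FY] by blast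
  moreover have "?R * ?E * ?S = ?R * (?E * ?S)" using c by simp
  ultimately show ?thesis unfolding mat_reversal_KEL[OF E d] by simp
qed

end

section \<open>Necessity\<close>

text \<open>Majorization in a form that needs no sorting of the numbers \<open>h i\<close>. It is written additively
  because the differences \<open>d - h i\<close> may be negative
  (see \<open>subset_bound_iff_majorized\<close>).\<close>

definition subset_bound :: "nat \<Rightarrow> nat \<Rightarrow> (nat \<Rightarrow> nat) \<Rightarrow> (nat \<Rightarrow> nat) \<Rightarrow> bool" where
  "subset_bound r d h y \<longleftrightarrow>
     (\<forall>S. S \<subseteq> {0..<r} \<longrightarrow> (\<Sum>i<card S. y i) + (\<Sum>i\<in>S. h i) \<le> card S * d) \<and>
     (\<Sum>i<r. y i) + (\<Sum>i = 0..<r. h i) = r * d"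

lemma X_power_dvd_iff: "p \<noteq> 0 \<Longrightarrow> [:0, 1:] ^ k dvd (p :: 'a::field poly) \<longleftrightarrow> k \<le> order 0 p"
  using order_divides[of 0 k p] by simp

lemma X_power_dvd_poly_reversal:
  "degree p \<le> N \<Longrightarrow> [:0, 1:] ^ k dvd poly_reversal N (p :: 'a::field poly) \<longleftrightarrow> p = 0 \<or> degree p + k \<le> N"
  using monom_dvd_poly_reversal[of p N k] by (simp add: monom_altdef)

lemma order_prod_list:
  fixes xs :: "'a::field poly list"
  assumes "\<forall>x\<in>set xs. lead_coeff x = 1" "j \<le> length xs"
  shows "order a (\<Prod>i<j. xs ! i) = (\<Sum>i<j. order a (xs ! i))"
  using assms(2)
proof (induction j)
  case (Suc j)
  then have "(\<Prod>i<Suc j. xs ! i) \<noteq> 0" using monic_prod(2)[OF assms(1), of "Suc j"] by blast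
  then show ?case using Suc by (simp add: order_mult)
qed simp

lemma dvd_minors_dvd: "dvd_minors j x M \<Longrightarrow> y dvd x \<Longrightarrow> dvd_minors j y M"
  unfolding dvd_minors_def using dvd_trans by blast

lemma dvd_minors_det:
  assumes M: "M \<in> carrier_mat r r" and D: "dvd_minors r x M"
  shows "x dvd det M"
proof -
  have "id \<in> {0..<r} \<rightarrow> {0..<dim_row M}" "id \<in> {0..<r} \<rightarrow> {0..<dim_col M}" using M by auto
  then have "x dvd minor M r id id" using D unfolding dvd_minors_def by blast
  then show ?thesis unfolding minor_id[OF M] .
qed

context minimal_basis_pair
begin

lemma det_weighted_reversal:
  assumes E: "E \<in> carrier_mat r r" and bd: "degree_bounded d \<kappa> l E"
  defines "W \<equiv> (\<Sum>i = 0..<r. \<kappa> i + l i)"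
  shows "det (weighted_reversal d \<kappa> l E) = poly_reversal (r * d - W) (det E)"
    and "det E = 0 \<or> degree (det E) + W \<le> r * d"
proof -
  have id: "id \<in> {0..<r} \<rightarrow> {0..<r}" by auto
  have c: "weighted_reversal d \<kappa> l E \<in> carrier_mat r r" using E by (simp add: weighted_reversal_def)
  have W: "W = (\<Sum>a = 0..<r. \<kappa> (id a)) + (\<Sum>a = 0..<r. l (id a))" by (simp add: W_def sum.distrib)
  show "det (weighted_reversal d \<kappa> l E) = poly_reversal (r * d - W) (det E)"
    "det E = 0 \<or> degree (det E) + W \<le> r * d"
    using minor_weighted_reversal[OF E bd id id] unfolding W minor_id[OF E] minor_id[OF c] by auto
qed

text \<open>The inequality for \<open>S\<close> comes from a heavy nonzero minor of order \<open>card S\<close>, the equality from the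
  determinant, for which divisibility holds in both directions. The smallest partial multiplicity is
  \<open>0\<close> because an entry of largest degree has a reversal that does not vanish at \<open>0\<close>.\<close>

lemma necessity:
  assumes A: "A \<in> carrier_mat m n" and d: "mat_degree A = d"
    and inv: "invariant_factors A \<alpha>s" "length \<alpha>s = r" and pm: "partial_multiplicities_infinity A fs" "length fs = r"
    and cA: "col_range A = col_range K" and rA: "col_range A\<^sup>T = col_range L\<^sup>T" and r0: "0 < r"
    and mono: "\<And>i k. i \<le> k \<Longrightarrow> k < r \<Longrightarrow> \<kappa> i \<le> \<kappa> k" and anti: "\<And>i k. i \<le> k \<Longrightarrow> k < r \<Longrightarrow> l k \<le> l i"
  shows "fs ! 0 = 0 \<and> subset_bound r d (\<lambda>i. \<kappa> i + l i) (\<lambda>i. degree (\<alpha>s ! i) + fs ! i)"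
proof -
  obtain E where E: "E \<in> carrier_mat r r" and AE: "A = K * E * L"
    by (rule factor_through[OF A cA rA])
  obtain \<beta>s where \<beta>: "invariant_factors (mat_reversal A) \<beta>s" "fs = map (order 0) \<beta>s"
    using pm unfolding partial_multiplicities_infinity_def by blast
  have len\<beta>: "length \<beta>s = r" using \<beta>(2) pm(2) by simp
  have mon: "\<forall>\<alpha>\<in>set \<alpha>s. lead_coeff \<alpha> = 1" "\<forall>\<beta>\<in>set \<beta>s. lead_coeff \<beta> = 1"
    using inv \<beta> unfolding invariant_factors_def by auto
  have rA': "mat_reversal A \<in> carrier_mat m n" using A by (simp add: mat_reversal_def)
  let ?E = "weighted_reversal d \<kappa> l E"
  have cE: "?E \<in> carrier_mat r r" using E by (simp add: weighted_reversal_def)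
  have dE: "mat_degree (K * E * L) = d" using d AE by simp
  have bd: "degree_bounded d \<kappa> l E" using degree_bounded_if_mat_degree_le[OF E] dE by simp
  have DE: "dvd_minors j x E \<longleftrightarrow> x dvd (\<Prod>i<j. \<alpha>s ! i)" if "j \<le> r" for j x
    using invariant_factors_dvd_minors[OF A inv(1), of j x] dvd_minors_KEL[OF E, of j x] prod_padded[of j \<alpha>s] that r inv(2)
    unfolding AE by simp
  have DA: "dvd_minors j x (mat_reversal A) \<longleftrightarrow> x dvd (\<Prod>i<j. \<beta>s ! i)" if "j \<le> r" for j x
    using invariant_factors_dvd_minors[OF rA' \<beta>(1), of j x] prod_padded[of j \<beta>s] that r len\<beta> by simp
  have DX: "dvd_minors j ([:0, 1:] ^ k) ?E \<longleftrightarrow> [:0, 1:] ^ k dvd (\<Prod>i<j. \<beta>s ! i)" if "j \<le> r" for j k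
    using dvd_minors_reversal_KEL[OF E dE, of j k] DA[OF that, of "[:0, 1:] ^ k"] unfolding AE by simp
  have ord: "order 0 (\<Prod>i<j. \<beta>s ! i) = (\<Sum>i<j. fs ! i)" if "j \<le> r" for j
    using order_prod_list[OF mon(2), of j 0] that len\<beta> by (simp add: \<beta>(2))
  have nz: "(\<Prod>i<j. \<alpha>s ! i) \<noteq> 0" "(\<Prod>i<j. \<beta>s ! i) \<noteq> 0" if "j \<le> r" for j
    using monic_prod(2)[OF mon(1), of j] monic_prod(2)[OF mon(2), of j] that unfolding inv(2) len\<beta> by blast+
  have deg: "degree (\<Prod>i<j. \<alpha>s ! i) = (\<Sum>i<j. degree (\<alpha>s ! i))" if "j \<le> r" for j
    using monic_prod(3)[OF mon(1), of j] that inv(2) by blast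
  define h where "h i = \<kappa> i + l i" for i
  define W where "W = (\<Sum>i = 0..<r. h i)"
  have detE: "det E \<noteq> 0"
  proof
    assume "det E = 0"
    then have "0 dvd (\<Prod>i<r. \<alpha>s ! i)" using det_dvd_minors[OF E] DE[of r 0] by simp
    then show False using nz(1)[of r] by simp
  qed
  have "det E dvd (\<Prod>i<r. \<alpha>s ! i)" using det_dvd_minors[OF E] DE[of r "det E"] by simp
  moreover have "(\<Prod>i<r. \<alpha>s ! i) dvd det E" using dvd_minors_det[OF E] DE[of r "\<Prod>i<r. \<alpha>s ! i"] by simp
  ultimately have degE: "degree (det E) = (\<Sum>i<r. degree (\<alpha>s ! i))"
    using deg[of r] nz(1)[of r] detE by (metis dvd_imp_degree_le le_antisym order_refl)
  note dr = det_weighted_reversal[OF E bd, folded h_def, folded W_def]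
  have dW: "degree (det E) + W \<le> r * d" using dr(2) detE by simp
  then have Xdet: "[:0, 1:] ^ k dvd det ?E \<longleftrightarrow> degree (det E) + k \<le> r * d - W" for k
    unfolding dr(1) using detE by (subst X_power_dvd_poly_reversal) auto
  have total: "degree (det E) + (\<Sum>i<r. fs ! i) + W = r * d"
  proof -
    have "[:0, 1:] ^ (\<Sum>i<r. fs ! i) dvd det ?E"
      using DX[of r "\<Sum>i<r. fs ! i"] X_power_dvd_iff[OF nz(2)[of r]] ord[of r] dvd_minors_det[OF cE] by simp
    then have 1: "degree (det E) + (\<Sum>i<r. fs ! i) \<le> r * d - W" using Xdet by simp
    have "[:0, 1:] ^ (r * d - W - degree (det E)) dvd det ?E" unfolding Xdet using dW by simp
    then have "dvd_minors r ([:0, 1:] ^ (r * d - W - degree (det E))) ?E"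
      using det_dvd_minors[OF cE] dvd_minors_dvd by blast
    then have "r * d - W - degree (det E) \<le> (\<Sum>i<r. fs ! i)"
      using DX[of r] X_power_dvd_iff[OF nz(2)[of r]] ord[of r] by simp
    then show ?thesis using 1 dW by linarith
  qed
  have ineq: "(\<Sum>i<card S. degree (\<alpha>s ! i) + fs ! i) + (\<Sum>i\<in>S. h i) \<le> card S * d" if S: "S \<subseteq> {0..<r}" for S
  proof -
    have j: "card S \<le> r" using card_mono[OF _ S] by simp
    obtain \<rho> \<gamma> where \<rho>: "\<rho> \<in> {0..<card S} \<rightarrow> {0..<r}" and \<gamma>: "\<gamma> \<in> {0..<card S} \<rightarrow> {0..<r}"
      and nzm: "minor E (card S) \<rho> \<gamma> \<noteq> 0"
      and sums: "(\<Sum>i\<in>S. \<kappa> i) \<le> (\<Sum>a = 0..<card S. \<kappa> (\<rho> a))" "(\<Sum>i\<in>S. l i) \<le> (\<Sum>a = 0..<card S. l (\<gamma> a))"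
      using exists_heavy_minor[OF E detE S, of \<kappa> l] mono anti by blast
    let ?m = "minor E (card S) \<rho> \<gamma>"
    let ?W = "(\<Sum>a = 0..<card S. \<kappa> (\<rho> a)) + (\<Sum>a = 0..<card S. l (\<gamma> a))"
    note mw = minor_weighted_reversal[OF E bd \<rho> \<gamma>]
    have mW: "degree ?m + ?W \<le> card S * d" using mw(2) nzm by blast
    have "(\<Prod>i<card S. \<alpha>s ! i) dvd ?m"
      using DE[OF j, of "\<Prod>i<card S. \<alpha>s ! i"] \<rho> \<gamma> E unfolding dvd_minors_def by auto
    from dvd_imp_degree_le[OF this nzm] have 1: "(\<Sum>i<card S. degree (\<alpha>s ! i)) \<le> degree ?m"
      unfolding deg[OF j] .
    have "[:0, 1:] ^ (\<Sum>i<card S. fs ! i) dvd minor ?E (card S) \<rho> \<gamma>"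
      using DX[OF j, of "\<Sum>i<card S. fs ! i"] X_power_dvd_iff[OF nz(2)[OF j]] ord[OF j] \<rho> \<gamma> cE
      unfolding dvd_minors_def by auto
    then have "degree ?m + (\<Sum>i<card S. fs ! i) \<le> card S * d - ?W"
      unfolding mw(1) using nzm mW by (subst (asm) X_power_dvd_poly_reversal) auto
    then show ?thesis using 1 sums mW by (simp add: sum.distrib h_def)
  qed
  have "fs ! 0 = 0"
  proof -
    have "\<exists>a<m. \<exists>b<n. A $$ (a, b) \<noteq> 0"
    proof (rule ccontr)
      assume "\<not> ?thesis"
      then have "dvd_minors 1 0 A"
        using A unfolding dvd_minors_def minor_def by (auto simp: det_single)
      then show False using DE[of 1 0] dvd_minors_KEL[OF E, of 1 0] nz(1)[of 1] r0 unfolding AE by simp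
    qed
    then obtain a b where ab: "a < m" "b < n" "A $$ (a, b) \<noteq> 0" "degree (A $$ (a, b)) = d"
      using mat_degree_attained[OF A] d by blast
    have "dvd_minors 1 ([:0, 1:] ^ (fs ! 0)) (mat_reversal A)"
      using DA[of 1 "[:0, 1:] ^ (fs ! 0)"] X_power_dvd_iff[OF nz(2)[of 1]] ord[of 1] r0 by simp
    then have "[:0, 1:] ^ (fs ! 0) dvd minor (mat_reversal A) 1 (\<lambda>_. a) (\<lambda>_. b)"
      using ab rA' unfolding dvd_minors_def by auto
    also have "minor (mat_reversal A) 1 (\<lambda>_. a) (\<lambda>_. b) = poly_reversal d (A $$ (a, b))"
      using ab A d unfolding minor_def by (simp add: det_single mat_reversal_def)
    finally show ?thesis using ab X_power_dvd_poly_reversal[of "A $$ (a, b)" d "fs ! 0"] by simp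
  qed
  then show ?thesis
    using ineq total degE unfolding subset_bound_def W_def h_def by (simp add: sum.distrib)
qed

end

section \<open>Sufficiency\<close>

text \<open>If all elements of the field were roots of \<open>p\<close>, then \<open>p + 1\<close> would have none.\<close>

lemma ex_nonroot:
  fixes p :: "'a::field poly"
  assumes closed: "\<forall>p :: 'a poly. 0 < degree p \<longrightarrow> (\<exists>x. poly p x = 0)" and p: "p \<noteq> 0"
  shows "\<exists>c. poly p c \<noteq> 0"
proof (rule ccontr)
  assume all: "\<not> ?thesis"
  have "0 < degree p"
  proof (rule ccontr)
    assume "\<not> 0 < degree p"
    then obtain k where "p = [:k:]" by (auto elim: degree_eq_zeroE)
    then show False using all p by simp
  qed
  then have "0 < degree (p + 1)" by (simp add: degree_add_eq_left)
  then obtain x where "poly (p + 1) x = 0" using closed by blast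
  then show False using all by simp
qed

lemma comm_ring_hom_pcompose: "comm_ring_hom (\<lambda>p. pcompose p (q :: 'a::field poly))"
  by unfold_locales (auto simp: pcompose_add pcompose_mult pcompose_1)

lemma minor_pcompose:
  fixes M :: "'a::field poly mat"
  assumes "M \<in> carrier_mat m n" "\<rho> \<in> {0..<j} \<rightarrow> {0..<m}" "\<gamma> \<in> {0..<j} \<rightarrow> {0..<n}"
  shows "minor (map_mat (\<lambda>p. pcompose p q) M) j \<rho> \<gamma> = pcompose (minor M j \<rho> \<gamma>) q"
proof -
  interpret comm_ring_hom "\<lambda>p. pcompose p q" by (rule comm_ring_hom_pcompose)
  have "mat j j (\<lambda>(a, b). map_mat (\<lambda>p. pcompose p q) M $$ (\<rho> a, \<gamma> b)) =
      map_mat (\<lambda>p. pcompose p q) (mat j j (\<lambda>(a, b). M $$ (\<rho> a, \<gamma> b)))"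
    using assms by (intro eq_matI) (auto simp: Pi_def)
  then show ?thesis unfolding minor_def by simp
qed

lemma linear_power_dvd_pcompose:
  fixes p :: "'a::field poly"
  shows "[:- b, 1:] ^ k dvd pcompose p [:c, 1:] \<longleftrightarrow> [:- (b + c), 1:] ^ k dvd p"
proof -
  have dir: "[:- b, 1:] ^ k dvd pcompose p [:c, 1:]" if d: "[:- (b + c), 1:] ^ k dvd p" for b c and p :: "'a poly"
  proof -
    interpret comm_ring_hom "\<lambda>p. pcompose p [:c, 1:]" by (rule comm_ring_hom_pcompose)
    obtain q where q: "p = [:- (b + c), 1:] ^ k * q" using d by (elim dvdE)
    have "pcompose [:- (b + c), 1:] [:c, 1:] = [:- b, 1:]" by (simp add: pcompose_pCons)
    then have "pcompose p [:c, 1:] = [:- b, 1:] ^ k * pcompose q [:c, 1:]"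
      unfolding q by (simp only: hom_mult hom_power)
    then show ?thesis by simp
  qed
  have inv: "pcompose (pcompose p [:c, 1:]) [:- c, 1:] = p"
    by (simp add: pcompose_assoc[symmetric] pcompose_pCons)
  show ?thesis
  proof
    assume "[:- b, 1:] ^ k dvd pcompose p [:c, 1:]"
    then have "[:- ((b + c) + (- c)), 1:] ^ k dvd pcompose p [:c, 1:]" by simp
    from dir[OF this] show "[:- (b + c), 1:] ^ k dvd p" unfolding inv .
  qed (rule dir)
qed

text \<open>The substitution \<open>s = c + 1/z\<close> in \<open>\<alpha>\<close>, made into a monic polynomial in \<open>z\<close>, together with a
  zero of multiplicity \<open>f\<close> at \<open>z = 0\<close>, the point to which infinity is moved.\<close>

definition moved :: "'a::field \<Rightarrow> 'a poly \<Rightarrow> nat \<Rightarrow> 'a poly" where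
  "moved c \<alpha> f = Polynomial.smult (inverse (poly \<alpha> c)) (monom 1 f * reflect_poly (pcompose \<alpha> [:c, 1:]))"

lemma coeff_0_shift: "coeff (pcompose p [:c, 1:]) 0 = poly p (c :: 'a::field)"
  by (simp add: poly_pcompose flip: poly_0_coeff_0)

lemma degree_shift: "degree (pcompose p [:c, 1:]) = degree (p :: 'a::field poly)"
  by (simp add: degree_pcompose)

lemma moved_props:
  fixes \<alpha> :: "'a::field poly"
  assumes c: "poly \<alpha> c \<noteq> 0"
  shows "degree (moved c \<alpha> f) = degree \<alpha> + f" "lead_coeff (moved c \<alpha> f) = 1"
proof -
  let ?a = "pcompose \<alpha> [:c, 1:]"
  have 0: "coeff ?a 0 \<noteq> 0" using c by (simp add: coeff_0_shift)
  have dr: "degree (reflect_poly ?a) = degree \<alpha>" using degree_reflect_poly_eq[OF 0] by (simp add: degree_shift)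
  have lr: "lead_coeff (reflect_poly ?a) = poly \<alpha> c"
    using dr by (simp add: coeff_reflect_poly degree_shift coeff_0_shift)
  then have "reflect_poly ?a \<noteq> 0" using c by auto
  then show "degree (moved c \<alpha> f) = degree \<alpha> + f"
    using c dr by (simp add: moved_def degree_mult_eq monom_eq_0_iff degree_monom_eq)
  show "lead_coeff (moved c \<alpha> f) = 1"
    unfolding moved_def lead_coeff_smult lead_coeff_mult lr using c by (simp add: degree_monom_eq)
qed

lemma moved_dvd:
  fixes \<alpha> \<beta> :: "'a::field poly"
  assumes "\<alpha> dvd \<beta>" "f \<le> g" "poly \<beta> c \<noteq> 0"
  shows "moved c \<alpha> f dvd moved c \<beta> g"
proof -
  obtain q where q: "\<beta> = \<alpha> * q" using assms(1) by (elim dvdE)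
  have c: "poly \<alpha> c \<noteq> 0" using assms(3) q by auto
  have "monom (1::'a) f dvd monom 1 g"
    using assms(2) by (intro dvdI[of _ _ "monom 1 (g - f)"]) (simp add: mult_monom)
  moreover have "reflect_poly (pcompose \<alpha> [:c, 1:]) dvd reflect_poly (pcompose \<beta> [:c, 1:])"
    unfolding q pcompose_mult reflect_poly_mult by simp
  ultimately show ?thesis
    unfolding moved_def using c assms(3) by (simp add: smult_dvd_iff dvd_smult_iff mult_dvd_mono)
qed

lemma prod_moved:
  fixes \<alpha> :: "nat \<Rightarrow> 'a::field poly"
  assumes "\<And>i. i < j \<Longrightarrow> poly (\<alpha> i) c \<noteq> 0"
  shows "(\<Prod>i<j. moved c (\<alpha> i) (f i)) = moved c (\<Prod>i<j. \<alpha> i) (\<Sum>i<j. f i)"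
  using assms
proof (induction j)
  case 0
  show ?case by (simp add: moved_def pcompose_1 monom_0 one_pCons)
next
  case (Suc j)
  have "moved c p a * moved c q b = moved c (p * q) (a + b)" for p q :: "'a poly" and a b
  proof -
    have "monom (1::'a) (a + b) = monom 1 a * monom 1 b" by (simp add: mult_monom)
    then show ?thesis
      unfolding moved_def by (simp add: pcompose_mult reflect_poly_mult mult_ac)
  qed
  then show ?case using Suc by simp
qed

lemma X_power_dvd_moved:
  fixes \<alpha> :: "'a::field poly"
  assumes "poly \<alpha> c \<noteq> 0"
  shows "[:0, 1:] ^ k dvd moved c \<alpha> f \<longleftrightarrow> k \<le> f"
proof -
  let ?R = "reflect_poly (pcompose \<alpha> [:c, 1:])"
  have "pcompose \<alpha> [:c, 1:] \<noteq> 0" using assms coeff_0_shift[of \<alpha> c] by (metis coeff_0)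
  then have nz: "poly ?R 0 \<noteq> 0" by (simp add: poly_0_coeff_0)
  have "[:0, 1:] ^ k dvd moved c \<alpha> f \<longleftrightarrow> [:0, 1:] ^ k dvd ?R * monom 1 f"
    using assms by (simp add: moved_def dvd_smult_iff mult.commute)
  also have "\<dots> \<longleftrightarrow> [:0, 1:] ^ k dvd (monom 1 f :: 'a poly)"
    using linear_power_dvd_mult_iff[OF nz, of k "monom 1 f"] by simp
  also have "\<dots> \<longleftrightarrow> k \<le> f"
    using monom_dvd_poly_reversal[of "1 :: 'a poly" f k] poly_reversal_conv_reflect[of "1 :: 'a poly" f]
    by (simp add: monom_altdef)
  finally show ?thesis .
qed

lemma linear_power_dvd_moved:
  fixes \<alpha> :: "'a::field poly"
  assumes c: "poly \<alpha> c \<noteq> 0" and a: "a \<noteq> c"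
  shows "[:- inverse (a - c), 1:] ^ k dvd moved c \<alpha> f \<longleftrightarrow> [:- a, 1:] ^ k dvd \<alpha>"
proof -
  let ?a = "pcompose \<alpha> [:c, 1:]" and ?b = "inverse (a - c)"
  have b: "?b \<noteq> 0" using a by simp
  have nz: "poly (monom 1 f) ?b \<noteq> 0" using b by (simp add: poly_monom)
  have "[:- ?b, 1:] ^ k dvd moved c \<alpha> f \<longleftrightarrow> [:- ?b, 1:] ^ k dvd monom 1 f * reflect_poly ?a"
    using c by (simp add: moved_def dvd_smult_iff)
  also have "\<dots> \<longleftrightarrow> [:- ?b, 1:] ^ k dvd poly_reversal (degree ?a) ?a"
    unfolding linear_power_dvd_mult_iff[OF nz] by (simp add: poly_reversal_conv_reflect)
  also have "\<dots> \<longleftrightarrow> [:- (a - c), 1:] ^ k dvd ?a"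
    by (subst linear_power_dvd_poly_reversal[OF b]) auto
  also have "\<dots> \<longleftrightarrow> [:- a, 1:] ^ k dvd \<alpha>"
    using linear_power_dvd_pcompose[of "a - c" k \<alpha> c] by simp
  finally show ?thesis .
qed

lemma poly_reversal_eq_0_iff: "degree p \<le> N \<Longrightarrow> poly_reversal N p = 0 \<longleftrightarrow> p = 0"
  using poly_reversal_reversal[of p N] by auto

lemma order_cong:
  fixes p q :: "'a::field poly"
  assumes "p \<noteq> 0" "q \<noteq> 0" "\<And>k. [:- a, 1:] ^ k dvd p \<longleftrightarrow> [:- a, 1:] ^ k dvd q"
  shows "order a p = order a q"
  using assms by (metis order_divides order_refl le_antisym)

lemma monic_dvd_antisym:
  fixes p q :: "'a::field poly"
  assumes pq: "p dvd q" "q dvd p" and lc: "lead_coeff p = 1" "lead_coeff q = 1"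
  shows "p = q"
proof -
  obtain u where u: "q = p * u" using pq(1) by (elim dvdE)
  have nz: "p \<noteq> 0" "u \<noteq> 0" using lc u by auto
  have "degree q = degree p + degree u" unfolding u using nz by (rule degree_mult_eq)
  moreover have "degree q \<le> degree p" using dvd_imp_degree_le[OF pq(2) nz(1)] .
  ultimately obtain k where k: "u = [:k:]" by (auto elim: degree_eq_zeroE)
  have "k = 1" using lc unfolding u lead_coeff_mult k by simp
  then show ?thesis using u k by simp
qed

lemma nth_eq_if_prod_eq:
  fixes xs ys :: "'a::idom list"
  assumes "length xs = length ys" and "\<And>j. j \<le> length xs \<Longrightarrow> (\<Prod>i<j. xs ! i) = (\<Prod>i<j. ys ! i)"
    and "\<And>j. j \<le> length xs \<Longrightarrow> (\<Prod>i<j. xs ! i) \<noteq> 0"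
  shows "xs = ys"
proof (rule nth_equalityI)
  fix i assume i: "i < length xs"
  have "(\<Prod>k<i. xs ! k) * xs ! i = (\<Prod>k<i. xs ! k) * ys ! i"
    using assms(2)[of i] assms(2)[of "Suc i"] i by simp
  then show "xs ! i = ys ! i" using assms(3)[of i] i by simp
qed (rule assms(1))

lemma nth_eq_if_sum_eq:
  fixes xs ys :: "nat list"
  assumes "length xs = length ys" and "\<And>j. j \<le> length xs \<Longrightarrow> (\<Sum>i<j. xs ! i) = (\<Sum>i<j. ys ! i)"
  shows "xs = ys"
proof (rule nth_equalityI)
  fix i assume i: "i < length xs"
  then show "xs ! i = ys ! i" using assms(2)[of i] assms(2)[of "Suc i"] by simp
qed (rule assms(1))

text \<open>The matrix \<open>E\<close> is obtained from \<open>G\<close> by reversing every entry with respect to its degree bound and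
  shifting by \<open>c\<close>, which is the transformation \<open>z = 1/(s - c)\<close>. Its minors arise from those of
  \<open>G\<close> in the same way. Thus the multiplicity at a point \<open>a \<noteq> c\<close> is the one of \<open>G\<close> at
  \<open>1/(a - c)\<close>, and the partial multiplicities of infinity are those of \<open>G\<close> at \<open>0\<close>. The point
  \<open>c\<close> corresponds to infinity for \<open>G\<close>, where the monic diagonal of full degree makes \<open>G\<close>
  invertible.\<close>

lemma (in minimal_basis_pair) sufficiency:
  assumes closed: "\<forall>p :: 'a poly. 0 < degree p \<longrightarrow> (\<exists>x. poly p x = 0)" and r0: "0 < r"
    and len: "length \<alpha>s = r" "length fs = r" and mon: "\<forall>\<alpha>\<in>set \<alpha>s. lead_coeff \<alpha> = 1"
    and srt: "sorted_wrt (dvd) \<alpha>s" "sorted fs" and f0: "fs ! 0 = 0"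
    and mono: "\<And>i k. i \<le> k \<Longrightarrow> k < r \<Longrightarrow> \<kappa> i \<le> \<kappa> k"
    and bound: "subset_bound r d (\<lambda>i. \<kappa> i + l i) (\<lambda>i. degree (\<alpha>s ! i) + fs ! i)"
  shows "\<exists>A. A \<in> carrier_mat m n \<and> poly_rank A = r \<and> mat_degree A = d \<and>
    invariant_factors A \<alpha>s \<and> partial_multiplicities_infinity A fs \<and>
    col_range A = col_range K \<and> col_range A\<^sup>T = col_range L\<^sup>T"
proof -
  have chain: "\<alpha>s ! i dvd \<alpha>s ! k" if "i \<le> k" "k < r" for i k
    using that srt(1) len by (cases "i = k") (auto simp: sorted_wrt_iff_nth_less)
  have "\<alpha>s ! (r - 1) \<in> set \<alpha>s" using len r0 by simp
  then have "lead_coeff (\<alpha>s ! (r - 1)) = 1" using mon by blast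
  then have "\<alpha>s ! (r - 1) \<noteq> 0" by auto
  then obtain c where c: "poly (\<alpha>s ! (r - 1)) c \<noteq> 0" using ex_nonroot[OF closed] by blast
  have cnz: "poly (\<alpha>s ! i) c \<noteq> 0" if "i < r" for i
  proof -
    have "i \<le> r - 1" "r - 1 < r" using that by auto
    then show ?thesis using chain c by (metis dvd_def mult_zero_left poly_mult)
  qed
  define \<gamma>s where "\<gamma>s = map (\<lambda>i. moved c (\<alpha>s ! i) (fs ! i)) [0..<r]"
  have \<gamma>: "length \<gamma>s = r" "\<And>i. i < r \<Longrightarrow> \<gamma>s ! i = moved c (\<alpha>s ! i) (fs ! i)"
    by (auto simp: \<gamma>s_def)
  have chain\<gamma>: "\<gamma>s ! i dvd \<gamma>s ! k" if "i \<le> k" "k < r" for i k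
    using that \<gamma> chain cnz srt(2) len by (auto intro!: moved_dvd sorted_nth_mono)
  define h where "h i = \<kappa> i + l i" for i
  define e where "e i = d - h i" for i
  have hd: "h i \<le> d" if "i < r" for i
    using bound[unfolded subset_bound_def, THEN conjunct1, rule_format, of "{i}"] that by (simp add: h_def)
  have eh: "(\<Sum>i\<in>S. e i) + (\<Sum>i\<in>S. h i) = card S * d" if "S \<subseteq> {0..<r}" for S
  proof -
    have "(\<Sum>i\<in>S. e i + h i) = (\<Sum>i\<in>S. d)" using that hd by (intro sum.cong) (auto simp: e_def)
    then show ?thesis by (simp add: sum.distrib)
  qed
  have deg\<gamma>: "(\<Sum>i<j. degree (\<gamma>s ! i)) = (\<Sum>i<j. degree (\<alpha>s ! i) + fs ! i)" if "j \<le> r" for j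
    using that \<gamma> cnz by (intro sum.cong) (auto simp: moved_props)
  obtain G \<gamma>s' where mset: "mset \<gamma>s' = mset \<gamma>s" and EG: "unimod_equiv r r G (smith_mat r r \<gamma>s')"
    and diag: "\<forall>i<r. lead_coeff (G $$ (i, i)) = 1 \<and> degree (G $$ (i, i)) = e i"
    and low: "\<forall>i<r. \<forall>k<i. G $$ (i, k) = 0"
    and up: "\<forall>k<r. \<forall>i<k. G $$ (i, k) = 0 \<or> degree (G $$ (i, k)) < e k"
  proof -
    have "\<exists>G \<gamma>s'. mset \<gamma>s' = mset \<gamma>s \<and> unimod_equiv r r G (smith_mat r r \<gamma>s') \<and>
      (\<forall>i<r. lead_coeff (G $$ (i, i)) = 1 \<and> degree (G $$ (i, i)) = e i) \<and>
      (\<forall>i<r. \<forall>k<i. G $$ (i, k) = 0) \<and>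
      (\<forall>k<r. \<forall>i<k. G $$ (i, k) = 0 \<or> degree (G $$ (i, k)) < e k)"
    proof (rule exists_triangular_with_invariants[OF closed \<gamma>(1)])
      show "\<forall>\<gamma>\<in>set \<gamma>s. lead_coeff \<gamma> = 1"
      proof
        fix \<gamma> assume "\<gamma> \<in> set \<gamma>s"
        then obtain i where i: "i < r" "\<gamma> = moved c (\<alpha>s ! i) (fs ! i)" by (auto simp: \<gamma>s_def)
        show "lead_coeff \<gamma> = 1" unfolding i(2) by (rule moved_props(2)[OF cnz[OF i(1)]])
      qed
      show "sorted_wrt (dvd) \<gamma>s"
        using chain\<gamma> \<gamma>(1) by (auto simp: sorted_wrt_iff_nth_less)
      fix S assume S: "S \<subseteq> {0..<r}"
      have "card S \<le> r" using card_mono[OF _ S] by simp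
      then show "(\<Sum>i<card S. degree (\<gamma>s ! i)) \<le> (\<Sum>i\<in>S. e i)"
        using bound[unfolded subset_bound_def h_def[symmetric], THEN conjunct1, rule_format, OF S] eh[OF S] deg\<gamma>[of "card S"]
        by linarith
    next
      show "(\<Sum>i<r. degree (\<gamma>s ! i)) = (\<Sum>i = 0..<r. e i)"
        using bound eh[of "{0..<r}"] deg\<gamma>[of r] unfolding subset_bound_def h_def[symmetric] by simp
    qed
    then show ?thesis by (elim exE conjE) (rule that)
  qed
  have cG: "G \<in> carrier_mat r r" using unimod_equiv_carrier[OF EG] by simp
  have bdG: "degree_bounded d \<kappa> l G"
    unfolding degree_bounded_def
  proof (intro allI impI)
    fix i k assume "i < dim_row G" "k < dim_col G"
    then have ik: "i < r" "k < r" using cG by auto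
    consider "k < i" | "i = k" | "i < k" by linarith
    then show "G $$ (i, k) = 0 \<or> degree (G $$ (i, k)) + \<kappa> i + l k \<le> d"
    proof cases
      case 2
      then show ?thesis using diag ik hd[of i] by (simp add: e_def h_def)
    next
      case 3
      then have "G $$ (i, k) = 0 \<or> degree (G $$ (i, k)) < d - (\<kappa> k + l k)"
        using up ik unfolding e_def h_def by blast
      then show ?thesis using mono[of i k] 3 ik by auto
    qed (use low ik in simp)
  qed
  have DG: "dvd_minors j x G \<longleftrightarrow> x dvd moved c (\<Prod>i<j. \<alpha>s ! i) (\<Sum>i<j. fs ! i)" if j: "j \<le> r" for j x
  proof -
    have len': "length \<gamma>s' = r" using mset_eq_length[OF mset] \<gamma>(1) by simp
    obtain \<pi> where \<pi>: "\<pi> permutes {..<length \<gamma>s}" "permute_list \<pi> \<gamma>s = \<gamma>s'"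
      using mset_eq_permutation[OF mset] by blast
    have bij: "bij_betw \<pi> {0..<min r r} {0..<min r r}"
      using permutes_imp_bij[OF \<pi>(1)] \<gamma>(1) by (simp add: atLeast0LessThan)
    have nth: "\<gamma>s' ! i = \<gamma>s ! \<pi> i" if "i < r" for i
      using permute_list_nth[OF \<pi>(1), of i] that \<gamma>(1) \<pi>(2) by simp
    have "dvd_minors j x (smith_mat r r \<gamma>s') \<longleftrightarrow> x dvd (\<Prod>i<j. \<gamma>s ! i)"
      by (rule dvd_minors_diagonal[where \<sigma> = \<pi> and h = "\<lambda>i. \<gamma>s ! i", OF smith_mat_carrier])
        (use bij chain\<gamma> nth len' j in \<open>auto simp: smith_mat_def\<close>)
    moreover have "(\<Prod>i<j. \<gamma>s ! i) = (\<Prod>i<j. moved c (\<alpha>s ! i) (fs ! i))"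
      using j \<gamma>(2) by (intro prod.cong) auto
    ultimately show ?thesis
      using dvd_minors_unimod_equiv[OF EG] prod_moved[of j "\<lambda>i. \<alpha>s ! i" c "\<lambda>i. fs ! i"] cnz j by simp
  qed
  have Anz: "poly (\<Prod>i<j. \<alpha>s ! i) c \<noteq> 0" if "j \<le> r" for j
    using cnz that by (simp add: poly_prod)
  define H where "H = weighted_reversal d \<kappa> l G"
  define E where "E = map_mat (\<lambda>p. pcompose p [:- c, 1:]) H"
  have cH: "H \<in> carrier_mat r r" using cG by (simp add: H_def weighted_reversal_def)
  have E: "E \<in> carrier_mat r r" using cH by (simp add: E_def)
  have entry: "E $$ (i, k) = pcompose (poly_reversal (d - (\<kappa> i + l k)) (G $$ (i, k))) [:- c, 1:]"
    if "i < r" "k < r" for i k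
    using that cG by (simp add: E_def H_def weighted_reversal_def)
  have bdE: "degree_bounded d \<kappa> l E"
    unfolding degree_bounded_def
  proof (intro allI impI)
    fix i k assume "i < dim_row E" "k < dim_col E"
    then have ik: "i < r" "k < r" using E by auto
    show "E $$ (i, k) = 0 \<or> degree (E $$ (i, k)) + \<kappa> i + l k \<le> d"
    proof (cases "G $$ (i, k) = 0")
      case True
      then show ?thesis using entry[OF ik] by simp
    next
      case False
      then have "\<kappa> i + l k \<le> d" using bdG ik cG unfolding degree_bounded_def by fastforce
      moreover have "degree (E $$ (i, k)) \<le> d - (\<kappa> i + l k)"
        unfolding entry[OF ik] degree_shift by (rule degree_poly_reversal)
      ultimately show ?thesis by linarith
    qed
  qed
  let ?W = "\<lambda>j \<rho> \<gamma>. (\<Sum>a = 0..<j. \<kappa> (\<rho> a)) + (\<Sum>a = 0..<j. l (\<gamma> a))"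
  have minorE: "minor E j \<rho> \<gamma> = pcompose (poly_reversal (j * d - ?W j \<rho> \<gamma>) (minor G j \<rho> \<gamma>)) [:- c, 1:]"
    "degree (minor G j \<rho> \<gamma>) \<le> j * d - ?W j \<rho> \<gamma>"
    if "\<rho> \<in> {0..<j} \<rightarrow> {0..<r}" "\<gamma> \<in> {0..<j} \<rightarrow> {0..<r}" for j \<rho> \<gamma>
  proof -
    show "minor E j \<rho> \<gamma> = pcompose (poly_reversal (j * d - ?W j \<rho> \<gamma>) (minor G j \<rho> \<gamma>)) [:- c, 1:]"
      unfolding E_def minor_pcompose[OF cH that] by (simp only: H_def minor_weighted_reversal(1)[OF cG bdG that])
    show "degree (minor G j \<rho> \<gamma>) \<le> j * d - ?W j \<rho> \<gamma>"
      using minor_weighted_reversal(2)[OF cG bdG that] by (cases "minor G j \<rho> \<gamma> = 0") auto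
  qed
  \<comment> \<open>At \<open>c\<close> the matrix \<open>E\<close> is invertible: its leading principal minors do not vanish there.\<close>
  have principal: "poly (minor E j id id) c \<noteq> 0" if j: "j \<le> r" for j
  proof -
    have id: "id \<in> {0..<j} \<rightarrow> {0..<r}" using j by auto
    have diagj: "lead_coeff (G $$ (i, i)) = 1" "degree (G $$ (i, i)) = e i" "G $$ (i, i) \<noteq> 0" if "i < j" for i
    proof -
      have "i < r" using that j by simp
      from diag[rule_format, OF this] show 1: "lead_coeff (G $$ (i, i)) = 1" "degree (G $$ (i, i)) = e i" by blast+
      then show "G $$ (i, i) \<noteq> 0" by (metis leading_coeff_0_iff zero_neq_one)
    qed
    have g: "minor G j id id = (\<Prod>i = 0..<j. G $$ (i, i))"
      unfolding minor_def using low j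
      by (subst det_upper_triangular[of _ j]) (auto simp: upper_triangular_def prod_list_diag_prod)
    have "degree (minor G j id id) = (\<Sum>i = 0..<j. e i)"
      unfolding g using diagj by (subst degree_prod_eq_sum_degree) auto
    also have "\<dots> = j * d - ?W j id id"
      using eh[of "{0..<j}"] j by (simp add: h_def sum.distrib)
    finally have dg: "degree (minor G j id id) = j * d - ?W j id id" .
    have "lead_coeff (minor G j id id) = 1"
      unfolding g lead_coeff_prod using diagj by (intro prod.neutral) auto
    then have "coeff (poly_reversal (j * d - ?W j id id) (minor G j id id)) 0 = 1"
      unfolding dg[symmetric] by (simp add: coeff_poly_reversal)
    then show ?thesis
      unfolding minorE(1)[OF id id] by (simp add: poly_pcompose poly_0_coeff_0)
  qed
  have detE: "det E \<noteq> 0" using principal[of r] minor_id[OF E] by auto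
  define A where "A = K * E * L"
  have cA: "A \<in> carrier_mat m n" using K L E by (auto simp: A_def)
  note ranges = ranges_KEL[OF E detE, folded A_def]
  have D1: "\<not> dvd_minors 1 [:0, 1:] G"
    using DG[of 1 "[:0, 1:]"] X_power_dvd_moved[OF Anz[of 1], of 1 "fs ! 0"] r0 f0 by simp
  have degA: "mat_degree A = d"
  proof (rule antisym)
    show "mat_degree A \<le> d" unfolding A_def by (rule mat_degree_le_if_degree_bounded[OF E bdE])
    have "\<exists>i<r. \<exists>k<r. coeff (G $$ (i, k)) 0 \<noteq> 0"
    proof (rule ccontr)
      assume "\<not> ?thesis"
      then have "dvd_minors 1 [:0, 1:] G"
        using cG unfolding dvd_minors_def minor_def by (auto simp: det_single X_dvd_iff Pi_def)
      then show False using D1 by simp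
    qed
    then obtain i k where ik: "i < r" "k < r" "coeff (G $$ (i, k)) 0 \<noteq> 0" by blast
    let ?N = "d - (\<kappa> i + l k)"
    have "G $$ (i, k) \<noteq> 0" using ik by auto
    then have kl: "\<kappa> i + l k \<le> d" using bdG ik cG unfolding degree_bounded_def by fastforce
    have co: "coeff (poly_reversal ?N (G $$ (i, k))) ?N \<noteq> 0" using ik by (simp add: coeff_poly_reversal)
    then have "?N \<le> degree (E $$ (i, k))"
      unfolding entry[OF ik(1,2)] degree_shift by (rule le_degree)
    moreover have "E $$ (i, k) \<noteq> 0"
    proof
      assume "E $$ (i, k) = 0"
      then have "poly_reversal ?N (G $$ (i, k)) = 0"
        unfolding entry[OF ik(1,2)] by (subst (asm) pcompose_eq_0_iff) auto
      then show False using co by simp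
    qed
    moreover have "degree_bounded (mat_degree A) \<kappa> l E"
      using degree_bounded_if_mat_degree_le[OF E] by (simp add: A_def)
    ultimately show "d \<le> mat_degree A" using ik E kl unfolding degree_bounded_def by fastforce
  qed
  have dKEL: "mat_degree (K * E * L) = d" using degA by (simp add: A_def)
  have finite: "dvd_minors j ([:- a, 1:] ^ k) A \<longleftrightarrow> [:- a, 1:] ^ k dvd (\<Prod>i<j. \<alpha>s ! i)" if j: "j \<le> r" for j a k
  proof (cases "a = c")
    case True
    have id: "id \<in> {0..<j} \<rightarrow> {0..<r}" using j by auto
    have root: "k = 0" if "[:- c, 1:] ^ k dvd p" "poly p c \<noteq> 0" for p
    proof (rule ccontr)
      assume "k \<noteq> 0"
      then have "[:- c, 1:] dvd p" using that(1) dvd_power dvd_trans by (metis gr0I)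
      then show False using that(2) by (simp add: poly_eq_0_iff_dvd)
    qed
    have "k = 0" if "dvd_minors j ([:- c, 1:] ^ k) A"
    proof -
      have "[:- c, 1:] ^ k dvd minor E j id id"
        using that id E dvd_minors_KEL[OF E, of j] unfolding A_def dvd_minors_def by auto
      then show ?thesis using root principal[OF j] by blast
    qed
    moreover have "k = 0" if "[:- c, 1:] ^ k dvd (\<Prod>i<j. \<alpha>s ! i)"
      using root[OF that Anz[OF j]] .
    moreover have "dvd_minors j ([:- c, 1:] ^ 0) A" by (simp add: dvd_minors_def)
    ultimately show ?thesis using True by auto
  next
    case False
    have "dvd_minors j ([:- a, 1:] ^ k) A \<longleftrightarrow> dvd_minors j ([:- a, 1:] ^ k) E"
      unfolding A_def by (rule dvd_minors_KEL[OF E])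
    also have "\<dots> \<longleftrightarrow> dvd_minors j ([:- inverse (a - c), 1:] ^ k) G"
    proof (rule dvd_minors_cong[OF E cG])
      fix \<rho> \<gamma> assume rg: "\<rho> \<in> {0..<j} \<rightarrow> {0..<r}" "\<gamma> \<in> {0..<j} \<rightarrow> {0..<r}"
      have "[:- a, 1:] ^ k dvd minor E j \<rho> \<gamma> \<longleftrightarrow>
          [:- (a - c), 1:] ^ k dvd poly_reversal (j * d - ?W j \<rho> \<gamma>) (minor G j \<rho> \<gamma>)"
        unfolding minorE(1)[OF rg] linear_power_dvd_pcompose by simp
      also have "\<dots> \<longleftrightarrow> [:- inverse (a - c), 1:] ^ k dvd minor G j \<rho> \<gamma>"
        using False by (intro linear_power_dvd_poly_reversal minorE(2)[OF rg]) auto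
      finally show "[:- a, 1:] ^ k dvd minor E j \<rho> \<gamma> \<longleftrightarrow> [:- inverse (a - c), 1:] ^ k dvd minor G j \<rho> \<gamma>" .
    qed
    also have "\<dots> \<longleftrightarrow> [:- a, 1:] ^ k dvd (\<Prod>i<j. \<alpha>s ! i)"
      unfolding DG[OF j] by (rule linear_power_dvd_moved[OF Anz[OF j] False])
    finally show ?thesis .
  qed
  have "invariant_factors A \<alpha>s"
  proof -
    have "dvd_minors (Suc r) 0 A"
      using dvd_minors_zero[OF K, of "E * L" n "Suc r"] K E L by (simp add: A_def)
    moreover have "\<not> dvd_minors r 0 A"
      using dvd_minors_KEL[OF E, of r 0] dvd_minors_det[OF E, of 0] detE by (auto simp: A_def)
    ultimately obtain \<beta>s where \<beta>: "invariant_factors A \<beta>s" "length \<beta>s = r" "\<forall>\<beta>\<in>set \<beta>s. lead_coeff \<beta> = 1"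
      "\<And>j x. j \<le> r \<Longrightarrow> dvd_minors j x A \<longleftrightarrow> x dvd (\<Prod>i<j. \<beta>s ! i)"
      using invariant_factors_exist[OF cA ranges(3)] r by (metis min.bounded_iff)
    have "(\<Prod>i<j. \<alpha>s ! i) = (\<Prod>i<j. \<beta>s ! i)" if j: "j \<le> r" for j
    proof -
      note ma = monic_prod[OF mon, of j] and mb = monic_prod[OF \<beta>(3), of j]
      have nz: "(\<Prod>i<j. \<alpha>s ! i) \<noteq> 0" "(\<Prod>i<j. \<beta>s ! i) \<noteq> 0" using ma(2) mb(2) j len \<beta>(2) by auto
      have ord: "order a (\<Prod>i<j. \<alpha>s ! i) = order a (\<Prod>i<j. \<beta>s ! i)" for a
        using finite[OF j] \<beta>(4)[OF j] by (intro order_cong nz) blast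
      have "(\<Prod>i<j. \<alpha>s ! i) dvd (\<Prod>i<j. \<beta>s ! i)" "(\<Prod>i<j. \<beta>s ! i) dvd (\<Prod>i<j. \<alpha>s ! i)"
        using ord by (intro dvd_if_order_le[OF closed] nz; simp)+
      then show ?thesis using ma(1) mb(1) j len \<beta>(2) by (intro monic_dvd_antisym) auto
    qed
    then have "\<alpha>s = \<beta>s"
      using len \<beta>(2) monic_prod(2)[OF mon] by (intro nth_eq_if_prod_eq) auto
    then show ?thesis using \<beta>(1) by simp
  qed
  let ?E = "weighted_reversal d \<kappa> l E"
  have cE: "?E \<in> carrier_mat r r" using E by (simp add: weighted_reversal_def)
  have infinity: "dvd_minors j ([:0, 1:] ^ k) (mat_reversal A) \<longleftrightarrow> k \<le> (\<Sum>i<j. fs ! i)" if j: "j \<le> r" for j k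
  proof -
    have "dvd_minors j ([:0, 1:] ^ k) (mat_reversal A) \<longleftrightarrow> dvd_minors j ([:0, 1:] ^ k) ?E"
      using dvd_minors_reversal_KEL[OF E dKEL, of j k] by (simp add: A_def)
    also have "\<dots> \<longleftrightarrow> dvd_minors j ([:0, 1:] ^ k) G"
    proof (rule dvd_minors_cong[OF cE cG])
      fix \<rho> \<gamma> assume rg: "\<rho> \<in> {0..<j} \<rightarrow> {0..<r}" "\<gamma> \<in> {0..<j} \<rightarrow> {0..<r}"
      let ?N = "j * d - ?W j \<rho> \<gamma>" and ?g = "minor G j \<rho> \<gamma>"
      define p where "p = poly_reversal ?N ?g"
      have dp: "degree p \<le> ?N" unfolding p_def by (rule degree_poly_reversal)
      have g: "poly_reversal ?N p = ?g" unfolding p_def by (rule poly_reversal_reversal[OF minorE(2)[OF rg]])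
      have m: "minor ?E j \<rho> \<gamma> = poly_reversal ?N (pcompose p [:- c, 1:])"
        using minor_weighted_reversal(1)[OF E bdE rg] minorE(1)[OF rg] unfolding p_def by (rule trans[OF _ arg_cong])
      have "degree (pcompose p [:- c, 1:]) \<le> ?N" unfolding degree_shift by (rule dp)
      then have "[:0, 1:] ^ k dvd minor ?E j \<rho> \<gamma> \<longleftrightarrow> pcompose p [:- c, 1:] = 0 \<or> degree (pcompose p [:- c, 1:]) + k \<le> ?N"
        unfolding m by (rule X_power_dvd_poly_reversal)
      also have "\<dots> \<longleftrightarrow> p = 0 \<or> degree p + k \<le> ?N"
        unfolding degree_shift using pcompose_eq_0_iff[of "[:- c, 1:]" p] by simp
      also have "\<dots> \<longleftrightarrow> [:0, 1:] ^ k dvd ?g"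
        unfolding g[symmetric] by (rule X_power_dvd_poly_reversal[OF dp, symmetric])
      finally show "[:0, 1:] ^ k dvd minor ?E j \<rho> \<gamma> \<longleftrightarrow> [:0, 1:] ^ k dvd ?g" .
    qed
    also have "\<dots> \<longleftrightarrow> k \<le> (\<Sum>i<j. fs ! i)"
      unfolding DG[OF j] by (rule X_power_dvd_moved[OF Anz[OF j]])
    finally show ?thesis .
  qed
  have "partial_multiplicities_infinity A fs"
  proof -
    have cR: "mat_reversal A \<in> carrier_mat m n" using cA by (simp add: mat_reversal_def)
    have "det ?E \<noteq> 0"
      using det_weighted_reversal[OF E bdE] detE by (subst det_weighted_reversal(1)[OF E bdE], subst poly_reversal_eq_0_iff) auto
    then have rank: "poly_rank (mat_reversal A) = r"
      using rank_reversal_KEL[OF E dKEL] by (simp add: A_def)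
    have R: "column_reversal K \<in> carrier_mat m r" "?E * (column_reversal L\<^sup>T)\<^sup>T \<in> carrier_mat r n"
      and S: "(column_reversal L\<^sup>T)\<^sup>T \<in> carrier_mat r n"
      using K L cE by (auto simp: column_reversal_def)
    have "mat_reversal A = column_reversal K * (?E * (column_reversal L\<^sup>T)\<^sup>T)"
      using mat_reversal_KEL[OF E dKEL] assoc_mult_mat[OF R(1) cE S] by (simp add: A_def)
    then have "dvd_minors (Suc r) 0 (mat_reversal A)"
      using dvd_minors_zero[OF R, of "Suc r"] by simp
    moreover have "\<not> dvd_minors r 0 (mat_reversal A)"
    proof
      assume "dvd_minors r 0 (mat_reversal A)"
      then have "dvd_minors r ([:0, 1:] ^ Suc (\<Sum>i<r. fs ! i)) (mat_reversal A)"
        by (rule dvd_minors_dvd) simp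
      then show False using infinity[of r "Suc (\<Sum>i<r. fs ! i)"] by simp
    qed
    ultimately obtain \<beta>s where \<beta>: "invariant_factors (mat_reversal A) \<beta>s" "length \<beta>s = r" "\<forall>\<beta>\<in>set \<beta>s. lead_coeff \<beta> = 1"
      "\<And>j x. j \<le> r \<Longrightarrow> dvd_minors j x (mat_reversal A) \<longleftrightarrow> x dvd (\<Prod>i<j. \<beta>s ! i)"
      using invariant_factors_exist[OF cR rank] r by (metis min.bounded_iff)
    have "fs = map (order 0) \<beta>s"
    proof (rule nth_eq_if_sum_eq)
      fix j assume "j \<le> length fs"
      then have j: "j \<le> r" using len by simp
      have nz: "(\<Prod>i<j. \<beta>s ! i) \<noteq> 0" using monic_prod(2)[OF \<beta>(3), of j] j \<beta>(2) by simp
      have "k \<le> order 0 (\<Prod>i<j. \<beta>s ! i) \<longleftrightarrow> k \<le> (\<Sum>i<j. fs ! i)" for k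
        using infinity[OF j, of k] \<beta>(4)[OF j, of "[:0, 1:] ^ k"] X_power_dvd_iff[OF nz, of k] by simp
      then have "order 0 (\<Prod>i<j. \<beta>s ! i) = (\<Sum>i<j. fs ! i)" by (metis le_antisym order_refl)
      then show "(\<Sum>i<j. fs ! i) = (\<Sum>i<j. map (order 0) \<beta>s ! i)"
        using order_prod_list[OF \<beta>(3), of j 0] j \<beta>(2) by simp
    qed (use len \<beta>(2) in simp)
    then show ?thesis using \<beta>(1) unfolding partial_multiplicities_infinity_def by blast
  qed
  then show ?thesis
    using cA ranges degA \<open>invariant_factors A \<alpha>s\<close> by blast
qed

section \<open>Majorization and reordering\<close>

text \<open>With equal totals, bounding the sums of the largest elements from above is bounding the sums of the
  smallest elements from below.\<close>

lemma majorized_rev_iff: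
  assumes len: "length xs = length ys"
  shows "rev xs \<prec>\<^sub>m rev ys \<longleftrightarrow>
    (\<forall>j\<le>length xs. sum_list (take j ys) \<le> sum_list (take j xs)) \<and> sum_list xs = sum_list ys"
proof -
  have split: "sum_list (take k (rev zs)) = sum_list zs - sum_list (take (length zs - k) zs)" for k and zs :: "int list"
  proof -
    have "sum_list zs = sum_list (take (length zs - k) zs) + sum_list (drop (length zs - k) zs)"
      by (metis append_take_drop_id sum_list_append)
    moreover have "take k (rev zs) = rev (drop (length zs - k) zs)"
      by (simp add: take_rev)
    ultimately show ?thesis by (simp add: sum_list_rev)
  qed
  show ?thesis
  proof
    assume "rev xs \<prec>\<^sub>m rev ys"
    then have maj: "\<And>k. 1 \<le> k \<Longrightarrow> k < length xs \<Longrightarrow> sum_list (take k (rev xs)) \<le> sum_list (take k (rev ys))"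
      and tot: "sum_list xs = sum_list ys"
      unfolding majorized_def by (auto simp: sum_list_rev)
    have "sum_list (take j ys) \<le> sum_list (take j xs)" if j: "j \<le> length xs" for j
    proof -
      consider "j = 0" | "j = length xs" | "1 \<le> length xs - j" "length xs - j < length xs" using j by linarith
      then show ?thesis
      proof cases
        case 3
        then show ?thesis using maj[of "length xs - j"] j tot len unfolding split by simp
      qed (use tot len in auto)
    qed
    then show "(\<forall>j\<le>length xs. sum_list (take j ys) \<le> sum_list (take j xs)) \<and> sum_list xs = sum_list ys"
      using tot by simp
  next
    assume "(\<forall>j\<le>length xs. sum_list (take j ys) \<le> sum_list (take j xs)) \<and> sum_list xs = sum_list ys"
    then show "rev xs \<prec>\<^sub>m rev ys"
      unfolding majorized_def split using len by (auto simp: sum_list_rev)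
  qed
qed

lemma sum_le_prefix_sum:
  fixes g :: "nat \<Rightarrow> nat"
  assumes "finite T" and "\<And>i k. i \<le> k \<Longrightarrow> k \<in> T \<Longrightarrow> g k \<le> g i"
  shows "(\<Sum>i\<in>T. g i) \<le> (\<Sum>i<card T. g i)"
  using assms
proof (induction "card T" arbitrary: T)
  case 0
  then show ?case by auto
next
  case (Suc c)
  define t where "t = Max T"
  have "T \<noteq> {}" using Suc.hyps by auto
  then have t: "t \<in> T" using Suc.prems t_def by auto
  have c: "card (T - {t}) = c" using t Suc by auto
  have "T \<subseteq> {..t}" using Suc.prems(1) t_def by auto
  then have "card T \<le> Suc t" by (metis card_atMost card_mono finite_atMost)
  then have 1: "g t \<le> g c" using Suc.hyps Suc.prems(2) t by simp
  have 2: "(\<Sum>i\<in>T - {t}. g i) \<le> (\<Sum>i<card (T - {t}). g i)"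
    by (rule Suc.hyps) (use Suc.prems c in auto)
  have "(\<Sum>i<card T. g i) = (\<Sum>i<c. g i) + g c" by (simp add: Suc.hyps(2)[symmetric])
  then show ?case using sum.remove[OF Suc.prems(1) t, of g] 1 2 c by simp
qed

text \<open>Among all subsets of a given size the first elements of the decreasing rearrangement have the
  largest sum, so the condition on subsets is the one on prefixes of \<open>gs\<close>.\<close>

lemma subset_bound_iff_majorized:
  assumes len: "length hs = r" "length ys = r" and gs: "sorted_wrt (\<ge>) gs" "mset gs = mset hs"
  shows "subset_bound r d (\<lambda>i. hs ! i) (\<lambda>i. ys ! i) \<longleftrightarrow>
    rev (map (\<lambda>g. int d - int g) gs) \<prec>\<^sub>m rev (map int ys)"
proof -
  have leng: "length gs = r" using mset_eq_length[OF gs(2)] len by simp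
  obtain \<pi> where \<pi>: "\<pi> permutes {..<r}" "permute_list \<pi> hs = gs"
    using mset_eq_permutation[OF gs(2)] len by metis
  have nth: "gs ! i = hs ! \<pi> i" if "i < r" for i
    using permute_list_nth[of \<pi> hs i] \<pi> that len by simp
  have anti: "gs ! k \<le> gs ! i" if "i \<le> k" "k < r" for i k
    using that gs(1) leng by (cases "i = k") (auto simp: sorted_wrt_iff_nth_less)
  have inj: "inj_on \<pi> T" for T using permutes_inj[OF \<pi>(1)] inj_on_subset by blast
  have image: "(\<Sum>i\<in>\<pi> ` T. hs ! i) = (\<Sum>i\<in>T. gs ! i)" if "T \<subseteq> {0..<r}" for T
    unfolding sum.reindex[OF inj] comp_def using that nth by (intro sum.cong) auto
  have takeg: "sum_list (take j (map (\<lambda>g. int d - int g) gs)) = int (j * d) - int (\<Sum>i<j. gs ! i)" if "j \<le> r" for j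
  proof -
    have "sum_list (take j (map (\<lambda>g. int d - int g) gs)) = (\<Sum>i = 0..<j. int d - int (gs ! i))"
      using that leng by (simp add: sum_list_sum_nth)
    then show ?thesis by (simp add: sum_subtractf atLeast0LessThan)
  qed
  have takey: "sum_list (take j (map int ys)) = int (\<Sum>i<j. ys ! i)" if "j \<le> r" for j
    using that len by (simp add: sum_list_sum_nth atLeast0LessThan)
  have "rev (map (\<lambda>g. int d - int g) gs) \<prec>\<^sub>m rev (map int ys) \<longleftrightarrow>
      (\<forall>j\<le>r. (\<Sum>i<j. ys ! i) + (\<Sum>i<j. gs ! i) \<le> j * d) \<and> (\<Sum>i<r. ys ! i) + (\<Sum>i<r. gs ! i) = r * d"
  proof -
    have tot: "sum_list (map (\<lambda>g. int d - int g) gs) = int (r * d) - int (\<Sum>i<r. gs ! i)"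
      "sum_list (map int ys) = int (\<Sum>i<r. ys ! i)"
      using takeg[of r] takey[of r] leng len by simp_all
    have le: "sum_list (take j (map int ys)) \<le> sum_list (take j (map (\<lambda>g. int d - int g) gs)) \<longleftrightarrow>
        (\<Sum>i<j. ys ! i) + (\<Sum>i<j. gs ! i) \<le> j * d" if "j \<le> r" for j
      unfolding takeg[OF that] takey[OF that] by linarith
    have eq: "sum_list (map (\<lambda>g. int d - int g) gs) = sum_list (map int ys) \<longleftrightarrow>
        (\<Sum>i<r. ys ! i) + (\<Sum>i<r. gs ! i) = r * d"
      unfolding tot by linarith
    have len': "length (map (\<lambda>g. int d - int g) gs) = length (map int ys)" "length (map (\<lambda>g. int d - int g) gs) = r"
      using leng len by auto
    show ?thesis
      unfolding majorized_rev_iff[OF len'(1)] len'(2) eq using le by blast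
  qed
  also have "\<dots> \<longleftrightarrow> subset_bound r d (\<lambda>i. hs ! i) (\<lambda>i. ys ! i)"
  proof -
    have full: "(\<Sum>i<r. gs ! i) = (\<Sum>i = 0..<r. hs ! i)"
      using image[of "{0..<r}"] permutes_image[OF \<pi>(1)] by (simp add: atLeast0LessThan)
    have "(\<forall>j\<le>r. (\<Sum>i<j. ys ! i) + (\<Sum>i<j. gs ! i) \<le> j * d) \<longleftrightarrow>
        (\<forall>S. S \<subseteq> {0..<r} \<longrightarrow> (\<Sum>i<card S. ys ! i) + (\<Sum>i\<in>S. hs ! i) \<le> card S * d)"
    proof (intro iffI allI impI)
      fix S assume bound: "\<forall>j\<le>r. (\<Sum>i<j. ys ! i) + (\<Sum>i<j. gs ! i) \<le> j * d" and S: "S \<subseteq> {0..<r}"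
      define T where "T = inv_into UNIV \<pi> ` S"
      have T: "T \<subseteq> {0..<r}"
        using S permutes_image[OF permutes_inv[OF \<pi>(1)]] unfolding T_def by (metis atLeast0LessThan image_mono)
      have ST: "\<pi> ` T = S"
        unfolding T_def image_image using permutes_inverses(1)[OF \<pi>(1)] by simp
      have card: "card T = card S" using ST card_image[OF inj, of T] by metis
      have j: "card S \<le> r" using card_mono[OF _ S] by simp
      have "(\<Sum>i\<in>S. hs ! i) = (\<Sum>i\<in>T. gs ! i)" using image[OF T] ST by simp
      also have "\<dots> \<le> (\<Sum>i<card S. gs ! i)"
        unfolding card[symmetric] using T anti finite_subset[OF T] by (intro sum_le_prefix_sum) auto
      finally show "(\<Sum>i<card S. ys ! i) + (\<Sum>i\<in>S. hs ! i) \<le> card S * d"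
        using bound j by fastforce
    next
      fix j assume bound: "\<forall>S. S \<subseteq> {0..<r} \<longrightarrow> (\<Sum>i<card S. ys ! i) + (\<Sum>i\<in>S. hs ! i) \<le> card S * d" and j: "j \<le> r"
      have "{0..<j} \<subseteq> {0..<r}" using j by auto
      then have "\<pi> ` {0..<j} \<subseteq> {0..<r}"
        using permutes_image[OF \<pi>(1)] by (metis atLeast0LessThan image_mono)
      moreover have "card (\<pi> ` {0..<j}) = j" using card_image[OF inj] by simp
      moreover have "(\<Sum>i\<in>\<pi> ` {0..<j}. hs ! i) = (\<Sum>i<j. gs ! i)"
        using image[of "{0..<j}"] j by (simp add: atLeast0LessThan)
      ultimately show "(\<Sum>i<j. ys ! i) + (\<Sum>i<j. gs ! i) \<le> j * d"
        using bound by metis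
    qed
    then show ?thesis unfolding subset_bound_def full by simp
  qed
  finally show ?thesis by simp
qed

lemma reorder_minimal_basis:
  fixes N :: "'a::field poly mat"
  assumes N: "N \<in> carrier_mat p r" and min: "minimal_basis_mat N" and ks: "mset ks = mset (column_degrees N)"
  obtains N' where "N' \<in> carrier_mat p r" "minimal_basis_mat N'" "col_range N' = col_range N"
    "\<And>i. i < r \<Longrightarrow> vec_degree (col N' i) = ks ! i" "length ks = r"
proof -
  have lc: "length (cols N) = r" using N by simp
  have leng: "length ks = r" using mset_eq_length[OF ks] lc by (simp add: column_degrees_def)
  obtain \<pi> where \<pi>: "\<pi> permutes {..<length (column_degrees N)}" "permute_list \<pi> (column_degrees N) = ks"
    using mset_eq_permutation[OF ks] by blast
  have \<pi>': "\<pi> permutes {..<length (cols N)}" using \<pi>(1) by (simp add: column_degrees_def)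
  define vs where "vs = permute_list \<pi> (cols N)"
  have ms: "mset vs = mset (cols N)" unfolding vs_def using \<pi>' by (rule mset_permute_list)
  then have set: "set vs = set (cols N)" by (rule mset_eq_setD)
  have deg: "map vec_degree vs = ks"
    unfolding vs_def using \<pi>(2) permute_list_map[OF \<pi>', of vec_degree] by (simp add: column_degrees_def)
  have len: "length vs = r" using mset_eq_length[OF ms] lc by simp
  have sub: "set vs \<subseteq> carrier_vec p" unfolding set using N cols_dim by blast
  define N' where "N' = mat_of_cols p vs"
  have c: "N' \<in> carrier_mat p r" unfolding N'_def len[symmetric] by (rule mat_of_cols_carrier)
  have cols: "cols N' = vs" unfolding N'_def using sub by (rule cols_mat_of_cols)
  have cf: "set (cols (fract_mat M)) = fract_vec ` set (cols M)" for M :: "'a poly mat"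
  proof -
    have "cols (fract_mat M) = map fract_vec (cols M)" by (rule nth_equalityI) auto
    then show ?thesis by simp
  qed
  have range: "col_range N' = col_range N"
    using N c cf[of N'] cf[of N] cols set unfolding col_range_def vec_space.col_space_def by simp
  have dist: "distinct vs \<longleftrightarrow> distinct (cols N)" using ms by (rule mset_eq_imp_distinct_iff)
  have order: "basis_order vs = basis_order (cols N)"
    unfolding basis_order_def using ms by (metis mset_map sum_mset_sum_list)
  have "minimal_basis_mat N'"
    using min N c unfolding minimal_basis_mat_def minimal_basis_def polynomial_basis_def range cols
    by (simp add: set dist order)
  moreover have "vec_degree (col N' i) = ks ! i" if "i < r" for i
  proof -
    have "col N' i = vs ! i" using that len cols c by (metis carrier_matD(2) cols_nth)
    then show ?thesis using deg that len by auto
  qed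
  ultimately show ?thesis using that c range leng by blast
qed

theorem theorem5p1:
  fixes m n r d :: nat
    and \<alpha>s :: "'a::field poly list"
    and fs ks ls gs :: "nat list"
    and K L :: "'a poly mat"
  assumes "0 < m" and "0 < n" and "0 < r" and "r \<le> min m n"
    and "length \<alpha>s = r" and "\<forall>\<alpha>\<in>set \<alpha>s. lead_coeff \<alpha> = 1" and "sorted_wrt (dvd) \<alpha>s"
    and "length fs = r" and "sorted fs"
    and "K \<in> carrier_mat m r" and "minimal_basis_mat K"
    and "L \<in> carrier_mat r n" and "minimal_basis_mat L\<^sup>T"
    and "sorted_wrt (\<ge>) ks" and "mset ks = mset (column_degrees K)"
    and "sorted_wrt (\<ge>) ls" and "mset ls = mset (column_degrees L\<^sup>T)"
    and "sorted_wrt (\<ge>) gs" and "mset gs = mset (map2 (+) (rev ks) ls)"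
  shows
    "(\<forall>A. A \<in> carrier_mat m n \<and> poly_rank A = r \<and> mat_degree A = d \<and>
          invariant_factors A \<alpha>s \<and> partial_multiplicities_infinity A fs \<and>
          col_range A = col_range K \<and> col_range A\<^sup>T = col_range L\<^sup>T \<longrightarrow>
        fs ! 0 = 0 \<and>
        rev (map (\<lambda>g. int d - int g) gs) \<prec>\<^sub>m rev (map2 (\<lambda>\<alpha> f. int (degree \<alpha> + f)) \<alpha>s fs)) \<and>
     ((\<forall>p :: 'a poly. 0 < degree p \<longrightarrow> (\<exists>x. poly p x = 0)) \<longrightarrow>
        fs ! 0 = 0 \<and>
        rev (map (\<lambda>g. int d - int g) gs) \<prec>\<^sub>m rev (map2 (\<lambda>\<alpha> f. int (degree \<alpha> + f)) \<alpha>s fs) \<longrightarrow>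
        (\<exists>A. A \<in> carrier_mat m n \<and> poly_rank A = r \<and> mat_degree A = d \<and>
          invariant_factors A \<alpha>s \<and> partial_multiplicities_infinity A fs \<and>
          col_range A = col_range K \<and> col_range A\<^sup>T = col_range L\<^sup>T))"
proof -
  have "mset (rev ks) = mset (column_degrees K)" using assms(15) by simp
  then obtain K' where K': "K' \<in> carrier_mat m r" "minimal_basis_mat K'" "col_range K' = col_range K"
    "\<And>i. i < r \<Longrightarrow> vec_degree (col K' i) = rev ks ! i" "length (rev ks) = r"
    using reorder_minimal_basis[OF assms(10,11)] by metis
  have "L\<^sup>T \<in> carrier_mat n r" using assms(12) by simp
  then obtain N where N: "N \<in> carrier_mat n r" "minimal_basis_mat N" "col_range N = col_range L\<^sup>T"
    "\<And>i. i < r \<Longrightarrow> vec_degree (col N i) = ls ! i" "length ls = r"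
    using reorder_minimal_basis[OF _ assms(13,17)] by metis
  define \<kappa> where "\<kappa> i = rev ks ! i" for i
  define l where "l i = ls ! i" for i
  interpret minimal_basis_pair m n r K' "N\<^sup>T" \<kappa> l
    using assms(4) K' N by unfold_locales (auto simp: \<kappa>_def l_def)
  have mono: "\<kappa> i \<le> \<kappa> k" if "i \<le> k" "k < r" for i k
  proof -
    have "sorted (rev ks)" using assms(14) by (simp add: sorted_wrt_rev)
    then show ?thesis using that K'(5) by (simp add: \<kappa>_def sorted_nth_mono)
  qed
  have anti: "l k \<le> l i" if "i \<le> k" "k < r" for i k
    using that assms(16) N(5) unfolding l_def by (cases "i = k") (auto simp: sorted_wrt_iff_nth_less)
  let ?hs = "map2 (+) (rev ks) ls" and ?ys = "map2 (\<lambda>\<alpha> f. degree \<alpha> + f) \<alpha>s fs"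
  have lens: "length ?hs = r" "length ?ys = r" using K'(5) N(5) assms(5,8) by auto
  have ints: "map2 (\<lambda>\<alpha> f. int (degree \<alpha> + f)) \<alpha>s fs = map int ?ys" by (simp add: comp_def case_prod_beta)
  have cond: "subset_bound r d (\<lambda>i. ?hs ! i) (\<lambda>i. ?ys ! i) \<longleftrightarrow>
      subset_bound r d (\<lambda>i. \<kappa> i + l i) (\<lambda>i. degree (\<alpha>s ! i) + fs ! i)"
  proof -
    have h: "(\<Sum>i\<in>S. ?hs ! i) = (\<Sum>i\<in>S. \<kappa> i + l i)" if "S \<subseteq> {0..<r}" for S
      using that K'(5) N(5) by (intro sum.cong) (auto simp: \<kappa>_def l_def)
    have y: "(\<Sum>i<j. ?ys ! i) = (\<Sum>i<j. degree (\<alpha>s ! i) + fs ! i)" if "j \<le> r" for j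
      using that assms(5,8) by (intro sum.cong) auto
    have "card S \<le> r" if "S \<subseteq> {0..<r}" for S using card_mono[OF _ that] by simp
    then show ?thesis unfolding subset_bound_def using h y by auto
  qed
  have maj: "rev (map (\<lambda>g. int d - int g) gs) \<prec>\<^sub>m rev (map2 (\<lambda>\<alpha> f. int (degree \<alpha> + f)) \<alpha>s fs) \<longleftrightarrow>
      subset_bound r d (\<lambda>i. \<kappa> i + l i) (\<lambda>i. degree (\<alpha>s ! i) + fs ! i)"
    unfolding ints cond[symmetric] by (rule subset_bound_iff_majorized[OF lens assms(18,19), symmetric])
  have ranges: "col_range K = col_range K'" "col_range L\<^sup>T = col_range (N\<^sup>T)\<^sup>T" using K'(3) N(3) by simp_all
  show ?thesis
    unfolding maj ranges
    using necessity[OF _ _ _ assms(5) _ assms(8) _ _ assms(3) mono anti]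
      sufficiency[OF _ assms(3,5,8,6,7,9) _ mono] by blast
qed

end
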